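(* Let $\xi=\frac{\pi-2}{9\pi-2}$ and fix $\varepsilon\in(0,\xi]$. There exist numbers $c=c(\varepsilon)>0$ and $\kappa=\kappa(\varepsilon)>0$ such that for every odd prime $p$, every $\theta\in\{1,-1\}$, and every real $$ y\ge p^{1/(4\sqrt{e})}\exp\big(c(\log p)^{1-\varepsilon}\big), $$ we have $$ \#\{n\in\mathbb{N}: n\le y,\ (n|p)=\theta\}\ \ge\ \kappa\,\frac{y}{(\log y)^{\varepsilon}}. $$
   Context: For an odd prime $p$, $(\cdot|p)$ denotes the Legendre symbol. *)

theory Defs
  imports Complex_Main "HOL-Number_Theory.Number_Theory"
begin

definition xi :: real where
  "xi = (pi - 2) / (9 * pi - 2)"

end

theory Submission
  imports Defs "HOL-Computational_Algebra.Computational_Algebra" "HOL-Library.Cardinality"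
    "HOL-Number_Theory.Prime_Powers" "HOL-Real_Asymp.Real_Asymp"
begin

text \<open>Write \<chi> for the Legendre symbol, L for log p and T(x) for the sum of 1/q over the primes q \<le> x with
  \<chi>(q) = -1. A non-residue has a prime factor that is a non-residue, so Burgess' bound at
  x = p^(1/4) exp(L^(1-\<epsilon>)) gives T(x) \<ge> 1/2 - O(L^(-\<epsilon>)); Mertens' theorem then leaves T(y) \<ge> L^(-\<epsilon>) for
  every admissible y (Vinogradov). If T(y) \<le> 1/8, at least a quarter of the m \<le> z are residues for each z \<le> y, and the
  products q m of a non-residue prime and a residue give at least a constant times y T(y) non-residues. Otherwise let z be
  the point where T reaches 1/16. Both signs have positive proportion near z; this spreads to a range
  of smooth numbers beyond z by multiplying with primes, and then to y by writing n = a b with a smooth and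
  b rough, since for a positive proportion of n the smooth part a lies in that range.

  Burgess' bound is needed with a number of moments growing like L^\<epsilon>, hence with the Weil bound for
  products of linear factors, for which Stepanov's method suffices.\<close>

section \<open>Stepanov's method\<close>

text \<open>The number r of moments grows with p, so no bound may hide a dependence on r: Stepanov's
  bound must be linear in the degree with an absolute constant, and the diagonal lists in the 2r-th
  moment must be counted explicitly.

  The bound \<epsilon> <= 1/8 keeps L^(1-2\<epsilon>) unbounded: with x = p^(1/4) exp(u), u =
  L^(1-\<epsilon>) and r near L^\<epsilon>, Burgess' method saves a factor
  exp(-L^(1-2\<epsilon>)/4), far below v = L^(-\<epsilon>). Since u = L v, the factor exp(c u) in y
  changes ln x / ln y by a relative amount of order c v; a large constant c therefore beats all
  errors of order v.

  For large T(y) nothing is known about where the non-residue primes lie, and y may be far beyond z.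
  Smooth numbers make the transport uniform: a number below w^6 has boundedly many prime factors
  above w^(1/4), so each multiplication by primes loses only an absolute factor, and a bounded
  number of steps reaches w^6. The splitting into smooth and rough part then covers every larger y
  at once.\<close>

lemma finite_field_nontrivial_kernel:
  fixes \<Phi> :: "('i \<Rightarrow> 'a::finite_field) \<Rightarrow> 'e \<Rightarrow> 'a"
  assumes fin: "finite I" "finite E" and card: "card E < card I"
    and lin: "\<And>u v e. \<Phi> (\<lambda>i. u i - v i) e = \<Phi> u e - \<Phi> v e"
  shows "\<exists>v. (\<exists>i\<in>I. v i \<noteq> 0) \<and> (\<forall>i. i \<notin> I \<longrightarrow> v i = 0) \<and> (\<forall>e\<in>E. \<Phi> v e = 0)"
proof -
  define V where "V = (\<lambda>g i. if i \<in> I then g i else 0 :: 'a) ` (PiE I (\<lambda>_. UNIV))"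
  define F where "F = (\<lambda>v. restrict (\<Phi> v) E)"
  have "inj_on (\<lambda>g i. if i \<in> I then g i else 0 :: 'a) (PiE I (\<lambda>_. UNIV))"
  proof (rule inj_onI)
    fix g h :: "'i \<Rightarrow> 'a" assume gh: "g \<in> PiE I (\<lambda>_. UNIV)" "h \<in> PiE I (\<lambda>_. UNIV)"
      and eq: "(\<lambda>i. if i \<in> I then g i else 0) = (\<lambda>i. if i \<in> I then h i else 0)"
    show "g = h"
    proof (rule PiE_ext[OF gh])
      show "g i = h i" if "i \<in> I" for i using fun_cong[OF eq, of i] that by simp
    qed
  qed
  then have cV: "card V = CARD('a) ^ card I"
    unfolding V_def by (simp add: card_image card_PiE fin)
  have "F ` V \<subseteq> PiE E (\<lambda>_. UNIV)" by (auto simp: F_def)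
  then have "card (F ` V) \<le> CARD('a) ^ card E"
    using card_mono[of "PiE E (\<lambda>_. UNIV :: 'a set)" "F ` V"] fin by (simp add: card_PiE finite_PiE)
  also have "\<dots> < CARD('a) ^ card I"
  proof (rule power_strict_increasing[OF card])
    have "card {0, 1 :: 'a} \<le> CARD('a)" by (rule card_mono) auto
    then show "1 < CARD('a)" by simp
  qed
  \<comment> \<open>Counting replaces linear algebra: two vectors share their image, and their
    difference is the required kernel element. Compatibility with differences is all the linearity
    that this takes.\<close>
  finally have "card (F ` V) < card V" by (simp add: cV)
  then have "\<not> inj_on F V" using pigeonhole by blast
  then obtain u v where uv: "u \<in> V" "v \<in> V" "u \<noteq> v" "F u = F v" unfolding inj_on_def by blast
  have supp: "\<And>i. i \<notin> I \<Longrightarrow> u i = 0 \<and> v i = 0" using uv unfolding V_def by auto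
  show ?thesis
  proof (intro exI[of _ "\<lambda>i. u i - v i"] conjI ballI allI impI)
    obtain i where "u i \<noteq> v i" using uv(3) by blast
    moreover from this have "i \<in> I" using supp[of i] by metis
    ultimately show "\<exists>i\<in>I. u i - v i \<noteq> 0" by auto
    show "\<Phi> (\<lambda>i. u i - v i) e = 0" if "e \<in> E" for e
      using fun_cong[OF uv(4), of e] that by (simp add: F_def lin)
  qed (use supp in auto)
qed

lemma poly_pderiv_iter_linear_power:
  fixes h :: "'a::idom poly"
  shows "poly ((pderiv ^^ e) ([:-x, 1:] ^ e * h)) x = of_nat (fact e) * poly h x"
proof (induction e arbitrary: h)
  case (Suc e)
  have d: "pderiv ([:-x, 1:] ^ Suc e * h) = [:-x,1:] ^ e * (of_nat (Suc e) * h + [:-x,1:] * pderiv h)"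
    by (simp only: pderiv_mult pderiv_power_Suc) (simp add: pderiv_pCons algebra_simps of_nat_poly)
  have "(pderiv ^^ Suc e) ([:-x, 1:] ^ Suc e * h) = (pderiv ^^ e) (pderiv ([:-x, 1:] ^ Suc e * h))"
    by (simp only: funpow_Suc_right o_apply)
  then have "poly ((pderiv ^^ Suc e) ([:-x, 1:] ^ Suc e * h)) x
      = of_nat (fact e) * poly (of_nat (Suc e) * h + [:-x,1:] * pderiv h) x"
    by (simp only: d Suc.IH)
  then show ?case by (simp only: fact_Suc of_nat_mult) (simp add: algebra_simps)
qed simp

text \<open>In characteristic p, vanishing derivatives detect multiplicity only while the factorials
  are units, which is the second assumption; in the application it holds because l is at most
  p.\<close>

lemma linear_power_dvd_of_pderiv_iter:
  fixes R :: "'a::field poly"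
  assumes "\<And>k. k < l \<Longrightarrow> poly ((pderiv ^^ k) R) x = 0" and "\<And>k. k < l \<Longrightarrow> (of_nat (fact k) :: 'a) \<noteq> 0"
  shows "[:-x, 1:] ^ l dvd R"
  using assms
proof (induction l)
  case (Suc l)
  then have "[:-x, 1:] ^ l dvd R" by auto
  then obtain h where h: "R = [:-x, 1:] ^ l * h" by auto
  have "of_nat (fact l) * poly h x = 0"
    using Suc.prems(1)[of l] unfolding h poly_pderiv_iter_linear_power by auto
  then have "poly h x = 0" using Suc.prems(2)[of l] by auto
  then have "[:-x,1:] dvd h" by (simp add: poly_eq_0_iff_dvd)
  then show ?case unfolding h power_Suc2 by (intro mult_dvd_mono dvd_refl)
qed simp

lemma mult_card_le_degree:
  fixes R :: "'a::field poly"
  assumes "R \<noteq> 0" "\<And>x. x \<in> S \<Longrightarrow> [:-x, 1:] ^ l dvd R" "l > 0"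
  shows "l * card S \<le> degree R"
proof -
  have ord: "l \<le> order x R" if "x \<in> S" for x
    using assms that by (simp add: order_divides)
  have sub: "S \<subseteq> {x. poly R x = 0}"
  proof
    fix x assume "x \<in> S"
    then have "order x R \<noteq> 0" using ord[of x] assms(3) by simp
    then show "x \<in> {x. poly R x = 0}" using order_root[of R x] assms(1) by auto
  qed
  have fin: "finite {x. poly R x = 0}" using assms(1) by (rule poly_roots_finite)
  have "l * card S = (\<Sum>x\<in>S. l)" by simp
  also have "\<dots> \<le> (\<Sum>x\<in>S. order x R)" by (rule sum_mono) (use ord in auto)
  also have "\<dots> \<le> (\<Sum>x | poly R x = 0. order x R)" by (rule sum_mono2[OF fin sub]) auto
  also have "\<dots> \<le> degree R" by (rule sum_order_le_degree[OF assms(1)])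
  finally show ?thesis .
qed

section \<open>Iterated derivatives of a high power times a cofactor\<close>

lemma degree_pderiv_le_pred: "degree (pderiv q) \<le> degree q - 1" for q :: "'a::idom poly"
  by (rule degree_le) (auto simp: coeff_pderiv coeff_eq_0)

text \<open>What remains of the k-th derivative of f^N u after splitting off f^(N-k). Its degree
  grows by at most deg f - 1 per derivative and does not depend on N, which keeps the number of
  linear conditions in \<open>stepanov_count\<close> small.\<close>

fun deriv_cofactor :: "nat \<Rightarrow> 'a::idom poly \<Rightarrow> nat \<Rightarrow> 'a poly \<Rightarrow> 'a poly" where
  "deriv_cofactor N f 0 u = u"
| "deriv_cofactor N f (Suc k) u =
     of_nat (N - k) * (pderiv f * deriv_cofactor N f k u) + f * pderiv (deriv_cofactor N f k u)"

lemma pderiv_iter_power_mult: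
  fixes f :: "'a::idom poly"
  assumes "k \<le> N"
  shows "(pderiv ^^ k) (f ^ N * u) = f ^ (N - k) * deriv_cofactor N f k u"
  using assms
proof (induction k)
  case (Suc k)
  then have IH: "(pderiv ^^ k) (f ^ N * u) = f ^ Suc (N - Suc k) * deriv_cofactor N f k u"
    by (simp add: Suc_diff_Suc del: power_Suc)
  have e: "Suc (N - Suc k) = N - k" using Suc.prems by simp
  have pw: "f ^ (N - k) = f * f ^ (N - Suc k)" unfolding e[symmetric] by simp
  have "(pderiv ^^ Suc k) (f ^ N * u) = pderiv (f ^ Suc (N - Suc k) * deriv_cofactor N f k u)"
    by (simp add: IH del: power_Suc)
  also have "\<dots> = f ^ (N - Suc k) * deriv_cofactor N f (Suc k) u"
    by (simp only: pderiv_mult pderiv_power_Suc deriv_cofactor.simps)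
       (simp only: e, simp add: pw algebra_simps of_nat_mult_conv_smult)
  finally show ?case .
qed simp

lemma deriv_cofactor_diff:
  "deriv_cofactor N f k (u - v) = deriv_cofactor N f k u - deriv_cofactor N f k v"
  for f :: "'a::idom poly"
proof (induction k)
  case (Suc k)
  show ?case by (simp only: deriv_cofactor.simps Suc pderiv_diff) (simp add: algebra_simps)
qed simp

lemma degree_deriv_cofactor_le:
  fixes f :: "'a::idom poly"
  assumes "degree f > 0"
  shows "degree (deriv_cofactor N f k u) \<le> degree u + k * (degree f - 1)"
proof (induction k)
  case (Suc k)
  let ?w = "deriv_cofactor N f k u"
  have 1: "degree (of_nat (N - k) * (pderiv f * ?w)) \<le> degree ?w + (degree f - 1)"
  proof -
    have "degree (of_nat (N - k) * (pderiv f * ?w)) \<le> degree (of_nat (N-k) :: 'a poly) + degree (pderiv f * ?w)"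
      by (rule degree_mult_le)
    also have "\<dots> \<le> 0 + (degree (pderiv f) + degree ?w)" by (intro add_mono degree_mult_le) simp
    also have "degree (pderiv f) \<le> degree f - 1" by (rule degree_pderiv_le_pred)
    finally show ?thesis by simp
  qed
  have 2: "degree (f * pderiv ?w) \<le> degree ?w + (degree f - 1)"
  proof (cases "degree ?w = 0")
    case True
    then have "pderiv ?w = 0" by (metis degree_eq_zeroE pderiv_pCons pderiv_0 pCons_0_0 add_0)
    then show ?thesis by simp
  next
    case False
    have "degree (f * pderiv ?w) \<le> degree f + degree (pderiv ?w)" by (rule degree_mult_le)
    also have "degree (pderiv ?w) \<le> degree ?w - 1" by (rule degree_pderiv_le_pred)
    finally show ?thesis using False assms by simp
  qed
  have "degree (deriv_cofactor N f (Suc k) u) \<le> degree ?w + (degree f - 1)"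
    using degree_add_le[OF 1 2] by simp
  then show ?case using Suc by simp
qed simp

section \<open>Stepanov's auxiliary polynomial\<close>

lemma pderiv_iter_mult_const:
  fixes v :: "'a::idom poly"
  assumes "pderiv w = 0"
  shows "(pderiv ^^ k) (v * w) = (pderiv ^^ k) v * w"
  by (induction k) (simp_all add: pderiv_mult assms)

text \<open>Over the prime field \<open>f ^ p\<close> is f(X^p), since Frobenius fixes the
  coefficients; modulo X^p only the constant term survives.\<close>

lemma X_power_char_dvd:
  fixes f :: "'a::finite_field poly"
  assumes p: "p = CARD('a)" "p = CHAR('a)"
  shows "monom 1 p dvd f ^ p - [:coeff f 0:]"
proof -
  obtain c g where f: "f = pCons c g" by (cases f)
  have pr: "prime CHAR('a)" by (rule prime_CHAR_semidom) (simp add: finite_imp_CHAR_pos)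
  have "f = [:c:] + monom 1 1 * g" unfolding f by (simp add: monom_Suc)
  moreover have "([:c:] + monom 1 1 * g) ^ p = [:c:] ^ p + (monom 1 1 * g) ^ p"
    by (rule freshmans_dream) (use p pr in auto)
  moreover have "[:c:] ^ p = [:c:]" by (simp add: poly_const_pow p(1) finite_field_power_card_eq_same)
  moreover have "(monom 1 1 * g) ^ p = monom 1 p * g ^ p" by (simp add: power_mult_distrib monom_power)
  ultimately have "f ^ p = [:c:] + monom 1 p * g ^ p" by simp
  then show ?thesis by (simp add: f)
qed

text \<open>The summands do not occupy disjoint ranges of degrees, since f^h has degree m h, so
  comparing leading terms fails. Lowest terms work instead: the first j not yet known to vanish has
  X^p dividing r_j + s_j f^h. Multiplying by the conjugate removes f^h, and the degree bounds turn
  the congruence modulo X^p into r_j^2 f = f(0) s_j^2, which odd \<open>degree f\<close> forbids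
  unless both vanish.\<close>

lemma stepanov_independence:
  fixes f :: "'a::finite_field poly" and r s :: "nat \<Rightarrow> 'a poly"
  assumes p: "p = CARD('a)" "p = CHAR('a)" and h: "p = 2 * h + 1"
    and odd: "odd (degree f)" and c0: "coeff f 0 \<noteq> 0"
    and deg: "\<And>j. j < J \<Longrightarrow> 2 * degree (r j) + degree f < p" "\<And>j. j < J \<Longrightarrow> 2 * degree (s j) < p"
    and zero: "(\<Sum>j<J. (r j + s j * f ^ h) * monom 1 (j * p)) = 0"
  shows "j < J \<Longrightarrow> r j = 0 \<and> s j = 0"
proof (induction j rule: less_induct)
  case (less j)
  let ?t = "\<lambda>j. (r j + s j * f ^ h) * monom 1 (j * p)"
  let ?X = "monom 1 p :: 'a poly"
  have "(\<Sum>i<J. ?t i) = (\<Sum>i\<in>insert j {j<..<J}. ?t i)"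
  proof (rule sum.mono_neutral_right)
    show "\<forall>i\<in>{..<J} - insert j {j<..<J}. ?t i = 0"
    proof
      fix i assume "i \<in> {..<J} - insert j {j<..<J}"
      then have "i < j" "i < J" by auto
      then have "r i = 0" "s i = 0" using less.IH by auto
      then show "?t i = 0" by simp
    qed
  qed (use less.prems in auto)
  also have "\<dots> = ?t j + (\<Sum>i\<in>{j<..<J}. ?t i)" by simp
  finally have eq: "?t j = - (\<Sum>i\<in>{j<..<J}. ?t i)" using zero by (simp add: eq_neg_iff_add_eq_0)
  have "monom 1 (Suc j * p) dvd ?t i" if "i \<in> {j<..<J}" for i
  proof -
    have "Suc j + (i - Suc j) = i" using that by auto
    then have "i * p = Suc j * p + (i - Suc j) * p" by (metis add_mult_distrib)
    then have "(monom 1 (i * p) :: 'a poly) = monom 1 (Suc j * p) * monom 1 ((i - Suc j) * p)"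
      by (simp only: mult_monom mult_1)
    then show ?thesis by (simp only: dvd_mult dvd_triv_left)
  qed
  then have "monom 1 (Suc j * p) dvd ?t j" unfolding eq by (intro dvd_minus_iff[THEN iffD2] dvd_sum) auto
  moreover have "(monom 1 (Suc j * p) :: 'a poly) = ?X * monom 1 (j * p)" by (simp add: mult_monom)
  ultimately have d1: "?X dvd r j + s j * f ^ h" by (simp add: dvd_mult_cancel_right)
  \<comment> \<open>The extra factor f completes f^(2h) to f^p, and the second summand replaces f^p
    by the constant f(0) modulo X^p.\<close>
  have "?X dvd (r j + s j * f ^ h) * ((r j - s j * f ^ h) * f) + (s j)\<^sup>2 * (f ^ p - [:coeff f 0:])"
    by (rule dvd_add[OF dvd_mult2[OF d1] dvd_mult[OF X_power_char_dvd[OF p, of f]]])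
  also have "(r j + s j * f ^ h) * ((r j - s j * f ^ h) * f) + (s j)\<^sup>2 * (f ^ p - [:coeff f 0:])
      = (r j)\<^sup>2 * f - smult (coeff f 0) ((s j)\<^sup>2)"
  proof -
    have "f ^ p = f ^ h * f ^ h * f" unfolding h by (simp add: power_add mult_2)
    moreover have "(s j)\<^sup>2 * [:coeff f 0:] = smult (coeff f 0) ((s j)\<^sup>2)" by simp
    moreover have "(R + S * g) * ((R - S * g) * f) + S\<^sup>2 * (g * g * f - c) = R\<^sup>2 * f - S\<^sup>2 * c"
      for R S g c :: "'a poly" by (simp add: algebra_simps power2_eq_square)
    ultimately show ?thesis by metis
  qed
  finally have d2: "?X dvd (r j)\<^sup>2 * f - smult (coeff f 0) ((s j)\<^sup>2)" (is "_ dvd ?w") .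
  have "degree ?w < p"
  proof (rule degree_diff_less)
    have "degree ((r j)\<^sup>2 * f) \<le> 2 * degree (r j) + degree f"
    proof -
      have "degree ((r j)\<^sup>2 * f) \<le> degree ((r j)\<^sup>2) + degree f" by (rule degree_mult_le)
      then show ?thesis using degree_power_le[of "r j" 2] by (simp add: mult.commute)
    qed
    then show "degree ((r j)\<^sup>2 * f) < p" using deg(1)[OF less.prems] by simp
    have "degree (smult (coeff f 0) ((s j)\<^sup>2)) \<le> 2 * degree (s j)"
      using degree_smult_le[of "coeff f 0" "(s j)\<^sup>2"] degree_power_le[of "s j" 2] by (simp add: mult.commute)
    then show "degree (smult (coeff f 0) ((s j)\<^sup>2)) < p" using deg(2)[OF less.prems] by simp
  qed
  then have "?w = 0" using dvd_imp_degree_le[OF d2] by (cases "?w = 0") (auto simp: degree_monom_eq)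
  then have w: "(r j)\<^sup>2 * f = smult (coeff f 0) ((s j)\<^sup>2)" by simp
  have f0: "f \<noteq> 0" using c0 by auto
  have "r j = 0"
  proof (rule ccontr)
    assume rj: "r j \<noteq> 0"
    have "odd (degree ((r j)\<^sup>2 * f))"
      using rj f0 odd by (simp add: degree_mult_eq degree_power_eq)
    moreover have "even (degree (smult (coeff f 0) ((s j)\<^sup>2)))"
      by (cases "s j = 0") (use c0 in \<open>simp_all add: degree_power_eq\<close>)
    ultimately show False using w by simp
  qed
  with w c0 show ?case by simp
qed

lemma finite_field_prime_CHAR: "prime CHAR('a::finite_field)"
  by (rule prime_CHAR_semidom) (simp add: finite_imp_CHAR_pos)

text \<open>At a point with f^h = a, where also x^p = x, the k-th derivative of f^l times the sum of
  (r_j + s_j f^h) X^(jp) collapses to f^(l-k) times a polynomial of degree below D + k (m-1) + J.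
  The 2 D J free coefficients outnumber the conditions that make this vanish for all k < l, and then
  l times the number of points is at most the degree of a nonzero polynomial.\<close>

lemma stepanov_count:
  fixes f :: "'a::finite_field poly" and a :: 'a
  assumes p: "p = CARD('a)" "p = CHAR('a)" and h: "p = 2 * h + 1"
    and m: "m = degree f" "odd m" and c0: "coeff f 0 \<noteq> 0"
    and D: "p = m + 2 * D" "D > 0" and l: "0 < l" "l \<le> p" and J: "J > 0"
    and count: "(\<Sum>k<l. D + k * (m - 1) + J) < 2 * D * J"
  shows "l * card {x. poly f x ^ h = a} \<le> l * m + D + m * h + J * p"
proof -
  \<comment> \<open>An unknown (j, i, b) is the coefficient of X^i in r_j for b = False and in s_j
    for b = True; a condition (k, i) is the i-th coefficient of \<open>G v k\<close>.\<close>
  define I where "I = {..<J} \<times> ({..<D} \<times> (UNIV :: bool set))"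
  define E where "E = Sigma {..<l} (\<lambda>k. {..<D + k * (m - 1) + J})"
  define co where "co = (\<lambda>(v :: nat \<times> nat \<times> bool \<Rightarrow> 'a) b j. \<Sum>i<D. monom (v (j, i, b)) i)"
  \<comment> \<open>The reduced k-th derivative: f^h is replaced by a and X^(jp) by X^j, and the
    factor f^(l-k) is dropped.\<close>
  define G where "G = (\<lambda>v k. \<Sum>j<J. (deriv_cofactor l f k (co v False j)
      + smult a (deriv_cofactor (l + h) f k (co v True j))) * monom 1 j)"
  have co_diff: "co (\<lambda>i. u i - v i) b j = co u b j - co v b j" for u v b j
    unfolding co_def by (simp add: sum_subtractf diff_monom[symmetric])
  have G_diff: "G (\<lambda>i. u i - v i) k = G u k - G v k" for u v k
    unfolding G_def sum_subtractf[symmetric]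
    by (rule sum.cong) (simp_all add: co_diff deriv_cofactor_diff smult_diff_right algebra_simps)
  have "\<exists>v. (\<exists>i\<in>I. v i \<noteq> 0) \<and> (\<forall>i. i \<notin> I \<longrightarrow> v i = 0) \<and> (\<forall>e\<in>E. (\<lambda>v (k, i). coeff (G v k) i) v e = 0)"
  proof (rule finite_field_nontrivial_kernel)
    have "card E = (\<Sum>k<l. D + k * (m - 1) + J)" unfolding E_def by (subst card_SigmaI) auto
    then show "card E < card I" using count unfolding I_def by (simp add: card_cartesian_product mult_ac)
  qed (auto simp: I_def E_def G_diff)
  then obtain v where v: "\<exists>i\<in>I. v i \<noteq> 0" and vE: "\<And>k i. (k, i) \<in> E \<Longrightarrow> coeff (G v k) i = 0" by fast
  have deg_co: "degree (co v b j) \<le> D - 1" for b j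
    unfolding co_def by (rule degree_sum_le) (auto intro: order_trans[OF degree_monom_le])
  have m0: "degree f > 0" using m by (metis odd_pos)
  have G0: "G v k = 0" if k: "k < l" for k
  proof (rule poly_eqI)
    fix i
    have "degree (G v k) \<le> (D - 1) + k * (m - 1) + (J - 1)"
      unfolding G_def
    proof (rule degree_sum_le)
      fix j assume j: "j \<in> {..<J}"
      have c: "degree (deriv_cofactor N f k (co v b j)) \<le> (D - 1) + k * (m - 1)" for N b
        using degree_deriv_cofactor_le[OF m0, of N k "co v b j"] deg_co[of b j] m by simp
      have "degree (deriv_cofactor l f k (co v False j) + smult a (deriv_cofactor (l + h) f k (co v True j)))
          \<le> (D - 1) + k * (m - 1)"
        by (intro degree_add_le c order_trans[OF degree_smult_le])
      then show "degree ((deriv_cofactor l f k (co v False j)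
          + smult a (deriv_cofactor (l + h) f k (co v True j))) * monom 1 j) \<le> (D - 1) + k * (m - 1) + (J - 1)"
        using j by (intro order_trans[OF degree_mult_le] add_mono) (auto simp: degree_monom_eq)
    qed simp
    then have "coeff (G v k) i = 0" if "i \<ge> D + k * (m - 1) + J"
      using that D(2) J by (intro coeff_eq_0) linarith
    moreover have "coeff (G v k) i = 0" if "i < D + k * (m - 1) + J"
      using that k by (intro vE) (auto simp: E_def)
    ultimately show "coeff (G v k) i = coeff 0 i" by (metis coeff_0 not_less)
  qed
  define r s where "r = co v False" and "s = co v True"
  define R where "R = (\<Sum>j<J. (f ^ l * r j + f ^ (l + h) * s j) * monom 1 (j * p))"
  have "R = f ^ l * (\<Sum>j<J. (r j + s j * f ^ h) * monom 1 (j * p))"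
    unfolding R_def sum_distrib_left by (rule sum.cong) (simp_all add: power_add algebra_simps)
  moreover have "(\<Sum>j<J. (r j + s j * f ^ h) * monom 1 (j * p)) \<noteq> 0"
  proof
    assume z: "(\<Sum>j<J. (r j + s j * f ^ h) * monom 1 (j * p)) = 0"
    have rs: "r j = 0 \<and> s j = 0" if "j < J" for j
    proof (rule stepanov_independence[OF p h _ c0 _ _ z that])
      show "odd (degree f)" using m by simp
      show "2 * degree (r j) + degree f < p" for j using deg_co[of False j] D m unfolding r_def by linarith
      show "2 * degree (s j) < p" for j using deg_co[of True j] D m unfolding s_def by linarith
    qed
    obtain j i b where ji: "j < J" "i < D" "v (j, i, b) \<noteq> 0" using v unfolding I_def by auto
    have "co v b j = 0" using rs[OF ji(1)] unfolding r_def s_def by (cases b) auto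
    moreover have "coeff (co v b j) i = v (j, i, b)"
      unfolding co_def using ji(2) by (simp add: coeff_sum coeff_monom sum.delta)
    ultimately show False using ji(3) by simp
  qed
  moreover have "f \<noteq> 0" using c0 by auto
  ultimately have R0: "R \<noteq> 0" by simp
  have dR: "degree R \<le> l * m + D + m * h + J * p"
    unfolding R_def
  proof (rule degree_sum_le)
    fix j assume j: "j \<in> {..<J}"
    have dp: "degree (f ^ N) \<le> m * N" for N using degree_power_le[of f N] m by simp
    have "degree (f ^ l * r j + f ^ (l + h) * s j) \<le> m * (l + h) + (D - 1)"
    proof (rule degree_add_le)
      show "degree (f ^ l * r j) \<le> m * (l + h) + (D - 1)"
        using deg_co[of False j] dp[of l] degree_mult_le[of "f ^ l" "r j"] unfolding r_def
        by (simp add: algebra_simps)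
      show "degree (f ^ (l + h) * s j) \<le> m * (l + h) + (D - 1)"
        using deg_co[of True j] dp[of "l + h"] degree_mult_le[of "f ^ (l + h)" "s j"] unfolding s_def by simp
    qed
    then have "degree ((f ^ l * r j + f ^ (l + h) * s j) * monom 1 (j * p)) \<le> m * (l + h) + (D - 1) + j * p"
      by (intro order_trans[OF degree_mult_le] add_mono) (auto simp: degree_monom_eq)
    moreover have "j * p \<le> J * p" using j by simp
    moreover have "m * (l + h) = l * m + m * h" by (simp add: algebra_simps)
    ultimately show "degree ((f ^ l * r j + f ^ (l + h) * s j) * monom 1 (j * p)) \<le> l * m + D + m * h + J * p"
      by linarith
  qed simp
  have "l * card {x. poly f x ^ h = a} \<le> degree R"
  proof (rule mult_card_le_degree[OF R0 _ l(1)], rule linear_power_dvd_of_pderiv_iter)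
    fix k assume k: "k < l"
    show "(of_nat (fact k) :: 'a) \<noteq> 0"
      using k l p finite_field_prime_CHAR[where 'a='a]
      by (simp only: of_nat_eq_0_iff_char_dvd) (simp add: prime_dvd_fact_iff)
    fix x assume x: "x \<in> {x. poly f x ^ h = a}"
    \<comment> \<open>Powers of X^p are constants for differentiation in characteristic p, so they
      pass through all k derivatives.\<close>
    have dm: "pderiv (monom 1 (j * p) :: 'a poly) = 0" for j
      by (simp add: pderiv_monom p(2))
    have xp: "x ^ (j * p) = x ^ j" for j
      by (metis finite_field_power_card_eq_same mult.commute p(1) power_mult)
    have "(pderiv ^^ k) R = (\<Sum>j<J. (f ^ (l - k) * deriv_cofactor l f k (r j)
        + f ^ (l + h - k) * deriv_cofactor (l + h) f k (s j)) * monom 1 (j * p))"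
      unfolding R_def higher_pderiv_sum
      by (rule sum.cong) (use k in \<open>simp_all add: pderiv_iter_mult_const[OF dm] higher_pderiv_add pderiv_iter_power_mult\<close>)
    then have "poly ((pderiv ^^ k) R) x = (\<Sum>j<J. (poly f x ^ (l - k) * poly (deriv_cofactor l f k (r j)) x
        + poly f x ^ (l + h - k) * poly (deriv_cofactor (l + h) f k (s j)) x) * x ^ (j * p))"
      by (simp add: poly_sum poly_monom)
    also have "\<dots> = (\<Sum>j<J. poly f x ^ (l - k) * ((poly (deriv_cofactor l f k (r j)) x
        + a * poly (deriv_cofactor (l + h) f k (s j)) x) * x ^ j))"
    proof (rule sum.cong[OF refl])
      fix j
      have "poly f x ^ (l + h - k) = poly f x ^ (l - k) * a"
        using x k power_add[of "poly f x" "l - k" h] by simp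
      then show "(poly f x ^ (l - k) * poly (deriv_cofactor l f k (r j)) x
        + poly f x ^ (l + h - k) * poly (deriv_cofactor (l + h) f k (s j)) x) * x ^ (j * p)
        = poly f x ^ (l - k) * ((poly (deriv_cofactor l f k (r j)) x
        + a * poly (deriv_cofactor (l + h) f k (s j)) x) * x ^ j)"
        unfolding xp by (simp add: algebra_simps)
    qed
    also have "\<dots> = poly f x ^ (l - k) * poly (G v k) x"
      unfolding G_def r_def s_def by (simp add: sum_distrib_left poly_sum poly_monom)
    finally show "poly ((pderiv ^^ k) R) x = 0" using G0[OF k] by simp
  qed
  with dR show ?thesis by linarith
qed

section \<open>Point bounds and the Weil bound in odd degree\<close>

lemma finite_field_power_half:
  fixes v :: "'a::finite_field"
  assumes "CARD('a) = 2 * h + 1" "v \<noteq> 0"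
  shows "v ^ h = 1 \<or> v ^ h = -1"
proof -
  have "v * v ^ (2 * h) = v" using finite_field_power_card_eq_same[of v] assms(1) by simp
  then have "v ^ (2 * h) = 1" using assms(2) by simp
  then have "(v ^ h)\<^sup>2 = 1" by (metis mult.commute power_mult)
  then show ?thesis by (simp add: power2_eq_1_iff)
qed

text \<open>With multiplicity l near sqrt p, dividing the degree bound by l leaves p J / l plus
  terms of size m sqrt p; J slightly above l/2 produces the main term p/2.\<close>

lemma stepanov_bound:
  fixes f :: "'a::finite_field poly" and a :: 'a
  assumes p: "p = CARD('a)" "p = CHAR('a)" and h: "p = 2 * h + 1"
    and m: "m = degree f" "odd m" and c0: "coeff f 0 \<noteq> 0" and big: "64 * m\<^sup>2 \<le> p"
  shows "real (card {x. poly f x ^ h = a}) \<le> p / 2 + 4.625 * m * sqrt p"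
proof -
  define l where "l = nat \<lfloor>sqrt p\<rfloor>"
  have l1: "real l \<le> sqrt p" and l2: "sqrt p < l + 1" unfolding l_def by (simp_all add: of_nat_floor)  linarith
  have lp: "real l * real l \<le> p" using mult_mono[OF l1 l1] by simp
  have m1: "m \<ge> 1" using m(2) odd_pos by force
  have "sqrt (64 * (real m)\<^sup>2) \<le> sqrt p"
    using big by (intro real_sqrt_le_mono) (metis of_nat_le_iff of_nat_mult of_nat_numeral of_nat_power)
  then have "8 * real m \<le> sqrt p" by (simp add: real_sqrt_mult)
  then have "8 * m \<le> l" unfolding l_def using le_nat_floor[of "8 * m" "sqrt p"] by simp
  then have lm: "8 * real m \<le> l" by linarith
  then have l8: "real l \<ge> 8" using m1 by linarith
  have lp8: "8 * real l \<le> p" using mult_right_mono[OF l8, of "real l"] lp by linarith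
  have m1': "real m \<ge> 1" using m1 by simp
  have "m \<le> m\<^sup>2" by (simp add: power2_eq_square)
  then have "m < p" using big m1 by linarith
  have "even (p - m)" using h m(2) \<open>m < p\<close> by simp
  then obtain D where "p - m = 2 * D" by blast
  then have D: "p = m + 2 * D" "D > 0" using \<open>m < p\<close> by auto
  \<comment> \<open>In the doubled inequality the l contained in 2J cancels against l * 2D; the
    remaining 2m + 3, times 2D, pays for l^2 m <= p m and for (2m + 4) l.\<close>
  define J where "J = l div 2 + m + 2"
  have J1: "2 * real J \<ge> l + 2 * m + 3" unfolding J_def by simp
  have J2: "2 * real J \<le> l + 2 * m + 4" unfolding J_def by simp
  have count: "(\<Sum>k<l. D + k * (m - 1) + J) < 2 * D * J"
  proof -
    define S M where "S = (\<Sum>k<l. k)" and "M = m - 1"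
    have "(\<Sum>k<l. k) * 2 \<le> l * l" by (induction l) auto
    then have "2 * S \<le> l * l" unfolding S_def by simp
    then have s2: "2 * real S \<le> real l * real l" by (metis of_nat_le_iff of_nat_mult of_nat_numeral)
    have M: "real M = real m - 1" using m1 by (simp add: M_def of_nat_diff)
    have eq: "(\<Sum>k<l. D + k * (m - 1) + J) = l * D + S * M + l * J"
      unfolding S_def M_def[symmetric] by (simp add: sum.distrib sum_distrib_right)
    have "2 * real (l * D + S * M + l * J) = l * (2 * real D) + (2 * real S) * M + l * (2 * real J)"
      by (simp add: algebra_simps)
    also have "\<dots> \<le> l * (2 * real D) + (real l * real l) * M + l * (l + 2 * m + 4)"
      using s2 J2 by (intro add_mono mult_right_mono order_refl) (auto intro: mult_left_mono)
    also have "\<dots> = l * (2 * real D) + (real l * real l) * m + (2 * m + 4) * real l"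
      unfolding M by (simp add: algebra_simps)
    also have "\<dots> < (2 * real D) * (l + 2 * m + 3)"
    proof -
      have "(real l * real l) * m \<le> real p * real m" using lp by (intro mult_right_mono) auto
      moreover have "(2 * real m + 4) * (8 * real l) \<le> (2 * real m + 4) * real p" using lp8 by (intro mult_left_mono) auto
      moreover have "64 * (real m * real m) \<le> p" using big by (metis of_nat_le_iff of_nat_mult of_nat_numeral power2_eq_square)
      moreover have "real m \<le> real m * real m" using m1' by simp
      moreover have "real p \<le> real p * real m" using m1' by (simp add: mult_le_cancel_left1)
      moreover have "real p > 0" using D by simp
      moreover have "(2 * real D) * (l + 2 * m + 3)
          = l * (2 * real D) + 2 * (real p * real m) + 3 * real p - 2 * (real m * real m) - 3 * real m"
      proof -
        have Dp: "2 * real D = real p - real m" using D by simp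
        show ?thesis unfolding Dp by (simp add: algebra_simps)
      qed
      moreover have "8 * ((2 * m + 4) * real l) \<le> 2 * (real p * real m) + 4 * real p"
        using \<open>(2 * real m + 4) * (8 * real l) \<le> _\<close> by (simp add: algebra_simps)
      ultimately show ?thesis by linarith
    qed
    also have "\<dots> \<le> (2 * real D) * (2 * real J)" using J1 by (intro mult_left_mono) auto
    finally have "2 * real (l * D + S * M + l * J) < 2 * real (2 * D * J)" by simp
    then show ?thesis unfolding eq by (simp only: mult_less_cancel_left_pos zero_less_numeral of_nat_less_iff)
  qed
  let ?N = "card {x. poly f x ^ h = a}"
  have "l * ?N \<le> l * m + D + m * h + J * p"
  proof (rule stepanov_count[OF p h m c0 D])
    show "0 < l" using l8 by linarith
    show "l \<le> p" using lp8 by linarith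
    show "J > 0" unfolding J_def by simp
  qed (rule count)
  then have "real l * ?N \<le> real l * m + D + real m * h + real J * p"
    by (metis of_nat_add of_nat_le_iff of_nat_mult)
  also have "\<dots> \<le> real l * m + p / 2 + m * (p / 2) + (l / 2 + m + 2) * p"
  proof (intro add_mono mult_left_mono mult_right_mono)
    show "real D \<le> p / 2" using D by simp
    show "real h \<le> p / 2" using h by simp
    show "real J \<le> l / 2 + m + 2" using J2 by simp
  qed auto
  also have "\<dots> \<le> real l * m + l * (p / 2) + 4 * m * p"
  proof -
    have "real p \<le> m * real p" using m1' by (simp add: mult_le_cancel_right1)
    then show ?thesis by (simp add: algebra_simps)
  qed
  finally have N: "real l * ?N \<le> real l * m + l * (p / 2) + 4 * m * p" .
  \<comment> \<open>The constant is 4.625 = 4 * 9/8 + 1/8; the last part absorbs the lone m, as sqrt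
    p >= 8.\<close>
  have "sqrt p \<le> (9 / 8) * l" using l2 l8 by linarith
  then have "sqrt p * sqrt p \<le> (9 / 8) * l * sqrt p" by (intro mult_right_mono) auto
  then have "real p \<le> l * ((9 / 8) * sqrt p)" by (simp add: mult_ac)
  then have "4 * real m * p \<le> 4 * real m * (l * ((9 / 8) * sqrt p))" by (intro mult_left_mono) auto
  with N have "real l * ?N \<le> real l * m + l * (p / 2) + 4 * m * (l * ((9 / 8) * sqrt p))" by simp
  then have "real l * ?N \<le> l * (m + p / 2 + 4.5 * m * sqrt p)" by (simp add: algebra_simps)
  then have "?N \<le> m + p / 2 + 4.5 * m * sqrt p" using l8 by (simp add: mult_le_cancel_left)
  moreover have "8 * real m \<le> m * sqrt p" using l1 l8 m1' by (simp add: mult_left_mono mult.commute)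
  ultimately show ?thesis by simp
qed

text \<open>Upper bounds for both level sets suffice: together with at most m zeros they exhaust the
  field, so the difference is at most 2 N - p + m with N either count. If p < 64 m^2, the trivial
  bound p is already at most 8 m sqrt p.\<close>

lemma weil_odd_degree:
  fixes f :: "'a::finite_field poly"
  assumes p: "p = CARD('a)" "p = CHAR('a)" and h: "p = 2 * h + 1"
    and m: "m = degree f" "odd m" and c0: "coeff f 0 \<noteq> 0"
  shows "\<bar>real (card {x. poly f x ^ h = 1}) - real (card {x. poly f x ^ h = -1})\<bar> \<le> 11 * real m * sqrt p"
proof (cases "64 * m\<^sup>2 \<le> p")
  case True
  define N where "N = (\<lambda>a. real (card {x. poly f x ^ h = a}))"
  have b: "N a \<le> p / 2 + 4.625 * m * sqrt p" for a
    unfolding N_def by (rule stepanov_bound[OF p h m c0 True])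
  have "p = card ({x. poly f x = 0} \<union> {x. poly f x ^ h = 1} \<union> {x. poly f x ^ h = -1})"
    using finite_field_power_half[of h] p h by (auto intro!: arg_cong[of _ _ card])
  also have "\<dots> \<le> card {x. poly f x = 0} + card {x. poly f x ^ h = 1} + card {x. poly f x ^ h = -1}"
    by (meson add_le_mono1 card_Un_le order_trans)
  also have "card {x. poly f x = 0} \<le> m" using c0 m card_poly_roots_bound[of f] by force
  finally have "p \<le> m + card {x. poly f x ^ h = 1} + card {x. poly f x ^ h = -1}" by simp
  then have "real p \<le> m + N 1 + N (-1)" unfolding N_def by linarith
  moreover have "real m * 1 \<le> m * sqrt p" by (rule mult_left_mono) (use h in auto)
  ultimately have "\<bar>N 1 - N (-1)\<bar> \<le> 11 * real m * sqrt p"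
    using b[of 1] b[of "-1"] unfolding abs_le_iff by (auto simp: field_simps)
  then show ?thesis unfolding N_def .
next
  case False
  have m0: "real m > 0" using m(2) odd_pos by simp
  have le: "real (card {x. poly f x ^ h = a}) \<le> p" for a unfolding p(1) by (simp add: card_mono)
  have "real p \<le> 64 * (real m)\<^sup>2" using False by (metis linear of_nat_le_iff of_nat_mult of_nat_numeral of_nat_power)
  then have "sqrt p \<le> sqrt (64 * (real m)\<^sup>2)" by (rule real_sqrt_le_mono)
  then have "sqrt p \<le> 8 * real m" by (simp add: real_sqrt_mult)
  then have "sqrt p * sqrt p \<le> 8 * real m * sqrt p" by (rule mult_right_mono) simp
  then have "real p \<le> 11 * real m * sqrt p" using m0 by (simp add: mult_nonneg_nonneg)
  then show ?thesis using le[of 1] le[of "-1"] by (simp add: abs_le_iff)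
qed

section \<open>The quadratic character and products of linear factors\<close>

definition quad_char :: "'a::finite_field \<Rightarrow> int" where
  "quad_char v = (if v = 0 then 0 else if v ^ ((CARD('a) - 1) div 2) = 1 then 1 else -1)"

lemma finite_field_one_neq_minus_one:
  assumes "odd CHAR('a::finite_field)"
  shows "(1::'a) \<noteq> -1"
proof
  assume "(1::'a) = -1"
  then have "(of_nat 2 :: 'a) = 0" by (metis add.right_inverse of_nat_numeral one_add_one)
  then have "CHAR('a) dvd 2" by (simp only: of_nat_eq_0_iff_char_dvd)
  then have "CHAR('a) = 2" using finite_field_prime_CHAR[where 'a='a] primes_dvd_imp_eq two_is_prime_nat by blast
  with assms show False by simp
qed

context
  fixes p h :: nat
  assumes p: "p = CARD('a::finite_field)" "p = CHAR('a)" and h: "p = 2 * h + 1"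
begin

lemma quad_char_alt: "quad_char (v::'a) = (if v ^ h = 1 then 1 else 0) - (if v ^ h = -1 then 1 else 0)"
proof -
  have n: "(1::'a) \<noteq> -1" by (rule finite_field_one_neq_minus_one) (simp only: p(2)[symmetric] h, simp)
  have p1: "prime p" using finite_field_prime_CHAR[where 'a='a] unfolding p(2)[symmetric] .
  have "h > 0" using h p1 by (cases h) auto
  then have z: "(0::'a) ^ h = 0" by (rule zero_power)
  have hh: "(CARD('a) - 1) div 2 = h" using p h by simp
  have n0: "(0::'a) \<noteq> -1" by (metis neg_equal_0_iff_equal zero_neq_one)
  have "v \<noteq> 0 \<Longrightarrow> v ^ h = 1 \<or> v ^ h = -1" using finite_field_power_half[of h v] p h by simp
  then show ?thesis using n n0 z unfolding quad_char_def hh by (cases "v = 0") (auto simp: zero_power)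
qed

lemma quad_char_mult: "quad_char (u * v :: 'a) = quad_char u * quad_char v"
proof (cases "u = 0 \<or> v = 0")
  case False
  then show ?thesis
    using finite_field_power_half[of h u] finite_field_power_half[of h v] p h
      finite_field_one_neq_minus_one[where 'a='a]
    unfolding quad_char_alt by (auto simp: power_mult_distrib)
qed (auto simp: quad_char_def)

lemma quad_char_even_power:
  assumes "even k" "v \<noteq> 0"
  shows "quad_char ((v::'a) ^ k) = 1"
proof -
  obtain j where j: "k = j + j" using assms(1) by (metis evenE mult_2)
  have "quad_char (v ^ k) = quad_char (v ^ j) * quad_char (v ^ j)"
    unfolding j power_add quad_char_mult ..
  moreover have "quad_char (v ^ j) \<in> {1, -1}" using assms(2) by (auto simp: quad_char_def)
  ultimately show ?thesis by auto
qed

lemma sum_quad_char_poly: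
  "(\<Sum>x\<in>(UNIV::'a set). quad_char (poly f x))
     = int (card {x. poly f x ^ h = 1}) - int (card {x. poly f x ^ h = -1})"
  unfolding quad_char_alt sum_subtractf by (simp add: sum.If_cases)

text \<open>The substitution x = 1/t - \<beta> moves the root -\<beta> of odd multiplicity to infinity, which makes
  the degree odd.\<close>

lemma weil_linear_factors:
  fixes bs :: "'a list"
  assumes ev: "even (length bs)" and odd: "odd (count_list bs \<beta>)"
  shows "\<bar>real_of_int (\<Sum>x\<in>UNIV. quad_char (\<Prod>b\<leftarrow>bs. x + b))\<bar> \<le> 11 * real (length bs) * sqrt p"
proof -
  \<comment> \<open>The product at x = 1/t - \<beta> after clearing t^(length bs), a power with even
    exponent and so invisible to the character. Factors with b = \<beta> become 1, hence the degree
    drops by the odd number \<open>count_list bs \<beta>\<close>.\<close>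
  define F where "F = (\<Prod>b\<leftarrow>bs. [:1, b - \<beta>:])"
  have dF: "degree F + count_list bs \<beta> = length bs \<and> F \<noteq> 0" unfolding F_def
  proof (induction bs)
    case (Cons b bs)
    let ?F = "\<Prod>b\<leftarrow>bs. [:1, b - \<beta>:]"
    have "degree ([:1, b - \<beta>:] * ?F) = degree [:1, b - \<beta>:] + degree ?F"
      by (rule degree_mult_eq) (use Cons in auto)
    then show ?case using Cons by auto
  qed simp
  have F0: "coeff F 0 = 1"
    unfolding F_def by (induction bs) (simp_all add: coeff_mult)
  have b_in: "\<beta> \<in> set bs" using odd by (metis count_notin even_zero)
  have "count_list bs \<beta> > 0" using odd odd_pos by blast
  then have dl: "degree F + 1 \<le> length bs" using dF by simp
  define g where "g = (\<lambda>x. quad_char (\<Prod>b\<leftarrow>bs. x + b))"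
  have g0: "g (-\<beta>) = 0"
  proof -
    have "(\<Prod>b\<leftarrow>bs. -\<beta> + b) = 0" using b_in by (induction bs) auto
    moreover have "quad_char (0::'a) = 0" by (simp add: quad_char_def)
    ultimately show ?thesis unfolding g_def by metis
  qed
  have gF: "g (-\<beta> + inverse t) = quad_char (poly F t)" if t: "t \<noteq> 0" for t
  proof -
    have "(\<Prod>b\<leftarrow>bs. -\<beta> + inverse t + b) = inverse t ^ length bs * poly F t"
      unfolding F_def using t by (induction bs) (simp_all add: field_simps)
    then show ?thesis
      unfolding g_def using quad_char_even_power[OF ev, of "inverse t"] t by (simp add: quad_char_mult)
  qed
  have "(\<Sum>x\<in>UNIV. g x) = (\<Sum>x\<in>UNIV - {-\<beta>}. g x)"
    using g0 by (simp add: sum.remove[of UNIV "-\<beta>"])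
  also have "\<dots> = (\<Sum>t\<in>UNIV - {0}. quad_char (poly F t))"
    by (rule sum.reindex_bij_witness[of _ "\<lambda>t. -\<beta> + inverse t" "\<lambda>x. inverse (x + \<beta>)"])
       (auto simp: gF[symmetric] add_eq_0_iff2)
  \<comment> \<open>The value t = 0 corresponds to no x; F(0) = 1 there, whence the correction by
    1.\<close>
  also have "\<dots> = (\<Sum>t\<in>UNIV. quad_char (poly F t)) - 1"
    using F0 by (simp add: sum.remove[of UNIV 0] poly_0_coeff_0) (simp add: quad_char_def)
  finally have eq: "(\<Sum>x\<in>UNIV. g x) = (\<Sum>t\<in>UNIV. quad_char (poly F t)) - 1" .
  have "\<bar>real (card {x. poly F x ^ h = 1}) - real (card {x. poly F x ^ h = -1})\<bar> \<le> 11 * real (degree F) * sqrt p"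
  proof (rule weil_odd_degree[OF p h refl])
    show "odd (degree F)" using dF ev odd by (metis even_add)
  qed (simp add: F0)
  then have "\<bar>real_of_int (\<Sum>t\<in>UNIV. quad_char (poly F t))\<bar> \<le> 11 * real (degree F) * sqrt p"
    unfolding sum_quad_char_poly by simp
  then have "\<bar>real_of_int (\<Sum>x\<in>UNIV. g x)\<bar> \<le> 11 * real (degree F) * sqrt p + 1"
    unfolding eq by simp
  \<comment> \<open>The stray 1 is absorbed because \<open>degree F\<close> is at least one below
    \<open>length bs\<close>.\<close>
  also have "1 \<le> 11 * sqrt p" using h by (simp add: order_trans[of 1 "sqrt p"])
  also have "11 * real (degree F) * sqrt p + 11 * sqrt p = 11 * real (degree F + 1) * sqrt p"
    by (simp add: algebra_simps)
  also have "\<dots> \<le> 11 * real (length bs) * sqrt p"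
    using dl by (intro mult_right_mono mult_left_mono) auto
  finally show ?thesis unfolding g_def by simp
qed

end

section \<open>The Weil bound over the prime field\<close>

text \<open>The shifts are representatives in [0, p), so that odd multiplicity in the list is odd
  multiplicity of a residue class. If all multiplicities were even, the product would be a square
  and no cancellation could be expected.\<close>

definition weil_bound :: "nat \<Rightarrow> bool" where
  "weil_bound p \<longleftrightarrow> (\<forall>bs::int list. even (length bs) \<longrightarrow> (\<exists>\<beta>. odd (count_list bs \<beta>)) \<longrightarrow>
     set bs \<subseteq> {0..<int p} \<longrightarrow>
     \<bar>real_of_int (\<Sum>x\<in>{0..<int p}. Legendre (\<Prod>b\<leftarrow>bs. x + b) (int p))\<bar> \<le> 11 * real (length bs) * sqrt p)"

text \<open>A type cannot depend on the variable p. Instead, the field with p elements is built for one fixed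
  prime, chosen as a counterexample to the Weil bound if there is any; proving the bound for that
  single prime then proves it for all.\<close>

definition chosen_prime :: nat where
  "chosen_prime = (SOME p. prime p \<and> odd p \<and> (\<not> weil_bound p \<or> (\<forall>q. prime q \<longrightarrow> odd q \<longrightarrow> weil_bound q)))"

lemma chosen_prime:
  "prime chosen_prime" "odd chosen_prime"
  "\<not> weil_bound chosen_prime \<or> (\<forall>q. prime q \<longrightarrow> odd q \<longrightarrow> weil_bound q)"
proof -
  have "\<exists>p. prime p \<and> odd p \<and> (\<not> weil_bound p \<or> (\<forall>q. prime q \<longrightarrow> odd q \<longrightarrow> weil_bound q))"
  proof (cases "\<forall>q. prime q \<longrightarrow> odd q \<longrightarrow> weil_bound q")
    case True
    then show ?thesis by (intro exI[of _ 3]) simp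
  qed blast
  from someI_ex[OF this, folded chosen_prime_def]
  show "prime chosen_prime" "odd chosen_prime"
    "\<not> weil_bound chosen_prime \<or> (\<forall>q. prime q \<longrightarrow> odd q \<longrightarrow> weil_bound q)" by auto
qed

lemma chosen_prime_gt_2: "chosen_prime > 2"
  using chosen_prime(1,2) prime_ge_2_nat[of chosen_prime] by (cases "chosen_prime = 2") auto

section \<open>The field with \<open>chosen_prime\<close> elements\<close>

typedef chosen_field = "{0..<int chosen_prime}"
  using chosen_prime_gt_2 by (intro exI[of _ 0]) simp

setup_lifting type_definition_chosen_field

instantiation chosen_field :: comm_ring_1
begin

lift_definition zero_chosen_field :: chosen_field is 0 using chosen_prime_gt_2 by simp
lift_definition one_chosen_field :: chosen_field is 1 using chosen_prime_gt_2 by simp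
lift_definition plus_chosen_field :: "chosen_field \<Rightarrow> chosen_field \<Rightarrow> chosen_field" is
  "\<lambda>x y. (x + y) mod int chosen_prime" using chosen_prime_gt_2 by simp
lift_definition minus_chosen_field :: "chosen_field \<Rightarrow> chosen_field \<Rightarrow> chosen_field" is
  "\<lambda>x y. (x - y) mod int chosen_prime" using chosen_prime_gt_2 by simp
lift_definition uminus_chosen_field :: "chosen_field \<Rightarrow> chosen_field" is
  "\<lambda>x. (- x) mod int chosen_prime" using chosen_prime_gt_2 by simp
lift_definition times_chosen_field :: "chosen_field \<Rightarrow> chosen_field \<Rightarrow> chosen_field" is
  "\<lambda>x y. (x * y) mod int chosen_prime" using chosen_prime_gt_2 by simp

instance
  by standard (transfer; auto simp: mod_simps algebra_simps)+

end

instantiation chosen_field :: field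
begin

lift_definition inverse_chosen_field :: "chosen_field \<Rightarrow> chosen_field" is
  "\<lambda>x. (x ^ (chosen_prime - 2)) mod int chosen_prime" using chosen_prime_gt_2 by simp

definition divide_chosen_field :: "chosen_field \<Rightarrow> chosen_field \<Rightarrow> chosen_field" where
  "divide_chosen_field x y = x * inverse y"

instance
proof
  show "inverse (0::chosen_field) = 0"
    by transfer (use chosen_prime_gt_2 in \<open>simp add: zero_power\<close>)
  show "x div y = x * inverse y" for x y :: chosen_field by (simp add: divide_chosen_field_def)
  fix x :: chosen_field assume "x \<noteq> 0"
  then show "inverse x * x = 1"
  proof transfer
    fix x :: int assume x: "x \<in> {0..<int chosen_prime}" "x \<noteq> 0"
    then obtain n where n: "x = int n" by (metis atLeastLessThan_iff nonneg_int_cases)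
    have "\<not> chosen_prime dvd n" using x n by (auto dest: dvd_imp_le)
    then have "[n ^ (chosen_prime - 1) = 1] (mod chosen_prime)" by (rule fermat_theorem[OF chosen_prime(1)])
    then have "[int (n ^ (chosen_prime - 1)) = int 1] (mod int chosen_prime)" by (simp only: cong_int_iff)
    moreover have "chosen_prime - 1 = Suc (chosen_prime - 2)" using chosen_prime_gt_2 by simp
    ultimately have "(x ^ (chosen_prime - 2) * x) mod int chosen_prime = 1"
      using chosen_prime_gt_2 unfolding n by (simp add: Cong.cong_def mult.commute)
    then show "(x ^ (chosen_prime - 2) mod int chosen_prime * x) mod int chosen_prime = 1"
      by (simp add: mod_simps)
  qed
qed

end

instance chosen_field :: finite_field
proof
  show "finite (UNIV :: chosen_field set)"
    by (metis finite_atLeastLessThan_int finite_imageI type_definition.Abs_image type_definition_chosen_field)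
qed

lemma card_chosen_field: "CARD(chosen_field) = chosen_prime"
  using type_definition.card[OF type_definition_chosen_field] by simp

lemma of_int_chosen_field: "(of_int x :: chosen_field) = Abs_chosen_field (x mod int chosen_prime)"
proof -
  have P: "int chosen_prime > 0" using chosen_prime_gt_2 by simp
  have nat: "(of_nat n :: chosen_field) = Abs_chosen_field (int n mod int chosen_prime)" for n
  proof (induction n)
    case 0 show ?case by (simp add: zero_chosen_field_def)
  next
    case (Suc n)
    show ?case unfolding of_nat_Suc Suc
      using P chosen_prime_gt_2
      by (simp add: one_chosen_field_def plus_chosen_field.abs_eq eq_onp_def mod_simps add.commute)
  qed
  obtain m n where x: "x = int m - int n" by (rule int_diff_cases)
  show ?thesis unfolding x of_int_diff of_int_of_nat_eq nat
    using P by (simp add: minus_chosen_field.abs_eq eq_onp_def mod_simps)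
qed

lemma of_int_chosen_field_eq_iff:
  "(of_int x :: chosen_field) = of_int y \<longleftrightarrow> [x = y] (mod int chosen_prime)"
  using chosen_prime_gt_2 unfolding of_int_chosen_field Cong.cong_def by (subst Abs_chosen_field_inject) auto

lemma char_chosen_field: "CHAR(chosen_field) = chosen_prime"
proof -
  have "(of_nat chosen_prime :: chosen_field) = 0"
    using of_int_chosen_field_eq_iff[of "int chosen_prime" 0] by (simp add: Cong.cong_def)
  then have "CHAR(chosen_field) dvd chosen_prime" by (simp only: of_nat_eq_0_iff_char_dvd)
  then show ?thesis
    using chosen_prime(1) finite_field_prime_CHAR[where 'a=chosen_field] primes_dvd_imp_eq by blast
qed

lemma Legendre_eq_quad_char: "Legendre a (int chosen_prime) = quad_char (of_int a :: chosen_field)"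
proof -
  let ?P = "int chosen_prime"
  have z: "(of_int a :: chosen_field) = 0 \<longleftrightarrow> [a = 0] (mod ?P)"
    using of_int_chosen_field_eq_iff[of a 0] by simp
  have "[Legendre a ?P = a ^ ((chosen_prime - 1) div 2)] (mod ?P)"
    using euler_criterion[OF chosen_prime(1) chosen_prime_gt_2] by simp
  then have e: "(of_int (Legendre a ?P) :: chosen_field) = of_int a ^ ((CARD(chosen_field) - 1) div 2)"
    by (simp add: of_int_chosen_field_eq_iff[symmetric] card_chosen_field)
  have n: "(1::chosen_field) \<noteq> -1"
    by (rule finite_field_one_neq_minus_one) (simp add: char_chosen_field chosen_prime)
  show ?thesis
    using e z n unfolding quad_char_def by (auto simp: Legendre_def split: if_splits)
qed

lemma weil_bound_all: "prime q \<Longrightarrow> odd q \<Longrightarrow> weil_bound q"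
proof -
  let ?P = "int chosen_prime"
  have "weil_bound chosen_prime"
    unfolding weil_bound_def
  proof (intro allI impI)
    fix bs :: "int list" assume ev: "even (length bs)" and ex: "\<exists>\<beta>. odd (count_list bs \<beta>)"
      and sub: "set bs \<subseteq> {0..<?P}"
    then obtain \<beta> where \<beta>: "odd (count_list bs \<beta>)" by blast
    let ?o = "of_int :: int \<Rightarrow> chosen_field"
    have inj: "inj_on ?o {0..<?P}"
      by (rule inj_onI) (auto simp: of_int_chosen_field_eq_iff cong_less_imp_eq_int)
    have bin: "\<beta> \<in> set bs" using \<beta> by (metis count_notin even_zero)
    have "count_list (map ?o bs) (?o \<beta>) = count_list bs \<beta>"
      using sub bin
    proof -
      have "\<And>b. b \<in> set bs \<Longrightarrow> (?o b = ?o \<beta>) = (b = \<beta>)"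
        using inj sub bin by (auto simp: inj_on_def)
      then show ?thesis by (induction bs) auto
    qed
    then have odd: "odd (count_list (map ?o bs) (?o \<beta>))" using \<beta> by simp
    obtain h where h: "chosen_prime = 2 * h + 1" using chosen_prime(2) by (rule oddE)
    have bij: "bij_betw ?o {0..<?P} UNIV"
    proof -
      have "card (?o ` {0..<?P}) = CARD(chosen_field)" using inj by (simp add: card_image card_chosen_field)
      then have "?o ` {0..<?P} = UNIV" by (intro card_subset_eq) auto
      then show ?thesis using inj by (simp add: bij_betw_def)
    qed
    have "(\<Sum>x\<in>{0..<?P}. Legendre (\<Prod>b\<leftarrow>bs. x + b) ?P)
        = (\<Sum>x\<in>{0..<?P}. quad_char (\<Prod>b\<leftarrow>map ?o bs. ?o x + b))"
    proof (rule sum.cong[OF refl])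
      fix x
      have "?o (\<Prod>b\<leftarrow>bs. x + b) = (\<Prod>b\<leftarrow>map ?o bs. ?o x + b)" by (induction bs) auto
      then show "Legendre (\<Prod>b\<leftarrow>bs. x + b) ?P = quad_char (\<Prod>b\<leftarrow>map ?o bs. ?o x + b)"
        by (simp add: Legendre_eq_quad_char)
    qed
    also have "\<dots> = (\<Sum>x\<in>UNIV. quad_char (\<Prod>b\<leftarrow>map ?o bs. x + b))"
      by (rule sum.reindex_bij_betw[OF bij])
    finally show "\<bar>real_of_int (\<Sum>x\<in>{0..<?P}. Legendre (\<Prod>b\<leftarrow>bs. x + b) ?P)\<bar>
        \<le> 11 * real (length bs) * sqrt chosen_prime"
      using weil_linear_factors[OF card_chosen_field[symmetric] char_chosen_field[symmetric] h _ odd] ev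
      by (simp only: length_map)
  qed
  then show "prime q \<Longrightarrow> odd q \<Longrightarrow> weil_bound q" using chosen_prime(3) by blast
qed

section \<open>Burgess' bound\<close>

lemma power_sum_lists:
  fixes g :: "'a \<Rightarrow> 'b::comm_semiring_1"
  assumes "finite S"
  shows "(\<Sum>b\<in>S. g b) ^ k = (\<Sum>bs | set bs \<subseteq> S \<and> length bs = k. \<Prod>b\<leftarrow>bs. g b)"
proof (induction k)
  case 0
  have "{bs. set bs \<subseteq> S \<and> length bs = 0} = {[]}" by auto
  then show ?case by (simp only: sum.insert finite.emptyI) simp
next
  case (Suc k)
  let ?L = "{bs. set bs \<subseteq> S \<and> length bs = k}"
  have eq: "{bs. set bs \<subseteq> S \<and> length bs = Suc k} = (\<lambda>(b, bs). b # bs) ` (S \<times> ?L)"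
    by (auto simp: length_Suc_conv image_iff)
  have inj: "inj_on (\<lambda>(b, bs). b # bs) (S \<times> ?L)" by (auto simp: inj_on_def)
  have "(\<Sum>bs | set bs \<subseteq> S \<and> length bs = Suc k. \<Prod>b\<leftarrow>bs. g b) = (\<Sum>(b, bs)\<in>S \<times> ?L. g b * (\<Prod>b\<leftarrow>bs. g b))"
    unfolding eq by (subst sum.reindex[OF inj]) (simp add: case_prod_unfold)
  also have "\<dots> = (\<Sum>b\<in>S. \<Sum>bs\<in>?L. g b * (\<Prod>b\<leftarrow>bs. g b))" by (rule sum.cartesian_product[symmetric])
  also have "\<dots> = (\<Sum>b\<in>S. g b) * (\<Sum>bs\<in>?L. \<Prod>b\<leftarrow>bs. g b)" by (simp add: sum_product)
  finally show ?case using Suc by simp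
qed

text \<open>If every value occurs an even number of times, a list of length 2r has at most r
  distinct values, so it is a word in the entries of some list cs of length r over S. There are
  \<open>card S ^ r\<close> choices of cs and at most r^(2r) words over each.\<close>

lemma card_lists_few_values:
  assumes "finite S" "S \<noteq> {}"
  shows "card {bs. set bs \<subseteq> S \<and> length bs = 2 * r \<and> (\<forall>\<beta>. even (count_list bs \<beta>))} \<le> r ^ (2 * r) * card S ^ r"
proof -
  let ?C = "{cs. set cs \<subseteq> S \<and> length cs = r}"
  let ?B = "{bs. set bs \<subseteq> S \<and> length bs = 2 * r \<and> (\<forall>\<beta>. even (count_list bs \<beta>))}"
  let ?D = "\<lambda>cs. {bs. set bs \<subseteq> set cs \<and> length bs = 2 * r}"
  obtain s where s: "s \<in> S" using assms by blast
  have "?B \<subseteq> (\<Union>cs\<in>?C. ?D cs)"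
  proof
    fix bs assume bs: "bs \<in> ?B"
    have "2 * card (set bs) = (\<Sum>b\<in>set bs. 2)" by simp
    also have "\<dots> \<le> (\<Sum>b\<in>set bs. count_list bs b)"
    proof (rule sum_mono)
      fix b assume "b \<in> set bs"
      then have "count_list bs b \<noteq> 0" by (simp add: count_list_0_iff)
      moreover have "even (count_list bs b)" using bs by simp
      ultimately show "2 \<le> count_list bs b" by (metis One_nat_def even_zero less_2_cases not_less odd_one)
    qed
    also have "\<dots> = 2 * r" using bs by (simp add: sum_count_set)
    finally have "card (set bs) \<le> r" by simp
    then obtain k where k: "r = card (set bs) + k" using le_Suc_ex by blast
    \<comment> \<open>Padding with an arbitrary element of S brings the list of distinct values to
      length exactly r.\<close>
    define cs where "cs = remdups bs @ replicate k s"
    have "cs \<in> ?C" "bs \<in> ?D cs" using bs s k by (auto simp: cs_def length_remdups_card_conv)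
    then show "bs \<in> (\<Union>cs\<in>?C. ?D cs)" by blast
  qed
  moreover have fC: "finite ?C" using assms by (simp add: finite_lists_length_eq)
  moreover have "finite (?D cs)" for cs by (simp add: finite_lists_length_eq)
  ultimately have "card ?B \<le> card (\<Union>cs\<in>?C. ?D cs)" by (intro card_mono) auto
  also have "\<dots> \<le> (\<Sum>cs\<in>?C. card (?D cs))" by (rule card_UN_le[OF fC])
  also have "\<dots> \<le> (\<Sum>cs\<in>?C. r ^ (2 * r))"
  proof (rule sum_mono)
    fix cs assume "cs \<in> ?C"
    then have "card (set cs) \<le> r" using card_length[of cs] by simp
    then show "card (?D cs) \<le> r ^ (2 * r)" by (simp add: card_lists_length_eq power_mono)
  qed
  also have "\<dots> = r ^ (2 * r) * card S ^ r" using assms by (simp add: card_lists_length_eq)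
  finally show ?thesis .
qed

section \<open>Elementary properties of the Legendre symbol\<close>

lemma Legendre_cong: "[a = b] (mod p) \<Longrightarrow> Legendre a p = Legendre b p"
proof -
  assume ab: "[a = b] (mod p)"
  have "[a = c] (mod p) \<longleftrightarrow> [b = c] (mod p)" for c using ab cong_sym cong_trans by blast
  moreover have "[c = a] (mod p) \<longleftrightarrow> [c = b] (mod p)" for c using ab cong_sym cong_trans by blast
  ultimately show ?thesis by (simp only: Legendre_def QuadRes_def)
qed

lemma Legendre_values: "Legendre a p = 0 \<or> Legendre a p = 1 \<or> Legendre a p = -1"
  by (simp add: Legendre_def)

lemma abs_Legendre_le: "\<bar>Legendre a p\<bar> \<le> 1"
  using Legendre_values[of a p] by auto

text \<open>Euler's criterion gives the identity modulo p, and the two sides differ by at most 2 <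
  p.\<close>

lemma Legendre_mult:
  assumes "prime p" "2 < p"
  shows "Legendre (a * b) (int p) = Legendre a (int p) * Legendre b (int p)"
proof -
  let ?h = "(p - 1) div 2"
  have "[Legendre (a * b) (int p) = (a * b) ^ ?h] (mod int p)" using euler_criterion[OF assms] .
  moreover have "[Legendre a (int p) * Legendre b (int p) = a ^ ?h * b ^ ?h] (mod int p)"
    by (intro cong_mult euler_criterion[OF assms])
  ultimately have "[Legendre (a * b) (int p) = Legendre a (int p) * Legendre b (int p)] (mod int p)"
    by (metis cong_sym cong_trans power_mult_distrib)
  then have d: "int p dvd Legendre (a * b) (int p) - Legendre a (int p) * Legendre b (int p)"
    by (simp add: cong_iff_dvd_diff)
  have *: "\<bar>x - y * z\<bar> \<le> 2" if "\<bar>x\<bar> \<le> 1" "\<bar>y\<bar> \<le> 1" "\<bar>z\<bar> \<le> 1" for x y z :: int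
    using that abs_mult[of y z] mult_mono[of "\<bar>y\<bar>" 1 "\<bar>z\<bar>" 1] by linarith
  have "\<bar>Legendre (a * b) (int p) - Legendre a (int p) * Legendre b (int p)\<bar> < int p"
    using *[OF abs_Legendre_le abs_Legendre_le abs_Legendre_le, of "a * b" "int p" a "int p" b "int p"] assms by linarith
  then have "Legendre (a * b) (int p) - Legendre a (int p) * Legendre b (int p) = 0"
    using dvd_imp_le_int[OF _ d] by force
  then show ?thesis by simp
qed

lemma Legendre_prod_list:
  assumes "prime p" "2 < p"
  shows "Legendre (\<Prod>b\<leftarrow>bs. x + b) (int p) = (\<Prod>b\<leftarrow>bs. Legendre (x + b) (int p))"
proof (induction bs)
  case Nil
  have "Legendre 1 (int p) = 1" using assms
    by (auto simp: Legendre_def Cong.cong_def QuadRes_def intro: exI[of _ 1])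
  then show ?case by simp
next
  case (Cons b bs)
  then show ?case by (simp only: list.map prod_list.Cons Legendre_mult[OF assms])
qed

lemma Legendre_zero_iff: "Legendre a p = 0 \<longleftrightarrow> [a = 0] (mod p)"
  by (simp add: Legendre_def)

text \<open>Expanding the power gives complete sums over products of linear factors. Lists with only
  even multiplicities are few and are bounded trivially by p; all others obey the Weil bound. B < p
  keeps distinct shifts distinct modulo p.\<close>

lemma burgess_moment:
  assumes p: "prime p" "2 < p" and B: "1 \<le> B" "B < p"
  shows "(\<Sum>x\<in>{0..<int p}. (real_of_int (\<Sum>b\<in>{1..int B}. Legendre (x + b) (int p))) ^ (2 * r))
    \<le> real r ^ (2 * r) * real B ^ r * p + 22 * real r * real B ^ (2 * r) * sqrt p"
proof -
  let ?S = "{1..int B}" and ?X = "{0..<int p}"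
  let ?L = "{bs. set bs \<subseteq> ?S \<and> length bs = 2 * r}"
  let ?E = "{bs. set bs \<subseteq> ?S \<and> length bs = 2 * r \<and> (\<forall>\<beta>. even (count_list bs \<beta>))}"
  define T where "T = (\<lambda>bs. real_of_int (\<Sum>x\<in>?X. Legendre (\<Prod>b\<leftarrow>bs. x + b) (int p)))"
  have finL: "finite ?L" by (simp add: finite_lists_length_eq)
  have EL: "?E \<subseteq> ?L" by auto
  have "(\<Sum>x\<in>?X. (\<Sum>b\<in>?S. Legendre (x + b) (int p)) ^ (2 * r)) = (\<Sum>x\<in>?X. \<Sum>bs\<in>?L. Legendre (\<Prod>b\<leftarrow>bs. x + b) (int p))"
    by (rule sum.cong[OF refl]) (simp add: power_sum_lists Legendre_prod_list[OF p])
  also have "\<dots> = (\<Sum>bs\<in>?L. \<Sum>x\<in>?X. Legendre (\<Prod>b\<leftarrow>bs. x + b) (int p))" by (rule sum.swap)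
  finally have "(\<Sum>x\<in>?X. (real_of_int (\<Sum>b\<in>?S. Legendre (x + b) (int p))) ^ (2 * r)) = (\<Sum>bs\<in>?L. T bs)"
    unfolding T_def by (simp only: of_int_power[symmetric] of_int_sum[symmetric])
  also have "\<dots> = (\<Sum>bs\<in>?L - ?E. T bs) + (\<Sum>bs\<in>?E. T bs)" by (rule sum.subset_diff[OF EL finL])
  finally have split: "(\<Sum>x\<in>?X. (real_of_int (\<Sum>b\<in>?S. Legendre (x + b) (int p))) ^ (2 * r))
      = (\<Sum>bs\<in>?L - ?E. T bs) + (\<Sum>bs\<in>?E. T bs)" .
  have "(\<Sum>bs\<in>?L - ?E. T bs) \<le> (\<Sum>bs\<in>?L - ?E. 22 * real r * sqrt p)"
  proof (rule sum_mono)
    fix bs assume bs: "bs \<in> ?L - ?E"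
    have "odd p" using p prime_odd_nat by blast
    then have "weil_bound p" using weil_bound_all p by blast
    moreover have "even (length bs)" "\<exists>\<beta>. odd (count_list bs \<beta>)" using bs by auto
    moreover have "set bs \<subseteq> {0..<int p}"
    proof
      fix b assume "b \<in> set bs"
      then have "b \<in> ?S" using bs by blast
      then show "b \<in> {0..<int p}" using B by auto
    qed
    ultimately have "\<bar>T bs\<bar> \<le> 11 * real (length bs) * sqrt p"
      unfolding T_def weil_bound_def by blast
    then show "T bs \<le> 22 * real r * sqrt p" using bs by simp
  qed
  also have "\<dots> = card (?L - ?E) * (22 * real r * sqrt p)" by simp
  also have "\<dots> \<le> card ?L * (22 * real r * sqrt p)"
    using finL by (intro mult_right_mono) (auto intro!: card_mono)
  also have "real (card ?L) = real B ^ (2 * r)" by (simp add: card_lists_length_eq)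
  finally have off: "(\<Sum>bs\<in>?L - ?E. T bs) \<le> real B ^ (2 * r) * (22 * real r * sqrt p)" .
  have "(\<Sum>bs\<in>?E. T bs) \<le> (\<Sum>bs\<in>?E. real p)"
  proof (rule sum_mono)
    fix bs
    have "(\<Sum>x\<in>?X. Legendre (\<Prod>b\<leftarrow>bs. x + b) (int p)) \<le> (\<Sum>x\<in>?X. 1)"
      by (rule sum_mono) (use abs_Legendre_le in \<open>simp add: abs_le_iff\<close>)
    then have "(\<Sum>x\<in>?X. Legendre (\<Prod>b\<leftarrow>bs. x + b) (int p)) \<le> int p" by simp
    then show "T bs \<le> real p" unfolding T_def by linarith
  qed
  also have "\<dots> = card ?E * real p" by simp
  also have "\<dots> \<le> real (r ^ (2 * r) * card ?S ^ r) * real p"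
  proof (rule mult_right_mono)
    have "card ?E \<le> r ^ (2 * r) * card ?S ^ r" using B by (intro card_lists_few_values) auto
    then show "real (card ?E) \<le> real (r ^ (2 * r) * card ?S ^ r)" by (simp only: of_nat_le_iff)
  qed simp
  finally have diag: "(\<Sum>bs\<in>?E. T bs) \<le> real (r ^ (2 * r) * card ?S ^ r) * real p" .
  show ?thesis unfolding split using add_mono[OF off diag] by (simp add: mult_ac)
qed

section \<open>Multiplicities of fractions and Hoelder's inequality\<close>

lemma harmonic_le: "1 \<le> A \<Longrightarrow> (\<Sum>g=1..A. 1 / real g) \<le> 1 + ln A"
proof (induction A rule: dec_induct)
  case (step n)
  have n: "real n > 0" using step by simp
  have "ln (real n / real (Suc n)) \<le> real n / real (Suc n) - 1" using n by (intro ln_le_minus_one) auto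
  also have "\<dots> = - (1 / real (Suc n))" by (simp add: field_simps)
  finally have "1 / real (Suc n) \<le> ln (real (Suc n)) - ln n" using n step by (simp add: ln_div)
  then show ?case using step by simp
qed simp

lemma one_le_div: "g \<le> n \<Longrightarrow> g \<noteq> 0 \<Longrightarrow> 1 \<le> n div g" for g n :: nat
  by (simp add: Suc_le_eq div_greater_zero_iff)

text \<open>Both pairs reduce to the same fraction u/v: n = g u, a = g v, n' = g' u, a' = g' v. The
  numbers g, g', u, v determine everything, with g, g' <= A, u <= N/g and v <= A/g'. Bounding u
  through n but v through a' decouples g from g', so the count is a product of two harmonic
  sums.\<close>

lemma card_equal_fractions_le:
  assumes A: "1 \<le> A"
  shows "real (card {((n, a), (n', a')) \<in> ({1..N} \<times> {1..A}) \<times> ({1..N} \<times> {1..A}). n * a' = n' * (a::nat)})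
    \<le> real N * real A * (1 + ln A)\<^sup>2"
proof -
  let ?Q = "{((n, a), (n', a')) \<in> ({1..N} \<times> {1..A}) \<times> ({1..N} \<times> {1..A}). n * a' = n' * (a::nat)}"
  let ?G = "Sigma ({1..A} \<times> {1..A}) (\<lambda>(g, g'). {1..N div g} \<times> {1..A div g'})"
  let ?f = "\<lambda>((n, a), (n', a')). ((gcd n a, gcd n' a'), (n div gcd n a, a' div gcd n' (a'::nat)))"
  have key: "n' div gcd n' a' = n div gcd n a \<and> a div gcd n a = a' div gcd n' a'"
    if "n * a' = n' * a" "1 \<le> n" "1 \<le> a" "1 \<le> n'" "1 \<le> a'" for n a n' a' :: nat
  proof -
    define g g' u v u' v' where "g = gcd n a" and "g' = gcd n' a'"
      and "u = n div gcd n a" and "v = a div gcd n a" and "u' = n' div gcd n' a'" and "v' = a' div gcd n' a'"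
    note defs = this
    have g: "g > 0" "g' > 0" using that by (auto simp: defs)
    have d: "n = g * u" "a = g * v" "n' = g' * u'" "a' = g' * v'" by (auto simp: defs)
    have cop: "coprime u v" "coprime u' v'" unfolding defs using that by (auto intro!: div_gcd_coprime)
    have "(g * g') * (u * v') = (g * g') * (u' * v)"
      using that(1) unfolding d by (simp only: mult_ac)
    then have "u * v' = u' * v" using g by simp
    then have "u = u' \<and> v' = v"
      using coprime_crossproduct_nat[OF cop] by blast
    then show ?thesis unfolding defs by simp
  qed
  have "card ?Q \<le> card ?G"
  proof (rule card_inj_on_le[where f="?f"])
    show "inj_on ?f ?Q"
    proof (rule inj_onI)
      fix s t assume sQ: "s \<in> ?Q" and tQ: "t \<in> ?Q" and ft: "?f s = ?f t"
      obtain n a n' a' where s: "s = ((n, a), (n', a'))" by (metis surj_pair)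
      obtain m b m' b' where t: "t = ((m, b), (m', b'))" by (metis surj_pair)
      have h: "n \<in> {1..N}" "a \<in> {1..A}" "n' \<in> {1..N}" "a' \<in> {1..A}" "n * a' = n' * a"
        using sQ unfolding s by auto
      have h2: "m \<in> {1..N}" "b \<in> {1..A}" "m' \<in> {1..N}" "b' \<in> {1..A}" "m * b' = m' * b"
        using tQ unfolding t by auto
      have e: "gcd n a = gcd m b" "gcd n' a' = gcd m' b'" "n div gcd n a = m div gcd m b" "a' div gcd n' a' = b' div gcd m' b'"
        using ft unfolding s t prod.case prod.inject by blast+
      have k1: "n' div gcd n' a' = n div gcd n a" "a div gcd n a = a' div gcd n' a'"
        using key[OF h(5)] h by auto
      have k2: "m' div gcd m' b' = m div gcd m b" "b div gcd m b = b' div gcd m' b'"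
        using key[OF h2(5)] h2 by auto
      have r: "gcd x y * (x div gcd x y) = x" "gcd x y * (y div gcd x y) = y" for x y :: nat by simp_all
      have "n = m" using arg_cong2[where f="(*)", OF e(1) e(3)] unfolding r .
      moreover have "a' = b'" using arg_cong2[where f="(*)", OF e(2) e(4)] unfolding r .
      moreover have "n' = m'"
        using arg_cong2[where f="(*)", OF e(2) trans[OF k1(1) trans[OF e(3) k2(1)[symmetric]]]] unfolding r .
      moreover have "a = b"
        using arg_cong2[where f="(*)", OF e(1) trans[OF k1(2) trans[OF e(4) k2(2)[symmetric]]]] unfolding r .
      ultimately show "s = t" unfolding s t by blast
    qed
    show "?f ` ?Q \<subseteq> ?G"
    proof (rule image_subsetI)
      fix s assume sQ: "s \<in> ?Q"
      obtain n a n' a' where s: "s = ((n, a), (n', a'))" by (metis surj_pair)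
      have h: "n \<in> {1..N}" "a \<in> {1..A}" "n' \<in> {1..N}" "a' \<in> {1..A}" "n * a' = n' * a"
        using sQ unfolding s by auto
      let ?g = "gcd n a" and ?g' = "gcd n' a'"
      have nz: "n \<noteq> 0" "a \<noteq> 0" "n' \<noteq> 0" "a' \<noteq> 0" using h by auto
      have gl: "?g \<le> n" "?g \<le> a" "?g' \<le> n'" "?g' \<le> a'"
        using gcd_le1_nat[OF nz(1), of a] gcd_le2_nat[OF nz(2), of n] gcd_le1_nat[OF nz(3), of a'] gcd_le2_nat[OF nz(4), of n'] by blast+
      have "?g \<noteq> 0" "?g' \<noteq> 0" using nz by simp_all
      then have g: "?g \<in> {1..A}" "?g' \<in> {1..A}" using gl h unfolding atLeastAtMost_iff by linarith+
      have le: "n div ?g \<le> N div ?g" "a' div ?g' \<le> A div ?g'"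
        using h unfolding atLeastAtMost_iff by (intro div_le_mono; blast)+
      have pos: "n div ?g \<ge> 1" "a' div ?g' \<ge> 1"
        using one_le_div[OF gl(1)] one_le_div[OF gl(4)] \<open>?g \<noteq> 0\<close> \<open>?g' \<noteq> 0\<close> by blast+
      have "(?g, ?g') \<in> {1..A} \<times> {1..A}" using g by (rule SigmaI)
      moreover have "(n div ?g, a' div ?g') \<in> {1..N div ?g} \<times> {1..A div ?g'}"
        using le pos by (intro SigmaI) (simp_all only: atLeastAtMost_iff)
      ultimately show "?f s \<in> ?G" unfolding s prod.case mem_Sigma_iff by blast
    qed
    show "finite ?G" by auto
  qed
  also have "card ?G = (\<Sum>z\<in>{1..A} \<times> {1..A}. card (case z of (g, g') \<Rightarrow> {1..N div g} \<times> {1..A div g'}))"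
    by (rule card_SigmaI) auto
  also have "\<dots> = (\<Sum>(g, g')\<in>{1..A} \<times> {1..A}. (N div g) * (A div g'))"
    by (rule sum.cong) (auto simp: card_cartesian_product)
  finally have "real (card ?Q) \<le> real (\<Sum>(g, g')\<in>{1..A} \<times> {1..A}. (N div g) * (A div g'))"
    by (simp only: of_nat_le_iff)
  also have "\<dots> = (\<Sum>(g, g')\<in>{1..A} \<times> {1..A}. real (N div g) * real (A div g'))"
    by (simp add: case_prod_unfold)
  also have "\<dots> \<le> (\<Sum>(g, g')\<in>{1..A} \<times> {1..A}. (real N * (1 / g)) * (real A * (1 / g')))"
  proof (rule sum_mono, clarify)
    fix g g' :: nat
    have d: "real (m div k) \<le> real m * (1 / k)" for m k :: nat
      using of_int_floor_le[of "real m / real k"] by (simp add: floor_divide_of_nat_eq)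
    show "real (N div g) * real (A div g') \<le> (real N * (1 / g)) * (real A * (1 / g'))"
      by (intro mult_mono d) auto
  qed
  also have "\<dots> = (\<Sum>g=1..A. real N * (1 / g)) * (\<Sum>g=1..A. real A * (1 / g))"
    unfolding sum_product by (simp add: sum.cartesian_product)
  also have "\<dots> = real N * real A * ((\<Sum>g=1..A. 1 / real g) * (\<Sum>g=1..A. 1 / real g))"
    unfolding sum_distrib_left[symmetric] by (simp only: mult_ac)
  also have "\<dots> \<le> real N * real A * ((1 + ln A) * (1 + ln A))"
    using harmonic_le[OF A] A by (intro mult_left_mono mult_mono sum_nonneg) auto
  finally show ?thesis by (simp add: power2_eq_square)
qed

text \<open>Jensen's inequality for powers, by induction: summing the nonnegative products (\<omega>
  x - \<omega> y) (\<omega> x^(k+1) - \<omega> y^(k+1)) over all pairs gives Chebyshev's sum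
  inequality, which raises the exponent by one.\<close>

lemma weighted_power_mean:
  fixes \<nu> \<omega> :: "'a \<Rightarrow> real"
  assumes "\<And>x. x \<in> X \<Longrightarrow> \<nu> x \<ge> 0" "\<And>x. x \<in> X \<Longrightarrow> \<omega> x \<ge> 0"
  shows "(\<Sum>x\<in>X. \<nu> x * \<omega> x) ^ Suc k \<le> (\<Sum>x\<in>X. \<nu> x) ^ k * (\<Sum>x\<in>X. \<nu> x * \<omega> x ^ Suc k)"
proof (induction k)
  case (Suc k)
  let ?S = "\<Sum>x\<in>X. \<nu> x" and ?W = "\<lambda>j. \<Sum>x\<in>X. \<nu> x * \<omega> x ^ j"
  have nn: "0 \<le> (\<Sum>x\<in>X. \<Sum>y\<in>X. \<nu> x * \<nu> y * ((\<omega> x - \<omega> y) * (\<omega> x ^ Suc k - \<omega> y ^ Suc k)))"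
  proof (intro sum_nonneg)
    fix x y assume xy: "x \<in> X" "y \<in> X"
    have "0 \<le> (\<omega> x - \<omega> y) * (\<omega> x ^ Suc k - \<omega> y ^ Suc k)"
    proof (cases "\<omega> x \<le> \<omega> y")
      case True
      then show ?thesis using power_mono[OF True, of "Suc k"] assms(2)[OF xy(1)] by (intro mult_nonpos_nonpos) auto
    next
      case False
      then show ?thesis using power_mono[of "\<omega> y" "\<omega> x" "Suc k"] assms(2)[OF xy(2)] by (intro mult_nonneg_nonneg) auto
    qed
    then show "0 \<le> \<nu> x * \<nu> y * ((\<omega> x - \<omega> y) * (\<omega> x ^ Suc k - \<omega> y ^ Suc k))"
      using assms(1)[OF xy(1)] assms(1)[OF xy(2)] by (rule_tac mult_nonneg_nonneg) (rule mult_nonneg_nonneg)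
  qed
  have gen: "u * v * ((a - b) * (c - d)) = (u * (a * c)) * v + u * (v * (b * d)) - (u * a) * (v * d) - (u * c) * (v * b)"
    for u v a b c d :: real by (simp add: algebra_simps)
  have "(\<Sum>x\<in>X. \<Sum>y\<in>X. \<nu> x * \<nu> y * ((\<omega> x - \<omega> y) * (\<omega> x ^ Suc k - \<omega> y ^ Suc k)))
      = (\<Sum>x\<in>X. \<Sum>y\<in>X. (\<nu> x * \<omega> x ^ Suc (Suc k)) * \<nu> y + \<nu> x * (\<nu> y * \<omega> y ^ Suc (Suc k))
          - (\<nu> x * \<omega> x) * (\<nu> y * \<omega> y ^ Suc k) - (\<nu> x * \<omega> x ^ Suc k) * (\<nu> y * \<omega> y))"
    by (intro sum.cong refl) (simp only: power_Suc[of _ "Suc k"] gen)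
  also have "\<dots> = ?W (Suc (Suc k)) * ?S + ?S * ?W (Suc (Suc k)) - (\<Sum>x\<in>X. \<nu> x * \<omega> x) * ?W (Suc k) - ?W (Suc k) * (\<Sum>x\<in>X. \<nu> x * \<omega> x)"
    by (simp only: sum_subtractf sum.distrib sum_product)
  finally have eq: "(\<Sum>x\<in>X. \<Sum>y\<in>X. \<nu> x * \<nu> y * ((\<omega> x - \<omega> y) * (\<omega> x ^ Suc k - \<omega> y ^ Suc k))) = \<dots>" .
  have half: "P * V \<le> S * W" if "0 \<le> W * S + S * W - P * V - V * P" for P V S W :: real
    using that by (simp add: mult.commute)
  have cheb: "(\<Sum>x\<in>X. \<nu> x * \<omega> x) * ?W (Suc k) \<le> ?S * ?W (Suc (Suc k))"
    by (rule half) (rule nn[unfolded eq])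
  have P0: "(\<Sum>x\<in>X. \<nu> x * \<omega> x) \<ge> 0" using assms by (intro sum_nonneg mult_nonneg_nonneg) auto
  have S0: "?S \<ge> 0" using assms by (intro sum_nonneg) auto
  have "(\<Sum>x\<in>X. \<nu> x * \<omega> x) ^ Suc (Suc k) \<le> (\<Sum>x\<in>X. \<nu> x * \<omega> x) * (?S ^ k * ?W (Suc k))"
    unfolding power_Suc[of _ "Suc k"] by (rule mult_left_mono[OF Suc P0])
  also have "\<dots> = ?S ^ k * ((\<Sum>x\<in>X. \<nu> x * \<omega> x) * ?W (Suc k))" by (simp only: mult.left_commute)
  also have "\<dots> \<le> ?S ^ k * (?S * ?W (Suc (Suc k)))" by (rule mult_left_mono[OF cheb]) (simp add: S0)
  also have "\<dots> = ?S ^ Suc k * ?W (Suc (Suc k))" by (simp only: power_Suc2 mult.assoc)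
  finally show ?case .
qed simp

lemma cauchy_schwarz_sum:
  fixes a b :: "'a \<Rightarrow> real"
  shows "(\<Sum>x\<in>X. a x * b x)\<^sup>2 \<le> (\<Sum>x\<in>X. (a x)\<^sup>2) * (\<Sum>x\<in>X. (b x)\<^sup>2)"
proof -
  have gen: "(s * u - t * v)\<^sup>2 = s\<^sup>2 * u\<^sup>2 + v\<^sup>2 * t\<^sup>2 - 2 * ((s * v) * (t * u))" for s t u v :: real
    by (simp add: power2_eq_square algebra_simps)
  have "0 \<le> (\<Sum>x\<in>X. \<Sum>y\<in>X. (a x * b y - a y * b x)\<^sup>2)" by (intro sum_nonneg) simp
  also have "\<dots> = (\<Sum>x\<in>X. \<Sum>y\<in>X. (a x)\<^sup>2 * (b y)\<^sup>2 + (b x)\<^sup>2 * (a y)\<^sup>2 - 2 * ((a x * b x) * (a y * b y)))"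
    by (simp only: gen)
  also have "\<dots> = (\<Sum>x\<in>X. (a x)\<^sup>2) * (\<Sum>x\<in>X. (b x)\<^sup>2) + (\<Sum>x\<in>X. (b x)\<^sup>2) * (\<Sum>x\<in>X. (a x)\<^sup>2)
      - 2 * ((\<Sum>x\<in>X. a x * b x) * (\<Sum>x\<in>X. a x * b x))"
    by (simp only: sum_subtractf sum.distrib sum_product) (simp only: sum_distrib_left)
  finally have *: "0 \<le> \<dots>" .
  have "R\<^sup>2 \<le> P * Q" if "0 \<le> P * Q + Q * P - 2 * (R * R)" for P Q R :: real
    using that by (simp add: power2_eq_square mult.commute)
  from this[OF *] show ?thesis .
qed

text \<open>The power mean with exponent r, then Cauchy-Schwarz for \<nu> against \<omega>^r.
  Afterwards \<nu> occurs only through its first two moments, which count fractions, and \<omega>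
  only through an even moment as in \<open>burgess_moment\<close>.\<close>

lemma hoelder_weighted:
  fixes \<nu> \<omega> :: "'a \<Rightarrow> real"
  assumes "\<And>x. x \<in> X \<Longrightarrow> \<nu> x \<ge> 0" "\<And>x. x \<in> X \<Longrightarrow> \<omega> x \<ge> 0" and r: "r \<ge> 1"
  shows "(\<Sum>x\<in>X. \<nu> x * \<omega> x) ^ (2 * r)
    \<le> (\<Sum>x\<in>X. \<nu> x) ^ (2 * r - 2) * (\<Sum>x\<in>X. (\<nu> x)\<^sup>2) * (\<Sum>x\<in>X. \<omega> x ^ (2 * r))"
proof -
  obtain k where k: "r = Suc k" using r by (cases r) auto
  let ?P = "\<Sum>x\<in>X. \<nu> x * \<omega> x" and ?S = "\<Sum>x\<in>X. \<nu> x"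
  have P0: "?P \<ge> 0" using assms by (intro sum_nonneg mult_nonneg_nonneg) auto
  have "?P ^ (2 * r) = (?P ^ r)\<^sup>2" by (simp add: power_mult[symmetric] mult.commute)
  also have "\<dots> \<le> (?S ^ k * (\<Sum>x\<in>X. \<nu> x * \<omega> x ^ r))\<^sup>2"
    unfolding k using P0 weighted_power_mean[of X \<nu> \<omega> k, OF assms(1,2)] by (intro power_mono) auto
  also have "\<dots> = (?S ^ k)\<^sup>2 * (\<Sum>x\<in>X. \<nu> x * \<omega> x ^ r)\<^sup>2" by (rule power_mult_distrib)
  also have "\<dots> \<le> (?S ^ k)\<^sup>2 * ((\<Sum>x\<in>X. (\<nu> x)\<^sup>2) * (\<Sum>x\<in>X. (\<omega> x ^ r)\<^sup>2))"
    by (intro mult_left_mono cauchy_schwarz_sum) simp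
  also have "(?S ^ k)\<^sup>2 = ?S ^ (2 * r - 2)" by (simp add: k power_mult[symmetric] mult.commute)
  also have "(\<Sum>x\<in>X. (\<omega> x ^ r)\<^sup>2) = (\<Sum>x\<in>X. \<omega> x ^ (2 * r))"
    by (simp add: power_mult[symmetric] mult.commute)
  finally show ?thesis by (simp only: mult.assoc)
qed

section \<open>Burgess' shift by products and the choice of parameters\<close>

lemma shifted_sum_diff_le:
  fixes g :: "nat \<Rightarrow> real"
  assumes "\<And>n. \<bar>g n\<bar> \<le> 1"
  shows "\<bar>(\<Sum>n=1..N. g (n + h)) - (\<Sum>n=1..N. g n)\<bar> \<le> 2 * real h"
proof (induction h)
  case (Suc h)
  have "(\<Sum>n=1..N. g (n + Suc h)) - (\<Sum>n=1..N. g (n + h)) = g (N + Suc h) - g (Suc h)"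
    by (induction N) auto
  then have "\<bar>(\<Sum>n=1..N. g (n + Suc h)) - (\<Sum>n=1..N. g (n + h))\<bar> \<le> 2"
    using assms[of "N + Suc h"] assms[of "Suc h"] by linarith
  then show ?case using Suc by simp
qed simp

definition burgess_avg :: "nat \<Rightarrow> nat \<Rightarrow> nat \<Rightarrow> nat \<Rightarrow> real" where
  "burgess_avg p N A B = (\<Sum>n=1..N. \<Sum>a=1..A. \<bar>\<Sum>b=1..B. real_of_int (Legendre (int (n + a * b)) (int p))\<bar>)"

text \<open>A shift of the interval by a b exchanges at most a b terms at either end, which costs at
  most 2 a b; this is averaged over all a <= A and b <= B.\<close>

lemma burgess_shift:
  "real A * real B * \<bar>\<Sum>n=1..N. real_of_int (Legendre (int n) (int p))\<bar> \<le> burgess_avg p N A B + 2 * (real A * real B)\<^sup>2"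
proof -
  define g where "g = (\<lambda>n. real_of_int (Legendre (int n) (int p)))"
  have g1: "\<bar>g n\<bar> \<le> 1" for n unfolding g_def using abs_Legendre_le[of "int n" "int p"] by linarith
  let ?S = "\<Sum>n=1..N. g n"
  let ?D = "\<Sum>a=1..A. \<Sum>b=1..B. \<Sum>n=1..N. g (n + a * b)"
  have "\<bar>?D\<bar> \<le> burgess_avg p N A B"
  proof -
    have "?D = (\<Sum>n=1..N. \<Sum>a=1..A. \<Sum>b=1..B. g (n + a * b))"
    proof -
      have "?D = (\<Sum>a=1..A. \<Sum>n=1..N. \<Sum>b=1..B. g (n + a * b))" by (intro sum.cong refl sum.swap)
      also have "\<dots> = (\<Sum>n=1..N. \<Sum>a=1..A. \<Sum>b=1..B. g (n + a * b))" by (rule sum.swap)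
      finally show ?thesis .
    qed
    then have "\<bar>?D\<bar> \<le> (\<Sum>n=1..N. \<bar>\<Sum>a=1..A. \<Sum>b=1..B. g (n + a * b)\<bar>)" by (simp only: sum_abs)
    also have "\<dots> \<le> (\<Sum>n=1..N. \<Sum>a=1..A. \<bar>\<Sum>b=1..B. g (n + a * b)\<bar>)" by (intro sum_mono sum_abs)
    finally show ?thesis by (simp add: burgess_avg_def g_def)
  qed
  moreover have "\<bar>real A * real B * ?S - ?D\<bar> \<le> 2 * (real A * real B)\<^sup>2"
  proof -
    have "real A * real B * ?S - ?D = (\<Sum>a=1..A. \<Sum>b=1..B. ?S - (\<Sum>n=1..N. g (n + a * b)))"
      by (simp add: sum_subtractf)
    also have "\<bar>\<dots>\<bar> \<le> (\<Sum>a=1..A. \<Sum>b=1..B. \<bar>?S - (\<Sum>n=1..N. g (n + a * b))\<bar>)"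
      by (intro order_trans[OF sum_abs] sum_mono sum_abs)
    also have "\<dots> \<le> (\<Sum>a=1..A. \<Sum>b=1..B. 2 * (real A * real B))"
    proof (intro sum_mono)
      fix a b assume ab: "a \<in> {1..A}" "b \<in> {1..B}"
      have "\<bar>?S - (\<Sum>n=1..N. g (n + a * b))\<bar> \<le> 2 * real (a * b)"
        using shifted_sum_diff_le[where g=g and N=N and h="a * b", OF g1] by (simp only: abs_minus_commute)
      moreover have "real (a * b) \<le> real A * real B" unfolding of_nat_mult using ab by (intro mult_mono) auto
      ultimately show "\<bar>?S - (\<Sum>n=1..N. g (n + a * b))\<bar> \<le> 2 * (real A * real B)" by linarith
    qed
    finally show ?thesis by (simp add: power2_eq_square mult_ac)
  qed
  moreover have "\<bar>real A * real B * ?S\<bar> = real A * real B * \<bar>?S\<bar>" by (simp add: abs_mult)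
  ultimately show ?thesis unfolding g_def by linarith
qed

text \<open>Modulo p, n + a b is a (n/a + b), so up to the sign of a the inner sum is a sum over an
  interval of length B following the residue n/a. Hoelder over these residues, weighted by their
  number of representations, reduces the average to a complete moment.\<close>

lemma burgess_core:
  assumes p: "prime p" "2 < p" and pos: "1 \<le> r" "1 \<le> A" "1 \<le> B" "1 \<le> N" and NA: "N * A < p" and Bp: "B < p"
  shows "burgess_avg p N A B ^ (2 * r)
    \<le> (real N * real A) ^ (2 * r - 2) * (real N * real A * (1 + ln A)\<^sup>2)
      * (real r ^ (2 * r) * real B ^ r * p + 22 * real r * real B ^ (2 * r) * sqrt p)"
proof -
  define K where "K = {1..N} \<times> {1..A}"
  define X where "X = {0..<int p}"
  have fin: "finite K" "finite X" by (auto simp: K_def X_def)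
  have aA: "\<not> int p dvd int a" if "a \<in> {1..A}" for a
  proof
    assume "int p dvd int a"
    then have "p \<le> a" using that by (intro dvd_imp_le) auto
    also have "a \<le> A" using that by simp
    also have "A \<le> N * A" using pos by simp
    finally show False using NA by simp
  qed
  have "\<forall>k\<in>K. \<exists>x. x \<in> X \<and> [int (snd k) * x = int (fst k)] (mod int p)"
  proof
    fix k assume k: "k \<in> K"
    have "coprime (int (snd k)) (int p)"
      using aA[of "snd k"] k p by (simp add: K_def coprime_commute prime_imp_coprime mem_Times_iff)
    then obtain x where x: "[int (snd k) * x = 1] (mod int p)" using cong_solve_coprime_int by blast
    have "[int (snd k) * (x * int (fst k) mod int p) = int (snd k) * (x * int (fst k))] (mod int p)"
      by (intro cong_mult cong_refl) (simp add: Cong.cong_def)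
    also have "int (snd k) * (x * int (fst k)) = (int (snd k) * x) * int (fst k)" by simp
    also have "[\<dots> = 1 * int (fst k)] (mod int p)" by (intro cong_mult x cong_refl)
    finally show "\<exists>x. x \<in> X \<and> [int (snd k) * x = int (fst k)] (mod int p)"
      using p by (intro exI[of _ "x * int (fst k) mod int p"]) (auto simp: X_def)
  qed
  \<comment> \<open>\<open>\<xi> (n, a)\<close> is the residue n/a modulo p.\<close>
  from bchoice[OF this] obtain \<xi> where \<xi>0: "\<forall>k\<in>K. \<xi> k \<in> X \<and> [int (snd k) * \<xi> k = int (fst k)] (mod int p)" by blast
  then have \<xi>: "\<And>k. k \<in> K \<Longrightarrow> \<xi> k \<in> X" "\<And>k. k \<in> K \<Longrightarrow> [int (snd k) * \<xi> k = int (fst k)] (mod int p)" by blast+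
  have \<xi>X: "\<xi> ` K \<subseteq> X" using \<xi> by auto
  define \<nu> where "\<nu> = (\<lambda>x. real (card {k\<in>K. \<xi> k = x}))"
  define W where "W = (\<lambda>x. real_of_int (\<Sum>b\<in>{1..int B}. Legendre (x + b) (int p)))"
  have summand: "\<bar>\<Sum>b=1..B. real_of_int (Legendre (int (n + a * b)) (int p))\<bar> = \<bar>W (\<xi> (n, a))\<bar>"
    if k: "(n, a) \<in> K" for n a
  proof -
    let ?x = "\<xi> (n, a)"
    have "Legendre (int (n + a * b)) (int p) = Legendre (int a) (int p) * Legendre (?x + int b) (int p)" for b
    proof -
      have "[int a * ?x + int a * int b = int n + int a * int b] (mod int p)"
        using \<xi>(2)[OF k] by (intro cong_add cong_refl) simp
      then have "[int a * (?x + int b) = int (n + a * b)] (mod int p)" by (simp add: algebra_simps)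
      from Legendre_cong[OF this] show ?thesis by (simp only: Legendre_mult[OF p])
    qed
    then have "(\<Sum>b=1..B. real_of_int (Legendre (int (n + a * b)) (int p)))
        = real_of_int (Legendre (int a) (int p)) * (\<Sum>b=1..B. real_of_int (Legendre (?x + int b) (int p)))"
      by (simp add: sum_distrib_left)
    moreover have "(\<Sum>b=1..B. real_of_int (Legendre (?x + int b) (int p))) = W ?x"
    proof -
      have "(\<Sum>b\<in>int ` {1..B}. Legendre (?x + b) (int p)) = (\<Sum>b=1..B. Legendre (?x + int b) (int p))"
        by (subst sum.reindex) auto
      then show ?thesis unfolding W_def by (simp add: image_int_atLeastAtMost)
    qed
    moreover have "\<bar>real_of_int (Legendre (int a) (int p))\<bar> = 1"
    proof -
      have "Legendre (int a) (int p) \<noteq> 0"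
        using aA[of a] k by (simp add: Legendre_zero_iff cong_0_iff K_def)
      then show ?thesis using Legendre_values[of "int a" "int p"] by auto
    qed
    ultimately show ?thesis by (simp add: abs_mult)
  qed
  have "burgess_avg p N A B = (\<Sum>k\<in>K. \<bar>W (\<xi> k)\<bar>)"
    unfolding burgess_avg_def K_def sum.cartesian_product
    by (rule sum.cong[OF refl]) (use summand in \<open>auto simp: K_def\<close>)
  also have "\<dots> = (\<Sum>x\<in>X. \<Sum>k\<in>{k\<in>K. \<xi> k = x}. \<bar>W (\<xi> k)\<bar>)" by (rule sum.group[symmetric, OF fin \<xi>X])
  also have "\<dots> = (\<Sum>x\<in>X. \<nu> x * \<bar>W x\<bar>)" by (rule sum.cong) (auto simp: \<nu>_def)
  finally have avg: "burgess_avg p N A B = (\<Sum>x\<in>X. \<nu> x * \<bar>W x\<bar>)" .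
  have s1: "(\<Sum>x\<in>X. \<nu> x) = real N * real A"
  proof -
    have "(\<Sum>x\<in>X. \<nu> x) = (\<Sum>x\<in>X. \<Sum>k\<in>{k\<in>K. \<xi> k = x}. 1)" by (simp add: \<nu>_def)
    also have "\<dots> = (\<Sum>k\<in>K. 1)" by (rule sum.group[OF fin \<xi>X])
    finally show ?thesis by (simp add: K_def)
  qed
  have s2: "(\<Sum>x\<in>X. (\<nu> x)\<^sup>2) \<le> real N * real A * (1 + ln A)\<^sup>2"
  proof -
    let ?Q = "{((n, a), (n', a')) \<in> ({1..N} \<times> {1..A}) \<times> ({1..N} \<times> {1..A}). n * a' = n' * (a::nat)}"
    have finQ: "finite ?Q" by (rule finite_subset[of _ "K \<times> K"]) (auto simp: K_def)
    have "(\<Sum>x\<in>X. (\<nu> x)\<^sup>2) = (\<Sum>x\<in>X. \<Sum>k\<in>{k\<in>K. \<xi> k = x}. \<nu> (\<xi> k))"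
    proof (rule sum.cong[OF refl])
      fix x
      have "(\<Sum>k\<in>{k\<in>K. \<xi> k = x}. \<nu> (\<xi> k)) = (\<Sum>k\<in>{k\<in>K. \<xi> k = x}. \<nu> x)" by (rule sum.cong) auto
      also have "\<dots> = \<nu> x * \<nu> x" by (simp add: \<nu>_def)
      finally show "(\<nu> x)\<^sup>2 = (\<Sum>k\<in>{k\<in>K. \<xi> k = x}. \<nu> (\<xi> k))" unfolding power2_eq_square by (rule sym)
    qed
    also have "\<dots> = (\<Sum>k\<in>K. \<nu> (\<xi> k))" by (rule sum.group[OF fin \<xi>X])
    also have "\<dots> = real (card (Sigma K (\<lambda>k. {k'\<in>K. \<xi> k' = \<xi> k})))"
      using fin by (simp add: \<nu>_def card_SigmaI)
    also have "\<dots> \<le> real (card ?Q)"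
    proof (subst of_nat_le_iff, rule card_mono[OF finQ], rule subsetI)
      fix z assume z: "z \<in> Sigma K (\<lambda>k. {k'\<in>K. \<xi> k' = \<xi> k})"
      obtain n a n' a' where zz: "z = ((n, a), (n', a'))" by (metis surj_pair)
      have k: "(n, a) \<in> K" "(n', a') \<in> K" "\<xi> (n', a') = \<xi> (n, a)" using z zz by auto
      let ?x = "\<xi> (n, a)"
      have c1: "[int a * ?x = int n] (mod int p)" using \<xi>(2)[OF k(1)] by simp
      have c2: "[int a' * ?x = int n'] (mod int p)" using \<xi>(2)[OF k(2)] k(3) by simp
      have "[int n * int a' = int a * ?x * int a'] (mod int p)" by (rule cong_mult[OF cong_sym[OF c1] cong_refl])
      also have "int a * ?x * int a' = int a' * ?x * int a" by simp
      also have "[\<dots> = int n' * int a] (mod int p)" by (rule cong_mult[OF c2 cong_refl])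
      finally have "[n * a' = n' * a] (mod p)" by (simp add: cong_int_iff[symmetric])
      \<comment> \<open>Here N A < p enters: both cross products lie below p, so congruent fractions
        are equal fractions.\<close>
      moreover have "n * a' < p" "n' * a < p"
        using k NA mult_le_mono[of n N a' A] mult_le_mono[of n' N a A] by (auto simp: K_def)
      ultimately have "n * a' = n' * a" by (simp add: Cong.cong_def)
      then show "z \<in> ?Q" using k zz by (auto simp: K_def)
    qed
    also have "\<dots> \<le> real N * real A * (1 + ln A)\<^sup>2" by (rule card_equal_fractions_le[OF pos(2)])
    finally show ?thesis .
  qed
  have s3: "(\<Sum>x\<in>X. \<bar>W x\<bar> ^ (2 * r)) \<le> real r ^ (2 * r) * real B ^ r * p + 22 * real r * real B ^ (2 * r) * sqrt p"
    using burgess_moment[OF p pos(3) Bp, of r] unfolding X_def W_def by (simp add: power_even_abs)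
  have "burgess_avg p N A B ^ (2 * r) \<le> (\<Sum>x\<in>X. \<nu> x) ^ (2 * r - 2) * (\<Sum>x\<in>X. (\<nu> x)\<^sup>2) * (\<Sum>x\<in>X. \<bar>W x\<bar> ^ (2 * r))"
    unfolding avg by (rule hoelder_weighted) (use pos in \<open>auto simp: \<nu>_def\<close>)
  also have "\<dots> \<le> (real N * real A) ^ (2 * r - 2) * (real N * real A * (1 + ln A)\<^sup>2)
      * (real r ^ (2 * r) * real B ^ r * p + 22 * real r * real B ^ (2 * r) * sqrt p)"
    unfolding s1 using s2 s3 by (intro mult_mono mult_left_mono) (auto intro!: sum_nonneg mult_nonneg_nonneg)
  finally show ?thesis .
qed

lemma nat_ceiling_bounds:
  fixes x :: real
  assumes "1 \<le> x"
  shows "x \<le> real (nat \<lceil>x\<rceil>)" "real (nat \<lceil>x\<rceil>) \<le> 2 * x" "1 \<le> nat \<lceil>x\<rceil>"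
  using assms by linarith+

lemma nat_floor_bounds:
  fixes x :: real
  assumes "1 \<le> x"
  shows "real (nat \<lfloor>x\<rfloor>) \<le> x" "x \<le> 2 * real (nat \<lfloor>x\<rfloor>)" "1 \<le> nat \<lfloor>x\<rfloor>"
proof -
  have "1 \<le> \<lfloor>x\<rfloor>" using assms by (simp add: one_le_floor)
  then show "real (nat \<lfloor>x\<rfloor>) \<le> x" "x \<le> 2 * real (nat \<lfloor>x\<rfloor>)" "1 \<le> nat \<lfloor>x\<rfloor>" by linarith+
qed

text \<open>The parameters r, B and A are chosen so that the diagonal and the Weil part of the
  moment balance and the shifts stay short. A factor exp(-u) is then saved in the 2r-th power of the
  average, that is exp(-u/(2r)) in the average itself.\<close>

lemma burgess_bound:
  fixes p :: nat and \<epsilon> L u x0 :: real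
  assumes p: "prime p" "2 < p" and L: "L = ln p" "1 \<le> L" and \<epsilon>: "0 < \<epsilon>" "\<epsilon> \<le> 1 / 8"
    and u: "u = L powr (1 - \<epsilon>)" and x0: "x0 = exp (L / 4 + u)"
    and c1: "u < L / 4" and c2: "16 * L ^ 3 \<le> exp (L / 4)" and c3: "11776 * L ^ 6 \<le> exp (u / 2)"
    and c4: "exp (- (L powr (1 - 2 * \<epsilon>) / 4)) \<le> L powr (-\<epsilon>) / 2" and c5: "2 / L \<le> L powr (-\<epsilon>) / 2"
  shows "\<bar>\<Sum>n=1..nat \<lfloor>x0\<rfloor>. real_of_int (Legendre (int n) (int p))\<bar> \<le> L powr (-\<epsilon>) * x0"
proof -
  have L0: "L > 0" using L by linarith
  have pL: "real p = exp L" using p L by simp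
  have sp: "sqrt p = exp (L / 2)"
  proof -
    have "exp (L / 2) * exp (L / 2) = exp L" by (simp add: exp_add[symmetric])
    then show ?thesis unfolding pL by (metis real_sqrt_abs2 abs_exp_cancel)
  qed
  \<comment> \<open>The identity u l = L and r >= l make E = p^(1/(2r)) at most exp(u/2), so B stays
    small against the surplus exp(2 u) found below.\<close>
  define l where "l = L powr \<epsilon>"
  have l1: "l \<ge> 1" unfolding l_def using L \<epsilon> by (intro ge_one_powr_ge_zero) auto
  have lL: "l \<le> L" unfolding l_def using L \<epsilon> powr_mono[of \<epsilon> 1 L] by simp
  have ul: "u * l = L" unfolding u l_def using L0 by (simp add: powr_add[symmetric])
  have u0: "u > 0" unfolding u using L0 by simp
  define r where "r = nat \<lceil>l\<rceil>"
  have r: "l \<le> real r" "real r \<le> 2 * l" "1 \<le> r" unfolding r_def by (rule nat_ceiling_bounds[OF l1])+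
  have r0: "real r > 0" using r by simp
  define E where "E = exp (L / (2 * real r))"
  have E1: "E \<ge> 1" unfolding E_def using L0 r0 by simp
  have Er: "E ^ r = sqrt p"
    unfolding sp E_def exp_of_nat_mult[symmetric] using r0 by simp
  have Eu: "E \<le> exp (u / 2)"
  proof -
    have "L / (2 * real r) \<le> L / (2 * l)" using L0 l1 r by (intro divide_left_mono) auto
    also have "\<dots> = u / 2" using ul l1 by (simp add: field_simps)
    finally show ?thesis by (simp add: E_def)
  qed
  \<comment> \<open>B >= r^2 p^(1/(2r)) makes the diagonal term r^(2r) B^r p at most B^(2r) sqrt p,
    the size of the Weil term without its factor 22 r.\<close>
  define b0 where "b0 = (real r)\<^sup>2 * E"
  have b01: "b0 \<ge> 1" unfolding b0_def using r E1 by (intro mult_ge1_I) (auto simp: one_le_power)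
  define B where "B = nat \<lceil>b0\<rceil>"
  have B: "b0 \<le> real B" "real B \<le> 2 * b0" "1 \<le> B" unfolding B_def by (rule nat_ceiling_bounds[OF b01])+
  have Bup: "real B \<le> 8 * L\<^sup>2 * exp (u / 2)"
  proof -
    have "(real r)\<^sup>2 \<le> (2 * L)\<^sup>2" using r lL by (intro power_mono) auto
    then have "b0 \<le> (2 * L)\<^sup>2 * exp (u / 2)" unfolding b0_def using Eu E1 by (intro mult_mono) auto
    then show ?thesis using B(2) by (simp add: power_mult_distrib)
  qed
  have x01: "x0 \<ge> 1" unfolding x0 using L0 u0 by simp
  define N where "N = nat \<lfloor>x0\<rfloor>"
  have N: "real N \<le> x0" "x0 \<le> 2 * real N" "1 \<le> N" unfolding N_def by (rule nat_floor_bounds[OF x01])+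
  define D where "D = real B * L"
  have D1: "D \<ge> 1" unfolding D_def using B(3) L by (intro mult_ge1_I) auto
  have Dup: "D \<le> 8 * L\<^sup>2 * exp (u / 2) * L" unfolding D_def using Bup L0 by (intro mult_right_mono) auto
  have DN: "D \<le> real N"
  proof -
    note Dup
    also have "\<dots> = (16 * L ^ 3) * exp (u / 2) / 2" by (simp add: power2_eq_square power3_eq_cube)
    also have "\<dots> \<le> exp (L / 4) * exp u / 2"
      using c2 u0 by (intro divide_right_mono mult_mono) auto
    also have "\<dots> = x0 / 2" unfolding x0 by (simp add: exp_add)
    finally show ?thesis using N by linarith
  qed
  have t1: "1 \<le> real N / D" using DN D1 by (simp add: le_divide_eq)
  define A where "A = nat \<lfloor>real N / D\<rfloor>"
  have A: "real A \<le> real N / D" "real N / D \<le> 2 * real A" "1 \<le> A" unfolding A_def by (rule nat_floor_bounds[OF t1])+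
  have AD: "real A * D \<le> real N" using A(1) D1 by (simp add: le_divide_eq)
  have AB: "real A * real B \<le> real N / L" using AD L0 by (simp add: D_def field_simps)
  define M where "M = real N * real A"
  have M0: "M > 0" unfolding M_def using N A by simp
  have x0sq: "x0\<^sup>2 = sqrt p * exp (2 * u)" unfolding sp x0 power2_eq_square exp_add[symmetric] by simp
  \<comment> \<open>A <= N and u < L/4 suffice: N A <= x0^2 = exp(L/2 + 2 u) < p.\<close>
  have NAp: "N * A < p"
  proof -
    have "real A \<le> real N / D" by (rule A)
    also have "\<dots> \<le> real N / 1" using D1 by (intro divide_left_mono) auto
    finally have "M \<le> real N * real N" unfolding M_def by (intro mult_left_mono) auto
    also have "\<dots> \<le> x0 * x0" using N by (intro mult_mono) auto
    also have "\<dots> = exp (L / 2 + 2 * u)" using x0sq unfolding sp power2_eq_square exp_add by simp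
    also have "\<dots> < exp L" using c1 by simp
    finally have "real (N * A) < real p" unfolding pL M_def by simp
    then show ?thesis by (simp only: of_nat_less_iff)
  qed
  have Bp: "B < p"
  proof -
    have "8 * L\<^sup>2 \<le> 16 * L ^ 3" using L by (simp add: power2_eq_square power3_eq_cube)
    then have "8 * L\<^sup>2 \<le> exp (L / 4)" using c2 by linarith
    then have "8 * L\<^sup>2 * exp (u / 2) \<le> exp (L / 4) * exp (u / 2)" by (intro mult_right_mono) auto
    also have "\<dots> = exp (L / 4 + u / 2)" by (simp add: exp_add)
    also have "\<dots> < exp L" using c1 L0 by simp
    finally have "real B < real p" using Bup pL by linarith
    then show ?thesis by simp
  qed
  have Ap: "real A \<le> real p"
  proof -
    have "A \<le> N * A" using N by simp
    then have "A \<le> p" using NAp by linarith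
    then show ?thesis by simp
  qed
  have lnA: "0 \<le> ln (real A)" "1 + ln (real A) \<le> 2 * L"
  proof -
    show "0 \<le> ln (real A)" using A by simp
    have "ln (real A) \<le> ln (real p)" using A Ap by (intro ln_mono) auto
    then show "1 + ln (real A) \<le> 2 * L" using L by linarith
  qed
  define V where "V = burgess_avg p N A B"
  have diag: "real r ^ (2 * r) * real B ^ r * real p \<le> real B ^ (2 * r) * sqrt p"
  proof -
    have "real r ^ (2 * r) * sqrt p = b0 ^ r"
      unfolding b0_def power_mult_distrib Er by (simp add: power_mult)
    also have "\<dots> \<le> real B ^ r" using B b01 by (intro power_mono) auto
    finally have "(real r ^ (2 * r) * sqrt p) * (real B ^ r * sqrt p) \<le> real B ^ r * (real B ^ r * sqrt p)"
      by (intro mult_right_mono) auto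
    moreover have "(real r ^ (2 * r) * sqrt p) * (real B ^ r * sqrt p) = real r ^ (2 * r) * real B ^ r * (sqrt p * sqrt p)"
      by (simp only: mult_ac)
    moreover have "sqrt p * sqrt p = real p" by simp
    moreover have "real B ^ (2 * r) = real B ^ r * real B ^ r" by (simp add: mult_2 power_add)
    ultimately show ?thesis by (simp only: mult.assoc)
  qed
  have "V ^ (2 * r) \<le> M ^ (2 * r - 2) * (M * (1 + ln A)\<^sup>2)
      * (real r ^ (2 * r) * real B ^ r * p + 22 * real r * real B ^ (2 * r) * sqrt p)"
    unfolding V_def M_def by (rule burgess_core[OF p r(3) A(3) B(3) N(3) NAp Bp])
  also have "\<dots> \<le> M ^ (2 * r - 2) * (M * (1 + ln A)\<^sup>2) * (23 * real r * real B ^ (2 * r) * sqrt p)"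
  proof (rule mult_left_mono)
    have e: "c * real r * real B ^ (2 * r) * sqrt p = c * (real r * (real B ^ (2 * r) * sqrt p))" for c
      by (simp only: mult.assoc)
    have "real B ^ (2 * r) * sqrt p \<le> real r * (real B ^ (2 * r) * sqrt p)"
      using r(3) mult_right_mono[of 1 "real r" "real B ^ (2 * r) * sqrt p"] by simp
    then show "real r ^ (2 * r) * real B ^ r * p + 22 * real r * real B ^ (2 * r) * sqrt p \<le> 23 * real r * real B ^ (2 * r) * sqrt p"
      using diag unfolding e by linarith
    show "0 \<le> M ^ (2 * r - 2) * (M * (1 + ln A)\<^sup>2)" using M0 by (intro mult_nonneg_nonneg) auto
  qed
  also have "\<dots> = (M ^ (2 * r) * real B ^ (2 * r)) * ((1 + ln A)\<^sup>2 * (23 * real r * sqrt p) / M)"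
  proof -
    have "2 * r = Suc (Suc (2 * r - 2))" using r(3) by linarith
    moreover have "M ^ Suc (Suc (2 * r - 2)) = M ^ (2 * r - 2) * M * M" by simp
    ultimately have "M ^ (2 * r) = M ^ (2 * r - 2) * M * M" by metis
    then show ?thesis using M0 by (simp add: field_simps)
  qed
  also have "\<dots> \<le> (M ^ (2 * r) * real B ^ (2 * r)) * exp (-u)"
  proof (rule mult_left_mono)
    \<comment> \<open>M = N A is about N^2 / D, and N^2 is about x0^2 = sqrt p exp(2 u): the surplus
      exp(2 u) over sqrt p is the source of the saving.\<close>
    have Mlo: "sqrt p * exp (2 * u) \<le> 8 * D * M"
    proof -
      have "x0 * x0 \<le> (2 * real N) * (2 * real N)" using N x01 by (intro mult_mono) auto
      also have "\<dots> = 4 * D * (real N * (real N / D))" using D1 by simp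
      also have "\<dots> \<le> 4 * D * (real N * (2 * real A))" using A D1 by (intro mult_left_mono) auto
      finally show ?thesis using x0sq unfolding M_def power2_eq_square by simp
    qed
    then have "sqrt p * exp (2 * u) * exp (- (2 * u)) \<le> 8 * D * M * exp (- (2 * u))" by (intro mult_right_mono) auto
    then have spM: "sqrt p / M \<le> 8 * D * exp (- (2 * u))"
      using M0 by (simp add: exp_minus field_simps)
    have L6: "L ^ 6 = L\<^sup>2 * L\<^sup>2 * L\<^sup>2" by (simp flip: power_add)
    have "(1 + ln A)\<^sup>2 * (23 * real r * sqrt p) / M = (1 + ln A)\<^sup>2 * (23 * real r) * (sqrt p / M)" by simp
    also have "\<dots> \<le> (2 * L)\<^sup>2 * (23 * (2 * L)) * (8 * (8 * L\<^sup>2 * exp (u / 2) * L) * exp (- (2 * u)))"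
    proof (rule mult_mono[OF mult_mono])
      show "(1 + ln A)\<^sup>2 \<le> (2 * L)\<^sup>2" using lnA by (intro power_mono) auto
      show "23 * real r \<le> 23 * (2 * L)" using r lL by simp
      have "8 * D * exp (- (2 * u)) \<le> 8 * (8 * L\<^sup>2 * exp (u / 2) * L) * exp (- (2 * u))"
        using Dup by (intro mult_right_mono mult_left_mono) simp_all
      then show "sqrt p / M \<le> 8 * (8 * L\<^sup>2 * exp (u / 2) * L) * exp (- (2 * u))" using spM by linarith
    qed (use L0 M0 in auto)
    \<comment> \<open>The constant is 4 * 46 * 64, one number from each of the three
      factors.\<close>
    also have "\<dots> = (11776 * L ^ 6) * (exp (u / 2) * exp (- (2 * u)))"
      by (simp add: L6 power2_eq_square)
    also have "\<dots> \<le> exp (u / 2) * (exp (u / 2) * exp (- (2 * u)))" using c3 by (intro mult_right_mono) auto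
    also have "\<dots> = exp (-u)" by (simp add: exp_add[symmetric])
    finally show "(1 + ln A)\<^sup>2 * (23 * real r * sqrt p) / M \<le> exp (-u)" .
  qed (use M0 in auto)
  also have "\<dots> = (M * real B * exp (- u / (2 * real r))) ^ (2 * r)"
  proof -
    have "exp (- u / (2 * real r)) ^ (2 * r) = exp (-u)"
      unfolding exp_of_nat_mult[symmetric] using r0 by simp
    then show ?thesis by (simp add: power_mult_distrib)
  qed
  finally have fin: "V ^ (2 * r) \<le> (M * real B * exp (- u / (2 * real r))) ^ (2 * r)" .
  have "Suc (2 * r - 1) = 2 * r" using r(3) by linarith
  then have "V \<le> M * real B * exp (- u / (2 * real r))"
    using power_le_imp_le_base[of V "2 * r - 1" "M * real B * exp (- u / (2 * real r))"] fin M0 by simp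
  \<comment> \<open>From r <= 2 L^\<epsilon> the exponent u/(2r) is at least
    L^(1-2\<epsilon>)/4.\<close>
  also have "exp (- u / (2 * real r)) \<le> L powr (-\<epsilon>) / 2"
  proof -
    have "L powr (1 - 2 * \<epsilon>) / 4 = u / (4 * l)"
    proof -
      have "L powr (1 - 2 * \<epsilon>) = L powr (1 - \<epsilon>) / L powr \<epsilon>" by (simp add: powr_diff[symmetric])
      then show ?thesis by (simp add: u l_def)
    qed
    also have "\<dots> \<le> u / (2 * real r)" using u0 r r0 by (intro divide_left_mono) auto
    finally have "exp (- u / (2 * real r)) \<le> exp (- (L powr (1 - 2 * \<epsilon>) / 4))" by simp
    then show ?thesis using c4 by linarith
  qed
  finally have VB: "V \<le> M * real B * (L powr (-\<epsilon>) / 2)" using M0 by (simp add: mult_left_mono)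
  define S where "S = \<bar>\<Sum>n=1..N. real_of_int (Legendre (int n) (int p))\<bar>"
  have "real A * real B * S \<le> V + 2 * (real A * real B)\<^sup>2"
    unfolding S_def V_def by (rule burgess_shift)
  also have "\<dots> \<le> M * real B * (L powr (-\<epsilon>) / 2) + 2 * ((real A * real B) * (real N / L))"
  proof (rule add_mono[OF VB])
    have "(real A * real B) * (real A * real B) \<le> (real A * real B) * (real N / L)"
      by (rule mult_left_mono[OF AB]) simp
    then show "2 * (real A * real B)\<^sup>2 \<le> 2 * ((real A * real B) * (real N / L))"
      by (simp only: power2_eq_square)
  qed
  also have "\<dots> = (real A * real B) * (real N * (L powr (-\<epsilon>) / 2) + real N * (2 / L))"
    unfolding M_def by (simp add: algebra_simps)
  finally have "S \<le> real N * (L powr (-\<epsilon>) / 2) + real N * (2 / L)"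
    using A(3) B(3) by (simp add: mult_le_cancel_left)
  also have "real N * (2 / L) \<le> real N * (L powr (-\<epsilon>) / 2)" using c5 by (intro mult_left_mono) auto
  finally have "S \<le> real N * L powr (-\<epsilon>)" by simp
  also have "\<dots> \<le> x0 * L powr (-\<epsilon>)" using N by (intro mult_right_mono) auto
  finally show ?thesis unfolding S_def N_def by (simp add: mult.commute)
qed

section \<open>Mertens' estimates\<close>

lemma prod_primes_dvd:
  fixes n :: nat
  assumes "finite A" "\<And>q. q \<in> A \<Longrightarrow> prime q" "\<And>q. q \<in> A \<Longrightarrow> q dvd n"
  shows "\<Prod>A dvd n"
  using assms
proof (induction A rule: finite_induct)
  case (insert q A)
  have "coprime q (\<Prod>A)"
    by (rule prod_coprime_right) (metis insert.hyps(2) insert.prems(1) insertCI primes_coprime)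
  then show ?case using insert by (simp add: divides_mult)
qed simp

lemma binomial_middle_le: "(2 * m + 1) choose m \<le> 4 ^ m"
proof -
  have "((2 * m + 1) choose m) + ((2 * m + 1) choose (m + 1)) = (\<Sum>k\<in>{m, m + 1}. (2 * m + 1) choose k)" by simp
  also have "\<dots> \<le> (\<Sum>k\<le>2 * m + 1. (2 * m + 1) choose k)" by (rule sum_mono2) auto
  also have "\<dots> = 2 ^ (2 * m + 1)" by (rule choose_row_sum)
  also have "(2 * m + 1) choose (m + 1) = (2 * m + 1) choose m"
    by (subst binomial_symmetric) auto
  finally show ?thesis by (simp add: power_mult)
qed

text \<open>Erdos' induction: for n = 2m + 1 the primes in (m + 1, n] divide the binomial
  coefficient n over m, which is at most 4^m; an even n > 2 contributes no prime.\<close>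

lemma primorial_le: "\<Prod>{q. prime q \<and> q \<le> n} \<le> (4::nat) ^ n"
proof (induction n rule: less_induct)
  case (less n)
  have fin: "finite {q. prime q \<and> q \<le> n}" for n :: nat by (rule finite_subset[of _ "{..n}"]) auto
  consider "n = 0" | "n = 1" | "n = 2" | "even n" "n > 2" | "odd n" "n > 2" by linarith
  then show ?case
  proof cases
    case 1
    then have "{q::nat. prime q \<and> q \<le> n} = {}" by auto
    then show ?thesis by (simp only: prod.empty) simp
  next
    case 2
    then have "{q::nat. prime q \<and> q \<le> n} = {}" by (auto dest: prime_ge_2_nat)
    then show ?thesis by (simp only: prod.empty) simp
  next
    case 3
    then have "{q::nat. prime q \<and> q \<le> n} = {2}" by (auto dest: prime_ge_2_nat)
    then show ?thesis using 3 by simp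
  next
    case 4
    then have "\<not> prime n" using prime_odd_nat by blast
    then have "{q. prime q \<and> q \<le> n} = {q. prime q \<and> q \<le> n - 1}"
      using 4 by (metis One_nat_def Suc_pred le_Suc_eq less_imp_le_nat less_trans zero_less_numeral diff_le_self le_trans)
    then have "\<Prod>{q. prime q \<and> q \<le> n} \<le> 4 ^ (n - 1)" using less.IH[of "n - 1"] 4 by simp
    also have "\<dots> \<le> (4::nat) ^ n" by (rule power_increasing) auto
    finally show ?thesis .
  next
    case 5
    then obtain m where m: "n = 2 * m + 1" by (rule_tac oddE) auto
    with 5 have m1: "m \<ge> 1" by auto
    let ?B = "{q. prime q \<and> m + 1 < q \<and> q \<le> n}"
    have finB: "finite ?B" by (rule finite_subset[OF _ fin[of n]]) auto
    have "{q. prime q \<and> q \<le> n} = {q. prime q \<and> q \<le> m + 1} \<union> ?B" using m by auto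
    then have "\<Prod>{q. prime q \<and> q \<le> n} = \<Prod>{q. prime q \<and> q \<le> m + 1} * \<Prod>?B"
      using fin finB by (simp only:) (rule prod.union_disjoint, auto)
    also have "\<dots> \<le> 4 ^ (m + 1) * 4 ^ m"
    proof (rule mult_le_mono)
      show "\<Prod>{q. prime q \<and> q \<le> m + 1} \<le> 4 ^ (m + 1)" using less.IH[of "m + 1"] m m1 by simp
      have "\<Prod>?B dvd n choose m"
      proof (rule prod_primes_dvd[OF finB])
        fix q assume q: "q \<in> ?B"
        have "q dvd fact n" using q by (simp add: prime_dvd_fact_iff)
        also have "fact n = fact m * fact (m + 1) * (n choose m)"
          using binomial_fact_lemma[of m n] m by (simp add: mult_2)
        finally show "q dvd n choose m" using q by (auto simp: prime_dvd_mult_iff prime_dvd_fact_iff simp del: fact_Suc)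
      qed auto
      then have "\<Prod>?B \<le> n choose m" using m by (intro dvd_imp_le) auto
      then show "\<Prod>?B \<le> 4 ^ m" using binomial_middle_le[of m] m by (metis order_trans)
    qed
    also have "\<dots> = 4 ^ n" by (simp add: m power_add[symmetric] mult_2)
    finally show ?thesis .
  qed
qed

lemma finite_primes_le: "finite {q. prime q \<and> q \<le> (n::nat)}"
  by (rule finite_subset[of _ "{..n}"]) auto

lemma chebyshev_theta_le: "(\<Sum>q | prime q \<and> q \<le> n. ln (real q)) \<le> real n * ln 4"
proof -
  have "(\<Sum>q | prime q \<and> q \<le> n. ln (real q)) = ln (\<Prod>q | prime q \<and> q \<le> n. real q)"
    by (rule ln_prod[symmetric]) (auto simp: finite_primes_le dest: prime_gt_0_nat)
  also have "(\<Prod>q | prime q \<and> q \<le> n. real q) = real (\<Prod>{q. prime q \<and> q \<le> n})" by simp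
  also have "ln \<dots> \<le> ln (real (4 ^ n))"
  proof (subst ln_le_cancel_iff)
    show "0 < real (\<Prod>{q. prime q \<and> q \<le> n})"
      by (auto simp: finite_primes_le intro!: prod_pos dest: prime_gt_0_nat)
    show "real (\<Prod>{q. prime q \<and> q \<le> n}) \<le> real (4 ^ n)" using primorial_le[of n] by (simp only: of_nat_le_iff)
  qed simp
  also have "\<dots> = real n * ln 4" by (simp add: ln_realpow)
  finally show ?thesis .
qed

section \<open>Mertens' first theorem\<close>

lemma sum_ln_eq_sum_mangoldt:
  "(\<Sum>n=1..N. ln (real n)) = (\<Sum>d=1..N. mangoldt d * real (N div d))"
proof -
  have "(\<Sum>n=1..N. ln (real n)) = (\<Sum>n=1..N. \<Sum>d | d dvd n. mangoldt d :: real)"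
    by (rule sum.cong) (simp_all add: mangoldt_sum)
  also have "\<dots> = (\<Sum>n=1..N. \<Sum>d\<in>{d\<in>{1..N}. d dvd n}. mangoldt d)"
    by (intro sum.cong refl) (auto dest: dvd_imp_le intro: Nat.gr0I)
  also have "\<dots> = (\<Sum>d=1..N. \<Sum>n\<in>{n\<in>{1..N}. d dvd n}. mangoldt d)"
    by (rule sum.swap_restrict) auto
  also have "\<dots> = (\<Sum>d=1..N. mangoldt d * real (N div d))"
  proof (rule sum.cong[OF refl])
    fix d assume d: "d \<in> {1..N}"
    have "{n\<in>{1..N}. d dvd n} = (\<lambda>k. d * k) ` {1..N div d}"
      using d by (auto simp: less_eq_div_iff_mult_less_eq mult.commute elim!: dvdE)
    moreover have "inj_on (\<lambda>k. d * k) {1..N div d}" using d by (auto simp: inj_on_def)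
    ultimately have "card {n\<in>{1..N}. d dvd n} = N div d" by (simp add: card_image)
    then show "(\<Sum>n\<in>{n\<in>{1..N}. d dvd n}. mangoldt d) = (mangoldt d :: real) * real (N div d)" by simp
  qed
  finally show ?thesis .
qed

lemma sum_ln_lower: "N \<ge> 1 \<Longrightarrow> (\<Sum>n=1..N. ln (real n)) \<ge> real N * ln N - N"
proof (induction N rule: dec_induct)
  case (step n)
  have n: "real n > 0" using step by simp
  have "ln (real (Suc n)) - ln n = ln (1 + 1 / n)"
    using n ln_div[of "real (Suc n)" "real n"] by (simp add: add_divide_distrib add.commute)
  also have "\<dots> \<le> 1 / n" using n by (intro ln_add_one_self_le_self) auto
  finally have "n * (ln (real (Suc n)) - ln n) \<le> n * (1 / n)" using n by (intro mult_left_mono) auto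
  then have "n * (ln (real (Suc n)) - ln n) \<le> 1" using n by simp
  then show ?case using step by (simp add: algebra_simps)
qed simp

lemma sum_ln_upper: "(\<Sum>n=1..N. ln (real n)) \<le> real N * ln N"
proof -
  have "(\<Sum>n=1..N. ln (real n)) \<le> (\<Sum>n=1..N. ln (real N))" by (rule sum_mono) auto
  then show ?thesis by simp
qed

text \<open>Each term is dominated by a difference of consecutive values of 2 / sqrt n, so the sum
  telescopes.\<close>

lemma sum_three_halves_le: "(\<Sum>n=2..N. 1 / (real n * sqrt n)) \<le> 2"
proof -
  have "(\<Sum>n=2..N. 1 / (real n * sqrt n)) \<le> 2 - 2 / sqrt N" if "N \<ge> 1"
    using that
  proof (induction N rule: dec_induct)
    case (step n)
    let ?a = "sqrt n" and ?b = "sqrt (Suc n)"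
    have a: "?a > 0" "?b > 0" "?a < ?b" using step by auto
    have "?b * ?b - ?a * ?a = 1" by simp
    then have "(?b - ?a) * (?b + ?a) = 1" by (simp add: algebra_simps)
    then have ba: "?b - ?a = 1 / (?b + ?a)" using a by (intro nonzero_eq_divide_eq[THEN iffD2]) auto
    have "2 / ?a - 2 / ?b = 2 * (?b - ?a) / (?a * ?b)" using a by (simp add: field_simps)
    also have "\<dots> = 2 / (?a * ?b * (?a + ?b))" unfolding ba by (simp add: mult_ac add.commute)
    also have "\<dots> \<ge> 2 / (?b * ?b * (?b + ?b))"
      using a by (intro divide_left_mono mult_mono add_mono mult_pos_pos add_pos_pos) auto
    finally have "1 / (real (Suc n) * ?b) \<le> 2 / ?a - 2 / ?b" by simp
    then show ?case using step by simp
  qed simp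
  then show ?thesis by (cases "N \<ge> 1") (force intro: order_trans, simp)
qed

lemma sum_power_le_two_squares:
  fixes x :: real
  assumes "0 \<le> x" "x \<le> 1 / 2"
  shows "(\<Sum>k=2..N. x ^ k) \<le> 2 * x\<^sup>2"
proof -
  have "(\<Sum>k=2..N. x ^ k) \<le> 2 * x\<^sup>2 - x ^ N" if "N \<ge> 2"
    using that
  proof (induction N rule: dec_induct)
    case (step n)
    have "2 * x ^ Suc n \<le> x ^ n" using mult_right_mono[OF assms(2), of "x ^ n"] assms(1) by simp
    then show ?case using step by simp
  qed simp
  then show ?thesis using assms by (cases "N \<ge> 2") (force intro: order_trans, simp)
qed

text \<open>For a prime q the powers q^k with k >= 2 contribute at most 2 ln q / q^2 <= 4 / q^(3/2),
  and the sum of n^(-3/2) over n >= 2 is at most 2.\<close>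

lemma sum_mangoldt_nonprime_le:
  "(\<Sum>d | d \<in> {1..N} \<and> \<not> prime d. mangoldt d / real d) \<le> 8"
proof -
  define P where "P = {q\<in>{2..N}. prime q}"
  define g where "g = (\<lambda>d. mangoldt d / real d :: real)"
  have g0: "g d \<ge> 0" for d unfolding g_def by (simp add: mangoldt_nonneg)
  let ?f = "\<lambda>(q::nat, k::nat). q ^ k"
  have "(\<Sum>d | d \<in> {1..N} \<and> \<not> prime d. g d) = (\<Sum>d | d \<in> {1..N} \<and> \<not> prime d \<and> primepow d. g d)"
    by (rule sum.mono_neutral_right) (auto simp: g_def mangoldt_def)
  also have "\<dots> \<le> (\<Sum>d\<in>?f ` (P \<times> {2..N}). g d)"
  proof (rule sum_mono2)
    show "{d. d \<in> {1..N} \<and> \<not> prime d \<and> primepow d} \<subseteq> ?f ` (P \<times> {2..N})"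
    proof clarify
      fix d assume d: "d \<in> {1..N}" "\<not> prime d" "primepow d"
      then obtain q k where qk: "prime q" "k > 0" "d = q ^ k" unfolding primepow_def by auto
      have q2: "q \<ge> 2" using qk prime_ge_2_nat by blast
      have "k \<noteq> 1" using d qk by auto
      then have k2: "k \<ge> 2" using qk by simp
      have "q \<le> q ^ k" using q2 qk by (intro self_le_power) auto
      then have "q \<le> N" using d qk by simp
      moreover have "k < q ^ k" using q2 by (intro power_gt_expt) auto
      ultimately have "(q, k) \<in> P \<times> {2..N}" using d qk q2 k2 by (auto simp: P_def)
      then show "d \<in> ?f ` (P \<times> {2..N})" using qk by force
    qed
  qed (use g0 in \<open>auto simp: P_def\<close>)
  also have "\<dots> \<le> (\<Sum>x\<in>P \<times> {2..N}. g (?f x))"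
    using sum_image_le[of "P \<times> {2..N}" g ?f] g0 by (auto simp: P_def o_def)
  also have "\<dots> = (\<Sum>q\<in>P. \<Sum>k=2..N. g (q ^ k))"
    by (subst sum.cartesian_product) (simp add: case_prod_unfold)
  also have "\<dots> \<le> (\<Sum>q\<in>P. 4 * (1 / (real q * sqrt q)))"
  proof (rule sum_mono)
    fix q assume q: "q \<in> P"
    then have q2: "real q \<ge> 2" and pr: "prime q" by (auto simp: P_def)
    have "(\<Sum>k=2..N. g (q ^ k)) = ln q * (\<Sum>k=2..N. (1 / real q) ^ k)"
      unfolding sum_distrib_left g_def using pr by (intro sum.cong) (auto simp: power_divide)
    also have "\<dots> \<le> ln q * (2 * (1 / real q)\<^sup>2)"
      using q2 by (intro mult_left_mono sum_power_le_two_squares) auto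
    also have "ln q \<le> 2 * sqrt q"
      using ln_sqrt[of "real q"] ln_le_minus_one[of "sqrt q"] q2 by (simp add: field_simps)
    then have "ln q * (2 * (1 / real q)\<^sup>2) \<le> 2 * sqrt q * (2 * (1 / real q)\<^sup>2)"
      by (intro mult_right_mono) auto
    also have "2 * sqrt q * (2 * (1 / real q)\<^sup>2) = 4 * (sqrt q * (1 / real q) * (1 / real q))"
      by (simp add: power2_eq_square)
    also have "sqrt q * (1 / real q) = 1 / sqrt q" using q2 by (simp add: field_simps)
    finally show "(\<Sum>k=2..N. g (q ^ k)) \<le> 4 * (1 / (real q * sqrt q))" by (simp add: mult.commute)
  qed
  also have "\<dots> \<le> (\<Sum>q=2..N. 4 * (1 / (real q * sqrt q)))"
    by (rule sum_mono2) (auto simp: P_def)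
  also have "\<dots> = 4 * (\<Sum>q=2..N. 1 / (real q * sqrt q))" by (simp add: sum_distrib_left)
  also have "\<dots> \<le> 8" using sum_three_halves_le[of N] by simp
  finally show ?thesis unfolding g_def .
qed

definition prime_log_sum :: "nat \<Rightarrow> real" where
  "prime_log_sum n = (\<Sum>q | prime q \<and> q \<le> n. ln (real q) / real q)"

text \<open>Both directions compare with ln N!, the sum of
  \<open>mangoldt d * real (N div d)\<close>. From above, the fractional parts of N/q cost the
  Chebyshev sum, at most N ln 4; from below, Stirling costs 1 and the proper prime powers cost
  8.\<close>

lemma prime_log_sum_bounds:
  assumes "N \<ge> 1"
  shows "\<bar>prime_log_sum N - ln N\<bar> \<le> 9"
proof -
  have N0: "real N > 0" using assms by simp
  let ?P = "{q. prime q \<and> q \<le> N}"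
  have P: "?P = {d. d \<in> {1..N} \<and> prime d}" by (auto dest: prime_ge_1_nat)
  have up: "N * prime_log_sum N \<le> N * (ln N + ln 4)"
  proof -
    have "N * prime_log_sum N - N * ln 4 \<le> (\<Sum>q\<in>?P. N * (ln q / q)) - (\<Sum>q\<in>?P. ln (real q))"
      using chebyshev_theta_le[of N] unfolding prime_log_sum_def sum_distrib_left by simp
    also have "\<dots> = (\<Sum>q\<in>?P. ln q * (N / q - 1))"
      by (simp add: sum_subtractf[symmetric] algebra_simps)
    also have "\<dots> \<le> (\<Sum>q\<in>?P. ln q * real (N div q))"
    proof (intro sum_mono mult_left_mono)
      fix q assume "q \<in> ?P"
      then have "real q \<ge> 1" by (auto dest: prime_ge_1_nat)
      then show "0 \<le> ln (real q)" by simp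
      show "real N / real q - 1 \<le> real (N div q)"
        by (metis diff_le_eq floor_divide_of_nat_eq of_int_of_nat_eq real_of_int_floor_add_one_ge)
    qed
    also have "\<dots> = (\<Sum>q\<in>?P. mangoldt q * real (N div q))" by (rule sum.cong) auto
    also have "\<dots> \<le> (\<Sum>d=1..N. mangoldt d * real (N div d))"
      unfolding P by (rule sum_mono2) (auto simp: mangoldt_nonneg)
    also have "\<dots> \<le> N * ln N" using sum_ln_upper[of N] sum_ln_eq_sum_mangoldt[of N] by simp
    finally show ?thesis by (simp add: algebra_simps)
  qed
  have lo: "N * (ln N - 1) \<le> N * (prime_log_sum N + 8)"
  proof -
    have "N * (ln N - 1) \<le> (\<Sum>d=1..N. mangoldt d * real (N div d))"
      using sum_ln_lower[OF assms] sum_ln_eq_sum_mangoldt[of N] by (simp add: algebra_simps)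
    also have "\<dots> \<le> (\<Sum>d=1..N. N * (mangoldt d / d))"
    proof (rule sum_mono)
      fix d
      have "mangoldt d * real (N div d) \<le> mangoldt d * (N / d)"

        by (intro mult_left_mono mangoldt_nonneg) (metis floor_divide_of_nat_eq of_int_floor_le of_int_of_nat_eq)
      then show "mangoldt d * real (N div d) \<le> N * (mangoldt d / d)" by (simp add: mult_ac)
    qed
    also have "\<dots> = N * (\<Sum>d\<in>{1..N}. mangoldt d / d)" by (simp add: sum_distrib_left)
    also have "{1..N} = {d. d \<in> {1..N} \<and> prime d} \<union> {d. d \<in> {1..N} \<and> \<not> prime d}" by auto
    also have "(\<Sum>d\<in>\<dots>. mangoldt d / real d) = (\<Sum>d\<in>{d. d \<in> {1..N} \<and> prime d}. mangoldt d / real d)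
        + (\<Sum>d\<in>{d. d \<in> {1..N} \<and> \<not> prime d}. mangoldt d / real d)"
      by (rule sum.union_disjoint) auto
    also have "(\<Sum>d\<in>{d. d \<in> {1..N} \<and> prime d}. mangoldt d / real d) = prime_log_sum N"
      unfolding prime_log_sum_def P by (rule sum.cong) auto
    also have "N * (prime_log_sum N + (\<Sum>d\<in>{d. d \<in> {1..N} \<and> \<not> prime d}. mangoldt d / real d))
        \<le> N * (prime_log_sum N + 8)"
      using sum_mangoldt_nonprime_le[of N] by (intro mult_left_mono) auto
    finally show ?thesis .
  qed
  have "ln (4::real) \<le> 3" using ln_le_minus_one[of 4] by simp
  then show ?thesis using up lo N0 by (simp add: abs_le_iff mult_le_cancel_left_pos)
qed

section \<open>Reciprocals of primes: Mertens' second theorem\<close>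

lemma sum_prime_recip_nat_le:
  fixes M N :: nat
  assumes "2 \<le> M" "M \<le> N"
  shows "(\<Sum>q | prime q \<and> M < q \<and> q \<le> N. 1 / real q) \<le> ln (ln N) - ln (ln M) + 18 / ln M"
proof -
  \<comment> \<open>The error in Mertens' first theorem, bounded by 9. It enters the partial
    summation with total weight at most 2 / ln M, which gives 18 / ln M.\<close>
  define E where "E = (\<lambda>n. prime_log_sum n - ln (real n))"
  have E: "\<bar>E n\<bar> \<le> 9" if "n \<ge> 2" for n unfolding E_def using prime_log_sum_bounds[of n] that by simp
  have fin: "finite {q. prime q \<and> q \<le> n}" for n :: nat by (rule finite_primes_le)
  have fin2: "finite {q. prime q \<and> M < q \<and> q \<le> n}" for n :: nat by (rule finite_subset[OF _ fin[of n]]) auto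
  have lM: "ln (real M) > 0" using assms by simp
  \<comment> \<open>Summation by parts, written as an invariant so that it can be checked step by step.\<close>
  have "(\<Sum>q | prime q \<and> M < q \<and> q \<le> N. 1 / real q)
     \<le> ln (ln N) - ln (ln M) + E N / ln N + 9 * (2 / ln M - 1 / ln N)"
    using assms(2)
  proof (induction N rule: dec_induct)
    case base
    have "(\<Sum>q | prime q \<and> M < q \<and> q \<le> M. 1 / real q) = 0" by (rule sum.neutral) auto
    moreover have "0 \<le> (E M + 9) / ln M" using E[of M] assms lM by (intro divide_nonneg_pos) auto
    ultimately show ?case using lM by (simp only:) (simp add: field_simps)
  next
    case (step n)
    have n2: "n \<ge> 2" using step assms by simp
    let ?a = "ln (real n)" and ?b = "ln (real (Suc n))"
    have ab: "0 < ?a" "?a < ?b" using n2 by auto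
    define t where "t = (if prime (Suc n) then 1 / real (Suc n) else 0)"
    have s1: "(\<Sum>q | prime q \<and> M < q \<and> q \<le> Suc n. 1 / real q) = (\<Sum>q | prime q \<and> M < q \<and> q \<le> n. 1 / real q) + t"
    proof (cases "prime (Suc n)")
      case True
      have "{q. prime q \<and> M < q \<and> q \<le> Suc n} = insert (Suc n) {q. prime q \<and> M < q \<and> q \<le> n}"
        using True step by (auto simp: le_Suc_eq)
      then show ?thesis using fin2[of n] True by (simp add: t_def)
    next
      case False
      have "{q. prime q \<and> M < q \<and> q \<le> Suc n} = {q. prime q \<and> M < q \<and> q \<le> n}"
        using False by (auto simp: le_Suc_eq)
      then show ?thesis using False by (simp add: t_def)
    qed
    have s2: "prime_log_sum (Suc n) = prime_log_sum n + t * ?b"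
    proof (cases "prime (Suc n)")
      case True
      have "{q. prime q \<and> q \<le> Suc n} = insert (Suc n) {q. prime q \<and> q \<le> n}"
        using True by (auto simp: le_Suc_eq)
      then show ?thesis using fin[of n] True by (simp add: t_def prime_log_sum_def)
    next
      case False
      have "{q. prime q \<and> q \<le> Suc n} = {q. prime q \<and> q \<le> n}"
        using False by (auto simp: le_Suc_eq)
      then show ?thesis using False by (simp add: t_def prime_log_sum_def)
    qed
    have "t * ?b = E (Suc n) - E n + (?b - ?a)" using s2 unfolding E_def by simp
    then have "t * ?b / ?b = (E (Suc n) - E n) / ?b + (?b / ?b - ?a / ?b)"
      by (simp only: add_divide_distrib diff_divide_distrib)
    then have t: "t = (E (Suc n) - E n) / ?b + (1 - ?a / ?b)" using ab n2 by simp
    have "0 < ?a / ?b" using ab n2 by (intro divide_pos_pos) auto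
    then have "1 - ?a / ?b \<le> ln ?b - ln ?a"
      using ln_le_minus_one[of "?a / ?b"] ab n2 by (simp add: ln_div)
    moreover have "E n * (1 / ?a - 1 / ?b) \<le> 9 * (1 / ?a - 1 / ?b)"
    proof (rule mult_right_mono)
      show "E n \<le> 9" using E[OF n2] by simp
      show "0 \<le> 1 / ?a - 1 / ?b" using ab frac_le[of 1 1 ?a ?b] by simp
    qed
    ultimately have "t \<le> ln ?b - ln ?a + E (Suc n) / ?b - E n / ?a + 9 * (1 / ?a - 1 / ?b)"
      unfolding t by (simp add: algebra_simps diff_divide_distrib)
    then show ?case unfolding s1 using step.IH by simp
  qed
  moreover have "E N / ln N \<le> 9 / ln N" using E[of N] assms by (intro divide_right_mono) auto
  ultimately show ?thesis by (simp add: algebra_simps)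
qed

definition primes_between :: "real \<Rightarrow> real \<Rightarrow> nat set" where
  "primes_between x y = {q. prime q \<and> x < real q \<and> real q \<le> y}"

lemma finite_primes_between [simp, intro]: "finite (primes_between x y)"
proof -
  have "primes_between x y \<subseteq> {..nat \<lfloor>y\<rfloor>}" by (auto simp: primes_between_def le_nat_floor)
  then show ?thesis using finite_subset by blast
qed

lemma prime_log_sum_real_bounds:
  assumes "x \<ge> 1"
  shows "\<bar>(\<Sum>q\<in>primes_between 0 x. ln (real q) / real q) - ln x\<bar> \<le> 10"
proof -
  define n where "n = nat \<lfloor>x\<rfloor>"
  have n: "real n \<le> x" "x < n + 1" "n \<ge> 1" using assms unfolding n_def by linarith+
  have "primes_between 0 x = {q. prime q \<and> q \<le> n}"
    unfolding primes_between_def n_def using assms by (auto simp: le_nat_iff le_floor_iff prime_gt_0_nat)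
  then have "(\<Sum>q\<in>primes_between 0 x. ln (real q) / real q) = prime_log_sum n" by (simp add: prime_log_sum_def)
  moreover have "\<bar>prime_log_sum n - ln n\<bar> \<le> 9" by (rule prime_log_sum_bounds[OF n(3)])
  moreover have "ln n \<le> ln x" using n by simp
  moreover have "ln x \<le> ln n + 1"
  proof -
    have "real n \<ge> 1" using n by simp
    then have "x \<le> 2 * real n" using n by linarith
    then have "ln x \<le> ln (2 * real n)" using assms by (intro ln_mono) auto
    also have "\<dots> = ln 2 + ln n" using n by (simp add: ln_mult)
    finally show ?thesis using ln_le_minus_one[of 2] by simp
  qed
  ultimately show ?thesis by linarith
qed

lemma prime_log_sum_between:
  assumes "1 \<le> x" "x \<le> y"
  shows "\<bar>(\<Sum>q\<in>primes_between x y. ln (real q) / real q) - (ln y - ln x)\<bar> \<le> 20"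
proof -
  have "primes_between 0 y = primes_between 0 x \<union> primes_between x y"
    using assms by (auto simp: primes_between_def)
  then have "(\<Sum>q\<in>primes_between 0 y. ln (real q) / real q)
      = (\<Sum>q\<in>primes_between 0 x. ln (real q) / real q) + (\<Sum>q\<in>primes_between x y. ln (real q) / real q)"
    by (simp only:) (rule sum.union_disjoint, simp, simp, auto simp: primes_between_def)
  then show ?thesis using prime_log_sum_real_bounds[of x] prime_log_sum_real_bounds[of y] assms by linarith
qed

text \<open>A crude consequence of the logarithmically weighted sum, by ln q <= ln y. It loses a
  constant factor, harmless wherever only a positive proportion is sought.\<close>

lemma sum_prime_recip_ge:
  assumes "1 \<le> x" "x \<le> y" "1 < y"
  shows "(\<Sum>q\<in>primes_between x y. 1 / real q) \<ge> (ln y - ln x - 20) / ln y"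
proof -
  have "ln y - ln x - 20 \<le> (\<Sum>q\<in>primes_between x y. ln (real q) / real q)"
    using prime_log_sum_between[OF assms(1,2)] by linarith
  also have "\<dots> \<le> (\<Sum>q\<in>primes_between x y. ln y * (1 / real q))"
  proof (rule sum_mono)
    fix q assume "q \<in> primes_between x y"
    then have "0 < real q" "real q \<le> y" using assms by (auto simp: primes_between_def)
    then show "ln (real q) / real q \<le> ln y * (1 / real q)" by (simp add: divide_right_mono)
  qed
  also have "\<dots> = (\<Sum>q\<in>primes_between x y. 1 / real q) * ln y" by (simp add: sum_distrib_left mult.commute)
  finally show ?thesis using assms by (simp add: divide_le_eq)
qed

lemma sum_prime_recip_le:
  assumes "1 < x" "x \<le> y"
  shows "(\<Sum>q\<in>primes_between x y. 1 / real q) \<le> (ln y - ln x + 20) / ln x"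
proof -
  have "(\<Sum>q\<in>primes_between x y. 1 / real q) * ln x = (\<Sum>q\<in>primes_between x y. ln x * (1 / real q))"
    by (simp add: sum_distrib_left mult.commute)
  also have "\<dots> \<le> (\<Sum>q\<in>primes_between x y. ln (real q) / real q)"
  proof (rule sum_mono)
    fix q assume "q \<in> primes_between x y"
    then have "x < real q" using assms by (auto simp: primes_between_def)
    then show "ln x * (1 / real q) \<le> ln (real q) / real q" using assms by (simp add: divide_right_mono)
  qed
  also have "\<dots> \<le> ln y - ln x + 20" using prime_log_sum_between[of x y] assms by linarith
  finally show ?thesis using assms by (simp add: le_divide_eq)
qed

text \<open>The sharp main term matters where masses near 1/2 are compared. In 38 = 2 * (18 + 1),
  the 1 pays for replacing ln (ln M) by ln (ln x) and the 2 comes from ln x <= 2 ln M, with M the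
  integer part of x.\<close>

lemma mertens_recip_le:
  assumes "2 \<le> x" "x \<le> y"
  shows "(\<Sum>q\<in>primes_between x y. 1 / real q) \<le> ln (ln y / ln x) + 38 / ln x"
proof -
  define M N where "M = nat \<lfloor>x\<rfloor>" and "N = nat \<lfloor>y\<rfloor>"
  have M: "real M \<le> x" "x < M + 1" "M \<ge> 2" using assms unfolding M_def by linarith+
  have N: "real N \<le> y" "M \<le> N" using assms unfolding N_def M_def by (auto intro: nat_mono floor_mono)
  have lM: "ln (real M) > 0" and lx: "ln x > 0" and lN: "ln (real N) > 0" using M N assms by auto
  have "primes_between x y \<subseteq> {q. prime q \<and> M < q \<and> q \<le> N}"
    using M N assms unfolding primes_between_def N_def by (auto simp: le_nat_iff le_floor_iff)
  moreover have "finite {q. prime q \<and> M < q \<and> q \<le> N}" by (rule finite_subset[of _ "{..N}"]) auto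
  ultimately have "(\<Sum>q\<in>primes_between x y. 1 / real q) \<le> (\<Sum>q | prime q \<and> M < q \<and> q \<le> N. 1 / real q)"
    by (intro sum_mono2) auto
  also have "\<dots> \<le> ln (ln N) - ln (ln M) + 18 / ln M" by (rule sum_prime_recip_nat_le) (use M N in auto)
  also have "ln (ln N) \<le> ln (ln y)"
    using lN N M assms by (subst ln_le_cancel_iff) (auto intro!: ln_mono)
  also have "ln (ln y) - ln (ln M) + 18 / ln M \<le> ln (ln y) - ln (ln x) + 19 / ln M"
  proof -
    have "ln x - ln M = ln (x / M)" using M assms by (simp add: ln_div)
    also have "\<dots> \<le> x / M - 1" using M assms by (intro ln_le_minus_one) auto
    also have "\<dots> \<le> 1" using M by (simp add: field_simps)
    finally have *: "ln x - ln M \<le> 1" .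
    have "ln (ln x) - ln (ln M) = ln (ln x / ln M)" using lx lM by (simp add: ln_div)
    also have "\<dots> \<le> ln x / ln M - 1" using lx lM by (intro ln_le_minus_one) auto
    also have "\<dots> = (ln x - ln M) / ln M" using lM by (simp add: field_simps)
    also have "\<dots> \<le> 1 / ln M" using * lM by (intro divide_right_mono) auto
    finally show ?thesis by simp
  qed
  also have "19 / ln M \<le> 38 / ln x"
  proof -
    have "x \<le> real M * real M"
    proof -
      have "real M + 1 \<le> real M * 2" using M by simp
      also have "\<dots> \<le> real M * real M" using M by (intro mult_left_mono) auto
      finally show ?thesis using M by linarith
    qed
    then have "ln x \<le> ln (real M * real M)" using assms M by (subst ln_le_cancel_iff) auto
    then have "ln x \<le> 2 * ln M" using M by (simp add: ln_mult)
    then show ?thesis using lM lx by (simp add: field_simps)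
  qed
  finally show ?thesis using lx assms by (simp add: ln_div)
qed

section \<open>Signs of multiplicative functions\<close>

definition pos_le :: "real \<Rightarrow> nat set" where
  "pos_le x = {n. 1 \<le> n \<and> real n \<le> x}"

lemma pos_le_eq: "pos_le x = {1..nat \<lfloor>x\<rfloor>}"
proof -
  have "1 \<le> n \<Longrightarrow> real n \<le> x \<longleftrightarrow> n \<le> nat \<lfloor>x\<rfloor>" for n
  proof -
    assume "1 \<le> n"
    moreover have "real n \<le> x \<longleftrightarrow> int n \<le> \<lfloor>x\<rfloor>" by (simp add: le_floor_iff)
    ultimately show "real n \<le> x \<longleftrightarrow> n \<le> nat \<lfloor>x\<rfloor>" by linarith
  qed
  then show ?thesis unfolding pos_le_def by auto
qed

lemma finite_pos_le [simp, intro]: "finite (pos_le x)"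
  by (simp add: pos_le_eq)

lemma card_pos_le: "0 \<le> x \<Longrightarrow> real (card (pos_le x)) \<le> x" "x - 1 \<le> real (card (pos_le x))"
  unfolding pos_le_eq by (simp_all add: of_nat_floor) linarith

lemma card_multiples_pos_le:
  assumes "d \<ge> 1"
  shows "card {n \<in> pos_le x. d dvd n} = card (pos_le (x / d))"
proof -
  have "{n \<in> pos_le x. d dvd n} = (\<lambda>k. d * k) ` pos_le (x / d)"
    using assms by (auto simp: pos_le_def field_simps elim!: dvdE)
  moreover have "inj_on (\<lambda>k. d * k) (pos_le (x / d))" using assms by (auto simp: inj_on_def)
  ultimately show ?thesis by (simp add: card_image)
qed

lemma card_multiples_le:
  assumes "d \<ge> 1" "0 \<le> x"
  shows "real (card {n \<in> pos_le x. d dvd n}) \<le> x / d"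
  unfolding card_multiples_pos_le[OF assms(1)] by (rule card_pos_le) (use assms in auto)

lemma sum_card_swap:
  assumes "finite A" "finite B"
  shows "(\<Sum>a\<in>A. card {b\<in>B. R a b}) = (\<Sum>b\<in>B. card {a\<in>A. R a b})"
proof -
  have "(\<Sum>a\<in>A. card {b\<in>B. R a b}) = (\<Sum>a\<in>A. \<Sum>b\<in>{b\<in>B. R a b}. 1)" by simp
  also have "\<dots> = (\<Sum>b\<in>B. \<Sum>a\<in>{a\<in>A. R a b}. 1)" by (rule sum.swap_restrict[OF assms])
  finally show ?thesis by simp
qed

definition recip_sum :: "nat set \<Rightarrow> real" where
  "recip_sum P = (\<Sum>q\<in>P. 1 / real q)"

lemma recip_sum_nonneg: "recip_sum P \<ge> 0" unfolding recip_sum_def by (rule sum_nonneg) auto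

definition omega_in :: "nat set \<Rightarrow> nat \<Rightarrow> nat" where
  "omega_in P n = card {q\<in>P. q dvd n}"

text \<open>The square counts pairs of primes: distinct q, r both divide at most x/(q r) integers up
  to x, equal ones at most x/q. No remainder terms arise because only an upper bound is
  claimed.\<close>

lemma omega_second_moment:
  assumes P: "finite P" "\<And>q. q \<in> P \<Longrightarrow> prime q" and x: "0 \<le> x"
  shows "(\<Sum>n\<in>pos_le x. (real (omega_in P n))\<^sup>2) \<le> x * ((recip_sum P)\<^sup>2 + recip_sum P)"
proof -
  have "(\<Sum>n\<in>pos_le x. (omega_in P n)\<^sup>2) = (\<Sum>n\<in>pos_le x. card {z\<in>P \<times> P. fst z dvd n \<and> snd z dvd n})"
  proof (rule sum.cong[OF refl])
    fix n
    have "{z\<in>P \<times> P. fst z dvd n \<and> snd z dvd n} = {q\<in>P. q dvd n} \<times> {q\<in>P. q dvd n}" by auto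
    then show "(omega_in P n)\<^sup>2 = card {z\<in>P \<times> P. fst z dvd n \<and> snd z dvd n}"
      unfolding omega_in_def by (simp add: card_cartesian_product power2_eq_square)
  qed
  also have "\<dots> = (\<Sum>z\<in>P \<times> P. card {n\<in>pos_le x. fst z dvd n \<and> snd z dvd n})"
    by (rule sum_card_swap) (use P in auto)
  finally have "(\<Sum>n\<in>pos_le x. (real (omega_in P n))\<^sup>2) = (\<Sum>z\<in>P \<times> P. real (card {n\<in>pos_le x. fst z dvd n \<and> snd z dvd n}))"
    by (metis (mono_tags, lifting) of_nat_power of_nat_sum sum.cong)
  also have "\<dots> \<le> (\<Sum>z\<in>P \<times> P. x * (1 / real (fst z)) * (1 / real (snd z)) + (if fst z = snd z then x * (1 / real (fst z)) else 0))"
  proof (rule sum_mono)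
    fix z assume z: "z \<in> P \<times> P"
    obtain q r where qr: "z = (q, r)" by fastforce
    have pr: "prime q" "prime r" using z qr P by auto
    have pos: "q \<ge> 1" "r \<ge> 1" using pr prime_ge_1_nat by auto
    show "real (card {n\<in>pos_le x. fst z dvd n \<and> snd z dvd n})
        \<le> x * (1 / real (fst z)) * (1 / real (snd z)) + (if fst z = snd z then x * (1 / real (fst z)) else 0)"
    proof (cases "q = r")
      case True
      have "real (card {n\<in>pos_le x. q dvd n}) \<le> x / q" by (rule card_multiples_le) (use pos x in auto)
      moreover have "0 \<le> x * (1 / real q) * (1 / real q)" using x by simp
      ultimately show ?thesis using True qr by simp
    next
      case False
      have "coprime q r" using pr False by (simp add: primes_coprime)
      then have "{n\<in>pos_le x. q dvd n \<and> r dvd n} = {n\<in>pos_le x. q * r dvd n}"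
        by (auto intro: divides_mult dest: dvd_mult_left dvd_mult_right)
      moreover have "real (card {n\<in>pos_le x. q * r dvd n}) \<le> x / real (q * r)"
        by (rule card_multiples_le) (use pos x in auto)
      ultimately show ?thesis using False qr by simp
    qed
  qed
  also have "\<dots> = (\<Sum>z\<in>P \<times> P. x * (1 / real (fst z)) * (1 / real (snd z))) + (\<Sum>z\<in>P \<times> P. (if fst z = snd z then x * (1 / real (fst z)) else 0))"
    by (rule sum.distrib)
  also have "(\<Sum>z\<in>P \<times> P. x * (1 / real (fst z)) * (1 / real (snd z))) = (\<Sum>q\<in>P. \<Sum>r\<in>P. x * (1 / real q) * (1 / real r))"
    by (subst sum.cartesian_product) (simp add: case_prod_unfold)
  also have "(\<Sum>q\<in>P. \<Sum>r\<in>P. x * (1 / real q) * (1 / real r)) = x * (recip_sum P)\<^sup>2"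
    unfolding recip_sum_def power2_eq_square sum_product by (simp add: sum_distrib_left mult.assoc)
  also have "(\<Sum>z\<in>P \<times> P. (if fst z = snd z then x * (1 / real (fst z)) else 0))
      = (\<Sum>q\<in>P. \<Sum>r\<in>P. if q = r then x * (1 / real q) else 0)"
    by (subst sum.cartesian_product) (simp add: case_prod_unfold)
  also have "\<dots> = x * recip_sum P"
    unfolding recip_sum_def sum_distrib_left using P by (intro sum.cong) auto
  finally show ?thesis by (simp add: algebra_simps)
qed

text \<open>Turan's variance argument: where \<open>omega_in P\<close> vanishes it differs from m =
  \<open>recip_sum P\<close> by m, while the sum of all squared deviations is at most 3 y m.
  Rounding costs one unit per prime, at most y in all because P lies in [1, y].\<close>

lemma card_omega_zero:
  assumes P: "finite P" "\<And>q. q \<in> P \<Longrightarrow> prime q \<and> real q \<le> y" and pos: "recip_sum P > 0" and y: "y \<ge> 0"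
  shows "real (card {n\<in>pos_le y. omega_in P n = 0}) \<le> 3 * y / recip_sum P"
proof -
  let ?m = "recip_sum P" and ?w = "\<lambda>n. real (omega_in P n)"
  have cP: "real (card P) \<le> y"
  proof -
    have "P \<subseteq> pos_le y"
    proof
      fix q assume "q \<in> P"
      then have "prime q" "real q \<le> y" using P by auto
      then show "q \<in> pos_le y" unfolding pos_le_def using prime_ge_1_nat by blast
    qed
    then have "card P \<le> card (pos_le y)" by (rule card_mono[rotated]) auto
    then show ?thesis using card_pos_le(1)[OF y] by linarith
  qed
  have first: "(\<Sum>n\<in>pos_le y. ?w n) \<ge> y * ?m - y"
  proof -
    have "(\<Sum>n\<in>pos_le y. omega_in P n) = (\<Sum>q\<in>P. card {n\<in>pos_le y. q dvd n})"
      unfolding omega_in_def by (rule sum_card_swap) (use P in auto)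
    then have "(\<Sum>n\<in>pos_le y. ?w n) = (\<Sum>q\<in>P. real (card {n\<in>pos_le y. q dvd n}))" by (metis of_nat_sum)
    also have "\<dots> \<ge> (\<Sum>q\<in>P. y * (1 / q) - 1)"
    proof (rule sum_mono)
      fix q assume "q \<in> P"
      then have "q \<ge> 1" using P prime_ge_1_nat by blast
      then show "y * (1 / q) - 1 \<le> real (card {n\<in>pos_le y. q dvd n})"
        using card_pos_le(2)[of "y / q"] by (simp add: card_multiples_pos_le)
    qed
    moreover have "(\<Sum>q\<in>P. y * (1 / q) - 1) = y * ?m - card P"
      unfolding recip_sum_def by (simp add: sum_subtractf sum_distrib_left)
    ultimately show ?thesis using cP by linarith
  qed
  have "card {n\<in>pos_le y. omega_in P n = 0} * ?m\<^sup>2 = (\<Sum>n\<in>{n\<in>pos_le y. omega_in P n = 0}. (?w n - ?m)\<^sup>2)" by simp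
  also have "\<dots> \<le> (\<Sum>n\<in>pos_le y. (?w n - ?m)\<^sup>2)" by (rule sum_mono2) auto
  also have "\<dots> = (\<Sum>n\<in>pos_le y. (?w n)\<^sup>2) - 2 * ?m * (\<Sum>n\<in>pos_le y. ?w n) + card (pos_le y) * ?m\<^sup>2"
    by (simp add: power2_diff sum.distrib sum_subtractf sum_distrib_left mult_ac)
  also have "\<dots> \<le> y * (?m\<^sup>2 + ?m) - 2 * ?m * (y * ?m - y) + y * ?m\<^sup>2"
    using omega_second_moment[OF P(1) _ y] P(2) first pos card_pos_le(1)[OF y]
    by (intro add_mono diff_mono mult_left_mono mult_right_mono) auto
  also have "\<dots> = (3 * y) * ?m" by (simp add: algebra_simps power2_eq_square)
  finally have "card {n\<in>pos_le y. omega_in P n = 0} * ?m * ?m \<le> (3 * y) * ?m" by (simp add: power2_eq_square mult_ac)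
  then have "card {n\<in>pos_le y. omega_in P n = 0} * ?m \<le> 3 * y" using pos by (simp add: mult_le_cancel_right)
  then show ?thesis using pos by (simp add: field_simps)
qed

section \<open>Smooth and rough parts\<close>

definition smooth_nat :: "real \<Rightarrow> nat \<Rightarrow> bool" where
  "smooth_nat w n \<longleftrightarrow> (\<forall>q. prime q \<longrightarrow> q dvd n \<longrightarrow> real q \<le> w)"

definition rough_nat :: "real \<Rightarrow> nat \<Rightarrow> bool" where
  "rough_nat w n \<longleftrightarrow> (\<forall>q. prime q \<longrightarrow> q dvd n \<longrightarrow> w < real q)"

lemma smooth_rough_decomposition:
  "n \<ge> 1 \<Longrightarrow> \<exists>a b. n = a * b \<and> smooth_nat w a \<and> rough_nat w b"
proof (induction n rule: less_induct)
  case (less n)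
  show ?case
  proof (cases "n = 1")
    case True
    then show ?thesis by (intro exI[of _ 1]) (auto simp: smooth_nat_def rough_nat_def)
  next
    case False
    then obtain q where q: "prime q" "q dvd n" using prime_factor_nat by blast
    then obtain m where m: "n = q * m" by auto
    have "1 < q" using q prime_gt_1_nat by blast
    then have "m < n" "m \<ge> 1" using m less.prems by auto
    then obtain a b where ab: "m = a * b" "smooth_nat w a" "rough_nat w b" using less.IH by blast
    show ?thesis
    proof (cases "real q \<le> w")
      case True
      have "smooth_nat w (q * a)" using ab q True
        by (auto simp: smooth_nat_def prime_dvd_mult_iff dest: primes_dvd_imp_eq)
      then show ?thesis using ab m by (intro exI[of _ "q * a"] exI[of _ b]) auto
    next
      case False
      have "rough_nat w (q * b)" using ab q False
        by (auto simp: rough_nat_def prime_dvd_mult_iff dest: primes_dvd_imp_eq)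
      then show ?thesis using ab m by (intro exI[of _ a] exI[of _ "q * b"]) auto
    qed
  qed
qed

lemma smooth_rough_coprime: "smooth_nat w a \<Longrightarrow> rough_nat w b \<Longrightarrow> coprime a b"
  unfolding smooth_nat_def rough_nat_def
  by (rule ccontr) (metis coprime_iff_gcd_eq_1 dvd_trans gcd_dvd1 gcd_dvd2 linorder_not_less prime_factor_nat)

lemma smooth_rough_unique:
  assumes "a * b = a' * b'" "smooth_nat w a" "smooth_nat w a'" "rough_nat w b" "rough_nat w b'" "a \<ge> 1"
  shows "a = a' \<and> b = b'"
proof -
  have "a dvd a'" using assms smooth_rough_coprime[of w a b'] by (metis coprime_dvd_mult_left_iff dvd_triv_left)
  moreover have "a' dvd a" using assms smooth_rough_coprime[of w a' b] by (metis coprime_dvd_mult_left_iff dvd_triv_left)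
  ultimately have "a = a'" by (rule dvd_antisym)
  then show ?thesis using assms by auto
qed

section \<open>Counting the signs of a multiplicative function\<close>

definition cnt :: "(nat \<Rightarrow> int) \<Rightarrow> int \<Rightarrow> real \<Rightarrow> real" where
  "cnt f \<theta> x = real (card {n \<in> pos_le x. f n = \<theta>})"

definition smooth_cnt :: "(nat \<Rightarrow> int) \<Rightarrow> real \<Rightarrow> int \<Rightarrow> real \<Rightarrow> real" where
  "smooth_cnt f w \<theta> x = real (card {n \<in> pos_le x. smooth_nat w n \<and> f n = \<theta>})"

definition neg_primes :: "(nat \<Rightarrow> int) \<Rightarrow> real \<Rightarrow> nat set" where
  "neg_primes f x = {q. prime q \<and> real q \<le> x \<and> f q = -1}"

lemma finite_neg_primes [simp, intro]: "finite (neg_primes f x)"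
  by (rule finite_subset[OF _ finite_primes_between[of 0 x]]) (auto simp: neg_primes_def primes_between_def prime_gt_0_nat)

definition neg_mass :: "(nat \<Rightarrow> int) \<Rightarrow> real \<Rightarrow> real" where
  "neg_mass f x = recip_sum (neg_primes f x)"

lemma neg_mass_mono: "x \<le> y \<Longrightarrow> neg_mass f x \<le> neg_mass f y"
  unfolding neg_mass_def recip_sum_def by (rule sum_mono2[OF finite_neg_primes]) (auto simp: neg_primes_def)

lemma neg_mass_diff_le:
  assumes "x \<le> y"
  shows "neg_mass f y - neg_mass f x \<le> (\<Sum>q\<in>primes_between x y. 1 / real q)"
proof -
  have sub: "neg_primes f x \<subseteq> neg_primes f y" using assms by (auto simp: neg_primes_def)
  have "neg_mass f y - neg_mass f x = (\<Sum>q\<in>neg_primes f y - neg_primes f x. 1 / real q)"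
    unfolding neg_mass_def recip_sum_def by (rule sum_diff[symmetric]) (use sub in auto)
  also have "\<dots> \<le> (\<Sum>q\<in>primes_between x y. 1 / real q)"
    by (rule sum_mono2[OF finite_primes_between]) (auto simp: neg_primes_def primes_between_def not_le)
  finally show ?thesis .
qed

text \<open>The values are required to be signs only up to M because the Legendre symbol vanishes at
  multiples of p; the instances take M < p.\<close>

locale pm_mult =
  fixes f :: "nat \<Rightarrow> int" and M :: real
  assumes f_mult: "f (a * b) = f a * f b"
    and f_pm: "1 \<le> n \<Longrightarrow> real n \<le> M \<Longrightarrow> f n = 1 \<or> f n = -1"
begin

lemma f_1: "1 \<le> M \<Longrightarrow> f 1 = 1"
  using f_mult[of 1 1] f_pm[of 1] by auto

lemma cnt_add: "x \<le> M \<Longrightarrow> cnt f 1 x + cnt f (-1) x = card (pos_le x)"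
proof -
  assume x: "x \<le> M"
  have "pos_le x = {n \<in> pos_le x. f n = 1} \<union> {n \<in> pos_le x. f n = -1}"
  proof (intro equalityI subsetI)
    fix n assume n: "n \<in> pos_le x"
    then have "f n = 1 \<or> f n = -1" using f_pm[of n] x by (auto simp: pos_le_def)
    then show "n \<in> {n \<in> pos_le x. f n = 1} \<union> {n \<in> pos_le x. f n = -1}" using n by auto
  qed auto
  then have "card (pos_le x) = card ({n \<in> pos_le x. f n = 1} \<union> {n \<in> pos_le x. f n = -1})" by simp
  also have "\<dots> = card {n \<in> pos_le x. f n = 1} + card {n \<in> pos_le x. f n = -1}"
    by (rule card_Un_disjoint) auto
  finally show ?thesis by (simp add: cnt_def)
qed

lemma ex_neg_prime_factor:
  "1 \<le> n \<Longrightarrow> real n \<le> M \<Longrightarrow> f n = -1 \<Longrightarrow> \<exists>q. prime q \<and> q dvd n \<and> f q = -1"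
proof (induction n rule: less_induct)
  case (less n)
  have "1 \<le> M" using less.prems by linarith
  then have "n \<noteq> 1" using f_1 less.prems by auto
  then obtain q where q: "prime q" "q dvd n" using prime_factor_nat by blast
  then obtain m where m: "n = q * m" by auto
  have q1: "1 < q" using q prime_gt_1_nat by blast
  then have mn: "m < n" "m \<ge> 1" using m less.prems by auto
  show ?case
  proof (cases "f q = -1")
    case False
    have "q \<le> n" using q less.prems by (intro dvd_imp_le) auto
    then have "f q = 1" using False f_pm[of q] q1 less.prems by auto
    then have "f m = -1" using less.prems m f_mult by simp
    moreover have "real m \<le> M" using mn less.prems by linarith
    ultimately show ?thesis using less.IH[of m] mn m by auto
  qed (use q in auto)
qed

text \<open>A negative value forces a prime factor with negative value; the union bound over these
  primes gives their reciprocal mass.\<close>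

lemma cnt_neg_le:
  assumes "0 \<le> x" "x \<le> M"
  shows "cnt f (-1) x \<le> x * neg_mass f x"
proof -
  have "{n \<in> pos_le x. f n = -1} \<subseteq> (\<Union>q\<in>neg_primes f x. {n \<in> pos_le x. q dvd n})"
  proof
    fix n assume n: "n \<in> {n \<in> pos_le x. f n = -1}"
    then have n1: "1 \<le> n" "real n \<le> x" "f n = -1" by (auto simp: pos_le_def)
    then obtain q where q: "prime q" "q dvd n" "f q = -1" using ex_neg_prime_factor[of n] assms by auto
    then have "q \<le> n" using n1 by (intro dvd_imp_le) auto
    then have "q \<in> neg_primes f x" using q n1 by (auto simp: neg_primes_def)
    then show "n \<in> (\<Union>q\<in>neg_primes f x. {n \<in> pos_le x. q dvd n})" using n q by auto
  qed
  then have "card {n \<in> pos_le x. f n = -1} \<le> card (\<Union>q\<in>neg_primes f x. {n \<in> pos_le x. q dvd n})"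
    by (intro card_mono) auto
  also have "\<dots> \<le> (\<Sum>q\<in>neg_primes f x. card {n \<in> pos_le x. q dvd n})" by (rule card_UN_le) auto
  finally have "cnt f (-1) x \<le> (\<Sum>q\<in>neg_primes f x. real (card {n \<in> pos_le x. q dvd n}))"
    unfolding cnt_def by (simp only: of_nat_le_iff of_nat_sum[symmetric])
  also have "\<dots> \<le> (\<Sum>q\<in>neg_primes f x. x * (1 / q))"
  proof (rule sum_mono)
    fix q assume "q \<in> neg_primes f x"
    then have "1 \<le> q" using prime_ge_1_nat by (auto simp: neg_primes_def)
    then show "real (card {n \<in> pos_le x. q dvd n}) \<le> x * (1 / q)" using card_multiples_le[of q x] assms by simp
  qed
  finally show ?thesis by (simp add: neg_mass_def recip_sum_def sum_distrib_left)
qed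

lemma cnt_pos_ge:
  assumes "1 \<le> x" "x \<le> M" "neg_mass f x \<le> 1 / 2"
  shows "cnt f 1 x \<ge> x / 4"
proof (cases "x \<ge> 4")
  case True
  have "x * neg_mass f x \<le> x * (1 / 2)" using assms by (intro mult_left_mono) auto
  then have "cnt f (-1) x \<le> x / 2" using cnt_neg_le[of x] assms by linarith
  then show ?thesis using cnt_add[OF assms(2)] card_pos_le(2)[of x] True by linarith
next
  case False
  \<comment> \<open>Below 4 the rounding is too costly, but n = 1 alone is at least x/4.\<close>
  have "1 \<in> {n \<in> pos_le x. f n = 1}" using assms f_1 by (auto simp: pos_le_def)
  then have "{1} \<subseteq> {n \<in> pos_le x. f n = 1}" by simp
  then have "card {1::nat} \<le> card {n \<in> pos_le x. f n = 1}" by (rule card_mono[rotated]) auto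
  then have "cnt f 1 x \<ge> 1" unfolding cnt_def by simp
  then show ?thesis using False by simp
qed

text \<open>A pair (q, m) yields n = q m with f n = \<theta>, because f q squares to 1, and n arises
  from at most \<open>omega_in P n\<close> pairs. R is instantiated with the trivial predicate and
  with smoothness.\<close>

lemma pair_count:
  assumes P: "finite P" "\<And>q. q \<in> P \<Longrightarrow> prime q \<and> real q \<le> M"
    and R: "\<And>q m. q \<in> P \<Longrightarrow> R m \<Longrightarrow> R (q * m)" and \<theta>: "\<theta> = 1 \<or> \<theta> = -1"
  shows "(\<Sum>q\<in>P. card {m \<in> pos_le (x / q). R m \<and> f m = \<theta> * f q})
    \<le> (\<Sum>n\<in>{n \<in> pos_le x. R n \<and> f n = \<theta>}. omega_in P n)"
proof -
  let ?S = "{n \<in> pos_le x. R n \<and> f n = \<theta>}"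
  let ?Z = "Sigma P (\<lambda>q. {m \<in> pos_le (x / q). R m \<and> f m = \<theta> * f q})"
  let ?W = "Sigma ?S (\<lambda>n. {q\<in>P. q dvd n})"
  have "card ?Z \<le> card ?W"
  proof (rule card_inj_on_le[where f="\<lambda>(q, m). (q * m, q)"])
    show "inj_on (\<lambda>(q, m). (q * m, q)) ?Z"
    proof (rule inj_onI, clarify)
      fix q m m' assume "q \<in> P" and eq: "q * m = q * m'"
      then have "q > 0" using P(2) prime_gt_0_nat by blast
      then show "q = q \<and> m = m'" using eq by simp
    qed
    show "finite ?W" using P by auto
    show "(\<lambda>(q, m). (q * m, q)) ` ?Z \<subseteq> ?W"
    proof clarsimp
      fix q m assume q: "q \<in> P" and m: "m \<in> pos_le (x / q)" "R m" "f m = \<theta> * f q"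
      have q1: "q \<ge> 1" using P q prime_ge_1_nat by blast
      have "f q = 1 \<or> f q = -1" using P q q1 f_pm by blast
      then have "f (q * m) = \<theta>" unfolding f_mult m(3) by auto
      moreover have "q * m \<in> pos_le x" using m q1 by (auto simp: pos_le_def field_simps)
      ultimately show "q * m \<in> pos_le x \<and> R (q * m) \<and> f (q * m) = \<theta>" using R q m by auto
    qed
  qed
  then show ?thesis using P by (simp add: omega_in_def)
qed

text \<open>Products of a negative prime q and a positive m <= x/q give at least x T / 4 pairs, with
  T the negative mass. An n may be hit several times; the second moment, at most (9/8) x T for T <=
  1/8, limits the repetitions.\<close>

lemma cnt_neg_ge:
  assumes "1 \<le> x" "x \<le> M" "neg_mass f x \<le> 1 / 8"
  shows "cnt f (-1) x \<ge> x * neg_mass f x / 18"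
proof -
  let ?P = "neg_primes f x" and ?T = "neg_mass f x"
  let ?S = "{n \<in> pos_le x. True \<and> f n = -1}"
  have prP: "prime q \<and> real q \<le> M" if "q \<in> ?P" for q using that assms by (auto simp: neg_primes_def)
  have "(\<Sum>q\<in>?P. card {m \<in> pos_le (x / q). True \<and> f m = (-1) * f q}) \<le> (\<Sum>n\<in>?S. omega_in ?P n)"
    by (rule pair_count) (use prP in auto)
  then have "(\<Sum>q\<in>?P. real (card {m \<in> pos_le (x / q). True \<and> f m = (-1) * f q})) \<le> (\<Sum>n\<in>?S. real (omega_in ?P n))"
    by (simp only: of_nat_le_iff of_nat_sum[symmetric])
  moreover have "x / 4 * ?T \<le> (\<Sum>q\<in>?P. real (card {m \<in> pos_le (x / q). True \<and> f m = (-1) * f q}))"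
    unfolding neg_mass_def recip_sum_def sum_distrib_left
  proof (rule sum_mono)
    fix q assume q: "q \<in> ?P"
    then have q': "prime q" "real q \<le> x" "f q = -1" by (auto simp: neg_primes_def)
    have q1: "real q \<ge> 1" using q' prime_ge_1_nat by (simp add: Suc_leI prime_gt_0_nat)
    have xq: "1 \<le> x / q" "x / q \<le> x" using q' q1 assms by (auto simp: field_simps)
    have "cnt f 1 (x / q) \<ge> (x / q) / 4"
      by (rule cnt_pos_ge) (use xq assms neg_mass_mono[OF xq(2), of f] in auto)
    then show "x / 4 * (1 / real q) \<le> real (card {m \<in> pos_le (x / q). True \<and> f m = (-1) * f q})"
      using q' unfolding cnt_def by simp
  qed
  ultimately have lo: "x / 4 * ?T \<le> (\<Sum>n\<in>?S. real (omega_in ?P n))" by linarith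
  have T0: "?T \<ge> 0" unfolding neg_mass_def by (rule recip_sum_nonneg)
  have "(\<Sum>n\<in>?S. (real (omega_in ?P n))\<^sup>2) \<le> (\<Sum>n\<in>pos_le x. (real (omega_in ?P n))\<^sup>2)" by (rule sum_mono2) auto
  also have "\<dots> \<le> x * (?T\<^sup>2 + ?T)"
    unfolding neg_mass_def by (rule omega_second_moment) (use prP assms in auto)
  also have "\<dots> \<le> x * (9 / 8 * ?T)"
    using assms T0 mult_right_mono[of ?T "1/8" ?T] by (intro mult_left_mono) (auto simp: power2_eq_square)
  finally have up: "(\<Sum>n\<in>?S. (real (omega_in ?P n))\<^sup>2) \<le> x * (9 / 8 * ?T)" .
  \<comment> \<open>The inequality 2 t <= 9/2 + (2/9) t^2 replaces Cauchy-Schwarz. The weight 2/9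
    lets the second moment cost x T / 4, half of the lower bound x T / 2.\<close>
  have "2 * (\<Sum>n\<in>?S. real (omega_in ?P n)) = (\<Sum>n\<in>?S. 2 * real (omega_in ?P n))" by (rule sum_distrib_left)
  also have "\<dots> \<le> (\<Sum>n\<in>?S. 9 / 2 + 2 / 9 * (real (omega_in ?P n))\<^sup>2)"
  proof (rule sum_mono)
    fix n
    have "0 \<le> (real (omega_in ?P n) - 9 / 2)\<^sup>2" by simp
    then show "2 * real (omega_in ?P n) \<le> 9 / 2 + 2 / 9 * (real (omega_in ?P n))\<^sup>2"
      by (simp add: power2_diff field_simps power2_eq_square)
  qed
  also have "\<dots> = 9 / 2 * card ?S + 2 / 9 * (\<Sum>n\<in>?S. (real (omega_in ?P n))\<^sup>2)"
    by (simp add: sum.distrib sum_distrib_left)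
  finally have "9 / 2 * real (card ?S) \<ge> x * ?T / 4" using lo up by simp
  then show ?thesis unfolding cnt_def by simp
qed

lemma omega_in_le:
  assumes P: "finite P" "\<And>q. q \<in> P \<Longrightarrow> prime q \<and> Y < real q" and Y: "1 < Y" and n: "1 \<le> n" "real n \<le> x"
    and U: "ln x \<le> U * ln Y"
  shows "real (omega_in P n) \<le> U"
proof -
  let ?A = "{q\<in>P. q dvd n}"
  have "\<Prod>?A dvd n" by (rule prod_primes_dvd) (use P in auto)
  then have "\<Prod>?A \<le> n" using n by (intro dvd_imp_le) auto
  then have "real (\<Prod>?A) \<le> x" using n by linarith
  moreover have "Y ^ card ?A \<le> real (\<Prod>?A)"
  proof -
    have "(\<Prod>q\<in>?A. Y) \<le> (\<Prod>q\<in>?A. real q)" by (rule prod_mono) (use P Y in force)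
    then show ?thesis by simp
  qed
  ultimately have "Y ^ card ?A \<le> x" by linarith
  then have "ln (Y ^ card ?A) \<le> ln x" using Y by (intro ln_mono) auto
  moreover have "ln (Y ^ card ?A) = card ?A * ln Y" using Y by (simp add: ln_realpow)
  ultimately have "card ?A * ln Y \<le> U * ln Y" using U by linarith
  then have "real (card ?A) \<le> U" by (rule mult_right_le_imp_le) (use Y in simp)
  then show ?thesis unfolding omega_in_def .
qed

text \<open>The sign of f q is unknown, so both signs must be available at x/q: whichever sign m has
  to have, q m then gets sign \<theta>. As x <= Y^U, at most U primes above Y divide an n, so each n
  is counted at most U times.\<close>

lemma smooth_cnt_step:
  assumes P: "finite P" "\<And>q. q \<in> P \<Longrightarrow> prime q \<and> Y < real q \<and> real q \<le> w \<and> real q \<le> M" and Y: "1 < Y"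
    and U: "ln x \<le> U * ln Y" "U > 0" and x: "0 \<le> x" and \<kappa>: "\<kappa> \<ge> 0"
    and \<theta>: "\<theta> = 1 \<or> \<theta> = -1"
    and IH: "\<And>q \<theta>. q \<in> P \<Longrightarrow> \<theta> = 1 \<or> \<theta> = -1 \<Longrightarrow> smooth_cnt f w \<theta> (x / q) \<ge> \<kappa> * (x / q)"
  shows "smooth_cnt f w \<theta> x \<ge> \<kappa> * recip_sum P / U * x"
proof -
  let ?S = "{n \<in> pos_le x. smooth_nat w n \<and> f n = \<theta>}"
  have "\<kappa> * recip_sum P * x = (\<Sum>q\<in>P. \<kappa> * (x / q))"
    unfolding recip_sum_def by (simp add: sum_distrib_left sum_distrib_right)
  also have "\<dots> \<le> (\<Sum>q\<in>P. real (card {m \<in> pos_le (x / q). smooth_nat w m \<and> f m = \<theta> * f q}))"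
  proof (rule sum_mono)
    fix q assume q: "q \<in> P"
    have "q \<ge> 1" using P q prime_ge_1_nat by blast
    then have "f q = 1 \<or> f q = -1" using P q f_pm by blast
    then have "\<theta> * f q = 1 \<or> \<theta> * f q = -1" using \<theta> by auto
    from IH[OF q this] show "\<kappa> * (x / q) \<le> real (card {m \<in> pos_le (x / q). smooth_nat w m \<and> f m = \<theta> * f q})"
      by (simp add: smooth_cnt_def)
  qed
  also have "\<dots> = real (\<Sum>q\<in>P. card {m \<in> pos_le (x / q). smooth_nat w m \<and> f m = \<theta> * f q})" by simp
  also have "\<dots> \<le> real (\<Sum>n\<in>?S. omega_in P n)"
  proof (subst of_nat_le_iff, rule pair_count)
    show "smooth_nat w (q * m)" if "q \<in> P" "smooth_nat w m" for q m
      unfolding smooth_nat_def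
    proof (intro allI impI)
      fix r assume r: "prime r" "r dvd q * m"
      then consider "r dvd q" | "r dvd m" by (auto simp: prime_dvd_mult_iff)
      then show "real r \<le> w"
      proof cases
        case 1
        then have "r = q" using r P(2)[OF that(1)] primes_dvd_imp_eq by blast
        then show ?thesis using P(2)[OF that(1)] by simp
      qed (use that r in \<open>auto simp: smooth_nat_def\<close>)
    qed
  qed (use P \<theta> in auto)
  also have "\<dots> = (\<Sum>n\<in>?S. real (omega_in P n))" by simp
  also have "\<dots> \<le> (\<Sum>n\<in>?S. U)"
  proof (rule sum_mono)
    fix n assume "n \<in> ?S"
    then have "1 \<le> n" "real n \<le> x" by (auto simp: pos_le_def)
    then show "real (omega_in P n) \<le> U" using omega_in_le[of P Y n x U] P Y U by auto
  qed
  also have "\<dots> = smooth_cnt f w \<theta> x * U" by (simp add: smooth_cnt_def)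
  finally show ?thesis using U by (simp add: field_simps)
qed

end

section \<open>Transport of both signs from z to all larger y\<close>

lemma ln_le_of_le_exp: "0 < q \<Longrightarrow> q \<le> exp t \<Longrightarrow> ln q \<le> t" for q t :: real
  using ln_le_cancel_iff[of q "exp t"] by simp

lemma le_ln_of_exp_less: "exp t < q \<Longrightarrow> t \<le> ln q" for q t :: real
  using ln_le_cancel_iff[of "exp t" q] order_less_trans[OF exp_gt_zero] by (simp add: less_imp_le)

lemma smooth_cnt_eq_cnt: "x \<le> w \<Longrightarrow> smooth_cnt f w \<theta> x = cnt f \<theta> x"
proof -
  assume x: "x \<le> w"
  have "smooth_nat w n" if "n \<in> pos_le x" for n
    unfolding smooth_nat_def
  proof (intro allI impI)
    fix q assume "prime q" "q dvd n"
    then have "q \<le> n" using that by (intro dvd_imp_le) (auto simp: pos_le_def)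
    then show "real q \<le> w" using that x by (auto simp: pos_le_def)
  qed
  then have "{n \<in> pos_le x. smooth_nat w n \<and> f n = \<theta>} = {n \<in> pos_le x. f n = \<theta>}" by auto
  then show ?thesis by (simp add: smooth_cnt_def cnt_def)
qed

lemma primes_between_split:
  "x \<le> y \<Longrightarrow> y \<le> z \<Longrightarrow> primes_between x z = primes_between x y \<union> primes_between y z"
  by (auto simp: primes_between_def)

text \<open>Each squaring of the upper endpoint adds at least 1/4, so 48 squarings reach the mass 12
  that \<open>card_good_split\<close> uses.\<close>

lemma sum_recip_primes_tower:
  assumes lz: "ln z \<ge> 40" and z: "z > 0"
  shows "recip_sum (primes_between z (exp (2 ^ i * ln z))) \<ge> i / 4"
proof (induction i)
  case (Suc i)
  let ?a = "exp (2 ^ i * ln z)" and ?b = "exp (2 ^ Suc i * ln z)"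
  have p1: "(1::real) \<le> 2 ^ i" by simp
  have big: "40 \<le> 2 ^ i * ln z" using mult_mono[OF p1 lz] lz by simp
  have za: "z \<le> ?a"
  proof -
    have "1 * ln z \<le> 2 ^ i * ln z" using p1 lz by (intro mult_right_mono) auto
    then show ?thesis using z by (metis exp_le_cancel_iff exp_ln mult_1)
  qed
  have ab: "?a \<le> ?b" using big lz by simp
  have "primes_between z ?b = primes_between z ?a \<union> primes_between ?a ?b"
    by (rule primes_between_split[OF za ab])
  then have "recip_sum (primes_between z ?b) = recip_sum (primes_between z ?a) + (\<Sum>q\<in>primes_between ?a ?b. 1 / real q)"
    unfolding recip_sum_def by (simp only:) (rule sum.union_disjoint, simp, simp, auto simp: primes_between_def)
  moreover have "(ln ?b - ln ?a - 20) / ln ?b \<le> (\<Sum>q\<in>primes_between ?a ?b. 1 / real q)"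
  proof (rule sum_prime_recip_ge)
    have "0 < 2 * (2 ^ i * ln z)" using big by linarith
    then show "1 < ?b" by (simp only: one_less_exp_iff power_Suc mult.assoc)
  qed (use big ab in auto)
  moreover have "1 / 4 \<le> (ln ?b - ln ?a - 20) / ln ?b"
  proof -
    have "1 / 4 \<le> (2 * L - L - 20) / (2 * L)" if "40 \<le> L" for L :: real using that by (simp add: field_simps)
    from this[OF big] show ?thesis by (simp add: mult.assoc)
  qed
  ultimately have "i / 4 + 1 / 4 \<le> recip_sum (primes_between z ?b)" using Suc.IH by linarith
  then show ?case by (simp add: add_divide_distrib)
qed (simp add: recip_sum_nonneg)

text \<open>ln a is the sum of \<open>mangoldt\<close> over the divisors of a, all of them smooth
  divisors of n. Averaging over n leaves the primes up to w, at most ln w + 10, and the proper prime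
  powers, at most 8. Hence few n have a smooth part beyond w^5.\<close>

lemma sum_ln_smooth_part:
  assumes ab: "\<And>n. n \<in> pos_le y \<Longrightarrow> n = a n * b n \<and> smooth_nat w (a n)" and w: "w \<ge> 1" and y: "y \<ge> 0"
  shows "(\<Sum>n\<in>pos_le y. ln (real (a n))) \<le> y * (ln w + 18)"
proof -
  let ?D = "{d \<in> pos_le y. smooth_nat w d}"
  have "(\<Sum>n\<in>pos_le y. ln (real (a n))) \<le> (\<Sum>n\<in>pos_le y. \<Sum>d\<in>{d\<in>?D. d dvd n}. mangoldt d)"
  proof (rule sum_mono)
    fix n assume n: "n \<in> pos_le y"
    then have n1: "n \<ge> 1" "real n \<le> y" by (auto simp: pos_le_def)
    have an: "a n dvd n" "a n \<noteq> 0" using ab[OF n] n1 by (metis dvd_triv_left, metis mult_0 not_one_le_zero)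
    have "ln (real (a n)) = (\<Sum>d | d dvd a n. mangoldt d)" using an by (simp add: mangoldt_sum)
    also have "\<dots> \<le> (\<Sum>d\<in>{d\<in>?D. d dvd n}. mangoldt d)"
    proof (rule sum_mono2)
      show "{d. d dvd a n} \<subseteq> {d\<in>?D. d dvd n}"
      proof clarify
        fix d assume d: "d dvd a n"
        then have dn: "d dvd n" using an dvd_trans by blast
        then have "d \<le> n" "d \<ge> 1" using n1 dvd_imp_le[of d n] dvd_pos_nat[of n d] by auto
        moreover have "smooth_nat w d" using ab[OF n] d unfolding smooth_nat_def by (meson dvd_trans)
        ultimately show "d \<in> ?D \<and> d dvd n" using n1 dn by (auto simp: pos_le_def)
      qed
    qed (auto simp: mangoldt_nonneg)
    finally show "ln (real (a n)) \<le> (\<Sum>d\<in>{d\<in>?D. d dvd n}. mangoldt d)" .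
  qed
  also have "\<dots> = (\<Sum>d\<in>?D. \<Sum>n\<in>{n\<in>pos_le y. d dvd n}. mangoldt d)" by (rule sum.swap_restrict) auto
  also have "\<dots> \<le> (\<Sum>d\<in>?D. y * (mangoldt d / d))"
  proof (rule sum_mono)
    fix d assume "d \<in> ?D"
    then have d: "d \<ge> 1" by (auto simp: pos_le_def)
    have "mangoldt d * real (card {n\<in>pos_le y. d dvd n}) \<le> mangoldt d * (y / d)"
      by (intro mult_left_mono card_multiples_le mangoldt_nonneg d y)
    then show "(\<Sum>n\<in>{n\<in>pos_le y. d dvd n}. mangoldt d) \<le> y * (mangoldt d / d)" by (simp add: mult_ac)
  qed
  also have "\<dots> = y * (\<Sum>d\<in>?D. mangoldt d / d)" by (simp add: sum_distrib_left)
  also have "\<dots> \<le> y * (ln w + 18)"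
  proof (rule mult_left_mono[OF _ y])
    let ?N = "nat \<lfloor>y\<rfloor>"
    have "(\<Sum>d\<in>?D. mangoldt d / d) = (\<Sum>d\<in>{d\<in>?D. prime d}. mangoldt d / d) + (\<Sum>d\<in>{d\<in>?D. \<not> prime d}. mangoldt d / d)"
      by (subst sum.union_disjoint[symmetric]) (auto intro: sum.cong)
    also have "(\<Sum>d\<in>{d\<in>?D. prime d}. mangoldt d / d) \<le> (\<Sum>q\<in>primes_between 0 w. mangoldt q / q)"
      by (rule sum_mono2[OF finite_primes_between]) (auto simp: primes_between_def smooth_nat_def prime_gt_0_nat mangoldt_nonneg)
    also have "(\<Sum>q\<in>primes_between 0 w. mangoldt q / q) = (\<Sum>q\<in>primes_between 0 w. ln (real q) / real q)"
      by (rule sum.cong) (auto simp: primes_between_def)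
    also have "\<dots> \<le> ln w + 10" using prime_log_sum_real_bounds[OF w] by linarith
    also have "(\<Sum>d\<in>{d\<in>?D. \<not> prime d}. mangoldt d / d) \<le> (\<Sum>d | d \<in> {1..?N} \<and> \<not> prime d. mangoldt d / real d)"
      by (rule sum_mono2) (auto simp: pos_le_eq mangoldt_nonneg)
    also have "\<dots> \<le> 8" by (rule sum_mangoldt_nonprime_le)
    finally show "(\<Sum>d\<in>?D. mangoldt d / d) \<le> ln w + 18" by simp
  qed
  finally show ?thesis .
qed

context pm_mult
begin

text \<open>From z^(63/64) to z the negative mass grows by at most 1/32, so at x it still lies
  between 1/32 and 1/8, where the bounds for small mass serve both signs; 576 = 32 * 18.\<close>

lemma both_signs_base:
  assumes mass: "1 / 16 < neg_mass f z" "neg_mass f z \<le> 1 / 8" and z: "z \<le> M" "ln z \<ge> 6000"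
    and x: "1 \<le> x" "x \<le> z" "63 / 64 * ln z \<le> ln x" and \<theta>: "\<theta> = 1 \<or> \<theta> = -1"
  shows "cnt f \<theta> x \<ge> x / 576"
proof -
  have lx: "ln x > 0" using x z by linarith
  have x1: "1 < x" using lx x by simp
  have "neg_mass f z - neg_mass f x \<le> (\<Sum>q\<in>primes_between x z. 1 / real q)" by (rule neg_mass_diff_le[OF x(2)])
  also have "\<dots> \<le> (ln z - ln x + 20) / ln x" by (rule sum_prime_recip_le[OF x1 x(2)])
  also have "\<dots> \<le> 1 / 32" using lx x z by (simp add: field_simps)
  finally have lo: "neg_mass f x \<ge> 1 / 32" using mass by simp
  have up: "neg_mass f x \<le> 1 / 8" using neg_mass_mono[OF x(2), of f] mass by linarith
  have xM: "x \<le> M" using x z by linarith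
  from \<theta> show ?thesis
  proof
    assume "\<theta> = 1"
    then show ?thesis using cnt_pos_ge[OF x(1) xM] up x by simp
  next
    assume "\<theta> = -1"
    moreover have "x * (1 / 32) \<le> x * neg_mass f x" using lo x by (intro mult_left_mono) auto
    ultimately show ?thesis using cnt_neg_ge[OF x(1) xM up] by simp
  qed
qed

text \<open>Primes q between x z^(-127/128) and x z^(-63/64) bring x/q into the window of
  \<open>both_signs_base\<close>. They exceed z^(1/128), so an integer up to z^A has at most 128 A
  of them, and their mass is at least 1/(256 A).\<close>

lemma both_signs_medium:
  assumes mass: "1 / 16 < neg_mass f z" "neg_mass f z \<le> 1 / 8" and z: "1 \<le> z" "z \<le> M" "ln z \<ge> 6000"
    and A: "A \<ge> 1" and w: "w = exp (A * ln z)"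
    and x: "z \<le> x" "x \<le> w" "x \<le> M" and \<theta>: "\<theta> = 1 \<or> \<theta> = -1"
  shows "smooth_cnt f w \<theta> x \<ge> 1 / (576 * 256 * 128 * A\<^sup>2) * x"
proof -
  let ?l = "ln z" and ?u = "ln x"
  define a b where "a = exp (?u - 127 / 128 * ?l)" and "b = exp (?u - 63 / 64 * ?l)"
  define P where "P = primes_between a b"
  have x0: "x > 0" using x z by linarith
  have z1: "1 < z" using z by (metis ln_gt_zero_iff less_le_trans zero_less_numeral zero_less_one)
  have ul: "?l \<le> ?u" using x z by simp
  have uw: "?u \<le> A * ?l" using x x0 w by (metis ln_exp ln_le_cancel_iff exp_gt_zero)
  have P': "prime q" "a < real q" "real q \<le> b" if "q \<in> P" for q using that by (auto simp: P_def primes_between_def)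
  have ab: "1 \<le> a" "a \<le> b" "1 < b" unfolding a_def b_def using ul z by auto
  have bx: "b \<le> x"
  proof -
    have "b \<le> exp ?u" unfolding b_def using z by simp
    then show ?thesis using x0 by simp
  qed
  have aY: "exp (?l / 128) \<le> a" unfolding a_def using ul by simp
  have "smooth_cnt f w \<theta> x \<ge> 1 / 576 * recip_sum P / (128 * A) * x"
  proof (rule smooth_cnt_step[where Y="exp (?l / 128)"])
    show "finite P" by (simp add: P_def)
    show "prime q \<and> exp (?l / 128) < real q \<and> real q \<le> w \<and> real q \<le> M" if "q \<in> P" for q
      using P'[OF that] aY bx x by auto
    show "1 < exp (?l / 128)" using z1 by simp
    show "?u \<le> 128 * A * ln (exp (?l / 128))" using uw by simp
    fix q \<theta>' assume q: "q \<in> P" and \<theta>': "\<theta>' = 1 \<or> \<theta>' = (-1::int)"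
    have q0: "real q > 0" using P'[OF q] ab by linarith
    have lq: "?u - 127 / 128 * ?l \<le> ln q" "ln q \<le> ?u - 63 / 64 * ?l"
      using P'[OF q] q0 unfolding a_def b_def by (auto intro!: le_ln_of_exp_less ln_le_of_le_exp)
    have lxq: "ln (x / q) = ?u - ln q" using x0 q0 by (simp add: ln_div)
    have xq0: "x / q > 0" using x0 q0 by simp
    have xz: "x / q \<le> z"
    proof -
      have "ln (x / q) \<le> ln z" using lxq lq z by linarith
      then show ?thesis using xq0 z by (subst (asm) ln_le_cancel_iff) auto
    qed
    have zw: "z \<le> w" using x by linarith
    have "0 \<le> ln (x / q)" using lxq lq z by linarith
    then have "x / q \<ge> 1" by (subst (asm) ln_ge_zero_iff[OF xq0])
    then have "cnt f \<theta>' (x / q) \<ge> (x / q) / 576"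
      using both_signs_base[OF mass z(2,3), of "x / q" \<theta>'] xz lxq lq \<theta>' by simp
    then show "1 / 576 * (x / q) \<le> smooth_cnt f w \<theta>' (x / q)"
      using smooth_cnt_eq_cnt[of "x / q" w f \<theta>'] xz zw by simp
  qed (use A x0 \<theta> in auto)
  moreover have "recip_sum P \<ge> 1 / (256 * A)"
  proof -
    have lb: "ln b = ?u - 63 / 64 * ?l" "ln a = ?u - 127 / 128 * ?l" unfolding a_def b_def by simp_all
    have lb0: "ln b > 0" using ab by simp
    have "1 / (256 * A) = (?l / 256) / (A * ?l)" using z1 A by (simp add: field_simps)
    also have "\<dots> \<le> (?l / 256) / ln b" using lb lb0 uw z A by (intro divide_left_mono) (auto intro: mult_pos_pos)
    also have "\<dots> \<le> (ln b - ln a - 20) / ln b" using lb lb0 z by (intro divide_right_mono) auto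
    also have "\<dots> \<le> recip_sum P" unfolding recip_sum_def P_def by (rule sum_prime_recip_ge[OF ab])
    finally show ?thesis .
  qed
  then have "1 / 576 * (1 / (256 * A)) / (128 * A) * x \<le> 1 / 576 * recip_sum P / (128 * A) * x"
    using A x0 by (intro mult_right_mono divide_right_mono mult_left_mono) auto
  ultimately show ?thesis by (simp add: power2_eq_square)
qed

text \<open>Multiplying with primes between w^(1/4) and w^(1/2) keeps w-smoothness and enlarges the
  range by a factor w^(1/4). Up to w^6 at most 24 such primes divide an integer and their mass is at
  least 1/4, whence 96 = 24 * 4 per step; 20 steps lead from w to w^6.\<close>

lemma both_signs_extend:
  assumes z: "1 \<le> z" and w: "w > 0" "ln w \<ge> 2 * ln z" "ln w \<ge> 160" and \<kappa>: "\<kappa> \<ge> 0"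
    and base: "\<And>x \<theta>. z \<le> x \<Longrightarrow> x \<le> w \<Longrightarrow> x \<le> M \<Longrightarrow> \<theta> = 1 \<or> \<theta> = -1 \<Longrightarrow> smooth_cnt f w \<theta> x \<ge> \<kappa> * x"
  shows "j \<le> 20 \<Longrightarrow> z \<le> x \<Longrightarrow> ln x \<le> (1 + real j / 4) * ln w \<Longrightarrow> x \<le> M \<Longrightarrow> \<theta> = 1 \<or> \<theta> = -1
    \<Longrightarrow> smooth_cnt f w \<theta> x \<ge> \<kappa> / 96 ^ j * x"
proof (induction j arbitrary: x \<theta>)
  case 0
  then have "ln x \<le> ln w" "x > 0" using z by auto
  then have "x \<le> w" using w by simp
  then show ?case using base 0 by simp
next
  case (Suc j)
  have x0: "x > 0" using Suc z by linarith
  show ?case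
  proof (cases "ln x \<le> (1 + real j / 4) * ln w")
    case True
    have "\<kappa> / 96 ^ Suc j * x \<le> \<kappa> / 96 ^ j * x"
      using \<kappa> x0 by (intro mult_right_mono divide_left_mono) auto
    then show ?thesis using Suc.IH[of x \<theta>] Suc.prems True by simp
  next
    case False
    let ?l = "ln w"
    define P where "P = primes_between (exp (?l / 4)) (exp (?l / 2))"
    have P': "prime q" "exp (?l / 4) < real q" "real q \<le> exp (?l / 2)" if "q \<in> P" for q
      using that by (auto simp: P_def primes_between_def)
    have "1 * ?l \<le> (1 + real j / 4) * ?l" by (rule mult_right_mono) (simp, use w in linarith)
    then have lx: "?l \<le> ln x" using False by linarith
    have w1: "1 < w" using w by (metis ln_gt_zero_iff less_le_trans zero_less_numeral)
    have ex: "exp (?l / 2) \<le> x" "exp (?l / 2) \<le> w"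
    proof -
      have "exp (?l / 2) \<le> exp (ln x)" using lx w by simp
      then show "exp (?l / 2) \<le> x" using x0 by simp
      have "exp (?l / 2) \<le> exp ?l" using w(3) by (simp only: exp_le_cancel_iff)
      also have "exp ?l = w" using w by simp
      finally show "exp (?l / 2) \<le> w" .
    qed
    have "smooth_cnt f w \<theta> x \<ge> \<kappa> / 96 ^ j * recip_sum P / 24 * x"
    proof (rule smooth_cnt_step[where Y="exp (?l / 4)"])
      show "finite P" by (simp add: P_def)
      show "prime q \<and> exp (?l / 4) < real q \<and> real q \<le> w \<and> real q \<le> M" if "q \<in> P" for q
        using P'[OF that] ex Suc.prems by auto
      show "1 < exp (?l / 4)" using w1 by simp
      have "(1 + real (Suc j) / 4) * ?l \<le> 6 * ?l" using Suc.prems w1 by (intro mult_right_mono) auto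
      then show "ln x \<le> 24 * ln (exp (?l / 4))" using Suc.prems by simp
      fix q \<theta>' assume q: "q \<in> P" and \<theta>': "\<theta>' = 1 \<or> \<theta>' = (-1::int)"
      have "1 < exp (?l / 4)" using w1 by simp
      then have q0: "real q > 1" using P'(2)[OF q] by linarith
      have lq: "?l / 4 \<le> ln q" "ln q \<le> ?l / 2"
        by (rule le_ln_of_exp_less[OF P'(2)[OF q]], rule ln_le_of_le_exp[OF _ P'(3)[OF q]]) (use q0 in linarith)
      have lxq: "ln (x / q) = ln x - ln q" using x0 q0 by (simp add: ln_div)
      have xq0: "x / q > 0" using x0 q0 by simp
      show "\<kappa> / 96 ^ j * (x / q) \<le> smooth_cnt f w \<theta>' (x / q)"
      proof (rule Suc.IH)
        have "ln z \<le> ln (x / q)" using lxq lq lx w by linarith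
        then show "z \<le> x / q" using xq0 z by (subst (asm) ln_le_cancel_iff) auto
        have "(1 + real (Suc j) / 4) * ?l = (1 + real j / 4) * ?l + ?l / 4" by (simp add: algebra_simps add_divide_distrib)
        then show "ln (x / q) \<le> (1 + real j / 4) * ?l" using lxq lq Suc.prems by linarith
        have "x / q \<le> x / 1" using q0 x0 by (intro divide_left_mono) auto
        then show "x / q \<le> M" using Suc.prems by simp
      qed (use Suc.prems \<theta>' in auto)
    qed (use \<kappa> x0 Suc.prems in auto)
    moreover have "recip_sum P \<ge> 1 / 4"
    proof -
      have "1 / 4 \<le> (x / 2 - x / 4 - 20) / (x / 2)" if "160 \<le> x" for x :: real using that by (simp add: field_simps)
      from this[OF w(3)] have "1 / 4 \<le> (ln (exp (?l / 2)) - ln (exp (?l / 4)) - 20) / ln (exp (?l / 2))" by (simp only: ln_exp)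
      also have "\<dots> \<le> recip_sum P" unfolding recip_sum_def P_def by (rule sum_prime_recip_ge) (use w1 in auto)
      finally show ?thesis .
    qed
    then have "\<kappa> / 96 ^ j * (1 / 4) / 24 * x \<le> \<kappa> / 96 ^ j * recip_sum P / 24 * x"
      using \<kappa> x0 by (intro mult_right_mono divide_right_mono mult_left_mono) auto
    ultimately show ?thesis by simp
  qed
qed

end

text \<open>Three exceptional sets have at most y/4 elements each: no prime factor in (z, w], by
  Turan's argument with mass 12; n <= y/4; smooth part beyond w^5, by Markov. For every other n a
  prime from (z, w] divides a, so y/b >= a > z, and n > y/4 gives y/b < 4 a <= 4 w^5, within w^6.
  The condition y >= 8 absorbs the rounding.\<close>

lemma card_good_split:
  assumes z: "z \<ge> 1" "ln z \<ge> 6000" and w: "w = exp (2 ^ 48 * ln z)" and y: "w \<le> y" "y \<ge> 8"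
  shows "real (card {n \<in> pos_le y. \<exists>a b. n = a * b \<and> smooth_nat w a \<and> rough_nat w b \<and> z \<le> y / b \<and> ln (y / b) \<le> 6 * ln w})
    \<ge> y / 8" (is "real (card ?G) \<ge> _")
proof -
  have "\<forall>n. \<exists>a b. n \<ge> 1 \<longrightarrow> n = a * b \<and> smooth_nat w a \<and> rough_nat w b"
    using smooth_rough_decomposition[of _ w] by blast
  then obtain a b where ab: "\<And>n. n \<ge> 1 \<Longrightarrow> n = a n * b n \<and> smooth_nat w (a n) \<and> rough_nat w (b n)" by metis
  have lw: "ln w = 2 ^ 48 * ln z" unfolding w by simp
  have lwz: "ln w \<ge> ln z" unfolding lw using z(2) by simp
  have w1: "w \<ge> 1" unfolding w using z by simp
  define P where "P = primes_between z w"
  have P: "prime q" "z < real q" "real q \<le> w" if "q \<in> P" for q using that by (auto simp: P_def primes_between_def)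
  have mu: "recip_sum P \<ge> 12"
    using sum_recip_primes_tower[of z 48] z unfolding P_def w by simp
  define B1 where "B1 = {n \<in> pos_le y. omega_in P n = 0}"
  define B2 where "B2 = pos_le (y / 4)"
  define B3 where "B3 = {n \<in> pos_le y. 5 * ln w < ln (real (a n))}"
  have a1: "a n \<ge> 1" "b n \<ge> 1" if "n \<ge> 1" for n
    using ab[OF that] that by (metis One_nat_def Suc_leI gr0I mult_is_0 not_one_le_zero)+
  have b1: "real (card B1) \<le> y / 4"
  proof -
    have "real (card B1) \<le> 3 * y / recip_sum P"
      unfolding B1_def
    proof (rule card_omega_zero)
      show "prime q \<and> real q \<le> y" if "q \<in> P" for q using P[OF that] y by simp
    qed (use y mu in \<open>auto simp: P_def\<close>)
    also have "\<dots> \<le> 3 * y / 12" using mu y by (intro divide_left_mono) auto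
    finally show ?thesis by simp
  qed
  have b2: "real (card B2) \<le> y / 4" unfolding B2_def using y by (intro card_pos_le) auto
  have b3: "real (card B3) \<le> y / 4"
  proof -
    have "real (card B3) * (5 * ln w) = (\<Sum>n\<in>B3. 5 * ln w)" by simp
    also have "\<dots> \<le> (\<Sum>n\<in>B3. ln (real (a n)))" by (rule sum_mono) (auto simp: B3_def)
    also have "\<dots> \<le> (\<Sum>n\<in>pos_le y. ln (real (a n)))"
      by (rule sum_mono2[OF finite_pos_le]) (use a1 in \<open>auto simp: B3_def pos_le_def\<close>)
    also have "\<dots> \<le> y * (ln w + 18)"
      by (rule sum_ln_smooth_part[where b=b]) (use ab w1 y in \<open>auto simp: pos_le_def\<close>)
    also have "\<dots> \<le> y * (5 / 4 * ln w)" using y lwz z by (intro mult_left_mono) auto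
    finally have "real (card B3) * (5 * ln w) \<le> (y / 4) * (5 * ln w)" by simp
    then show ?thesis by (rule mult_right_le_imp_le) (use lwz z in linarith)
  qed
  have cover: "pos_le y \<subseteq> ?G \<union> (B1 \<union> (B2 \<union> B3))"
  proof
    fix n assume n: "n \<in> pos_le y"
    then have n1: "1 \<le> n" "real n \<le> y" by (auto simp: pos_le_def)
    show "n \<in> ?G \<union> (B1 \<union> (B2 \<union> B3))"
    proof (rule ccontr)
      assume no: "n \<notin> ?G \<union> (B1 \<union> (B2 \<union> B3))"
      note abn = ab[OF n1(1)] and a1n = a1[OF n1(1)]
      have c1: "omega_in P n \<noteq> 0" and c2: "y / 4 < real n" and c3: "ln (real (a n)) \<le> 5 * ln w"
        using no n n1 by (auto simp: B1_def B2_def B3_def pos_le_def)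
      have "{q\<in>P. q dvd n} \<noteq> {}" using c1 unfolding omega_in_def by (metis card.empty)
      then obtain q where q: "q \<in> P" "q dvd n" by blast
      have "\<not> q dvd b n" using abn P[OF q(1)] by (auto simp: rough_nat_def)
      then have "q dvd a n" using q abn P[OF q(1)] by (metis prime_dvd_mult_iff)
      then have "q \<le> a n" using a1n by (intro dvd_imp_le) auto
      then have az: "z \<le> real (a n)" using P[OF q(1)] by linarith
      have nab: "real n = real (a n) * real (b n)" using abn by (metis of_nat_mult)
      have b0: "real (b n) > 0" using a1n by simp
      have "real (a n) = n / b n" using nab b0 by simp
      also have "\<dots> \<le> y / b n" using n1 b0 by (intro divide_right_mono) auto
      finally have g1: "z \<le> y / b n" using az by linarith
      have "y / b n \<le> (4 * real n) / b n" using c2 b0 by (intro divide_right_mono) auto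
      also have "\<dots> = 4 * real (a n)" using nab b0 by simp
      finally have "ln (y / b n) \<le> ln (4 * real (a n))" using y b0 by (intro ln_mono) auto
      also have "\<dots> = ln 4 + ln (real (a n))" using a1n by (simp add: ln_mult)
      also have "\<dots> \<le> 6 * ln w" using c3 lwz z ln_le_minus_one[of 4] by simp
      finally have "n \<in> ?G" using n abn g1 by blast
      then show False using no by blast
    qed
  qed
  have "card (pos_le y) \<le> card (?G \<union> (B1 \<union> (B2 \<union> B3)))"
    by (rule card_mono[OF _ cover]) (auto simp: B1_def B2_def B3_def)
  also have "\<dots> \<le> card ?G + (card B1 + (card B2 + card B3))"
    by (meson add_le_mono card_Un_le le_refl order_trans)
  finally have "real (card (pos_le y)) \<le> card ?G + (real (card B1) + (real (card B2) + real (card B3)))" by linarith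
  then show ?thesis using b1 b2 b3 card_pos_le(2)[of y] y by linarith
qed

text \<open>The density of \<open>both_signs_medium\<close> for A = 2^48, twenty losses of 96 in
  \<open>both_signs_extend\<close>, and the proportion 1/8 of
  \<open>card_good_split\<close>.\<close>

definition sign_density :: real where
  "sign_density = 1 / (576 * 256 * 128 * (2 ^ 48)\<^sup>2) / 96 ^ 20 / 8"

lemma sign_density_pos: "sign_density > 0"
  by (simp add: sign_density_def)

context pm_mult
begin

text \<open>For each rough b at most y/b good n have this b as rough part, while at least \<kappa>
  y/b smooth a have sign \<theta> f b; the products a b are distinct by
  \<open>smooth_rough_unique\<close>. The comparison is made b by b, so the number of rough b never
  has to be estimated.\<close>

lemma smooth_transfer:
  assumes "y \<le> M" "0 \<le> \<kappa>" "0 < y" and \<theta>: "\<theta> = 1 \<or> \<theta> = -1"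
    and sm: "\<And>b \<theta>. b \<ge> 1 \<Longrightarrow> z \<le> y / b \<Longrightarrow> ln (y / b) \<le> V \<Longrightarrow> \<theta> = 1 \<or> \<theta> = -1 \<Longrightarrow> smooth_cnt f w \<theta> (y / real b) \<ge> \<kappa> * (y / b)"
  shows "cnt f \<theta> y \<ge> \<kappa> * real (card {n \<in> pos_le y. \<exists>a b. n = a * b \<and> smooth_nat w a \<and> rough_nat w b \<and> z \<le> y / b \<and> ln (y / b) \<le> V})"
    (is "_ \<ge> \<kappa> * real (card ?G)")
proof -
  define B where "B = {b \<in> pos_le y. rough_nat w b \<and> z \<le> y / b \<and> ln (y / b) \<le> V}"
  have finB: "finite B" by (simp add: B_def)
  let ?A = "\<lambda>b. {a \<in> pos_le (y / real b). smooth_nat w a \<and> f a = \<theta> * f b}"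
  have B: "b \<ge> 1" "rough_nat w b" "z \<le> y / b" "ln (y / b) \<le> V" "f b = 1 \<or> f b = -1" if "b \<in> B" for b
    using that assms(1) f_pm[of b] by (auto simp: B_def pos_le_def)
  have "?G \<subseteq> (\<lambda>(b, a). a * b) ` (Sigma B (\<lambda>b. pos_le (y / real b)))"
  proof
    fix n assume "n \<in> ?G"
    then obtain a b where n: "n \<in> pos_le y" "n = a * b" "rough_nat w b" "z \<le> y / b" "ln (y / b) \<le> V" by blast
    then have n1: "1 \<le> a * b" "real (a * b) \<le> y" by (auto simp: pos_le_def)
    then have a1: "a \<ge> 1" "b \<ge> 1" by (metis One_nat_def Suc_leI gr0I mult_is_0 not_one_le_zero)+
    have "b \<le> a * b" using a1 by simp
    then have "real b \<le> real (a * b)" by (simp only: of_nat_le_iff)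
    then have "real b \<le> y" using n1 by linarith
    then have "b \<in> B" using n a1 unfolding B_def pos_le_def by simp
    moreover have "a \<in> pos_le (y / b)" using a1 n1 by (auto simp: pos_le_def field_simps)
    ultimately show "n \<in> (\<lambda>(b, a). a * b) ` (Sigma B (\<lambda>b. pos_le (y / real b)))" using n by force
  qed
  then have "card ?G \<le> card (Sigma B (\<lambda>b. pos_le (y / real b)))"
    by (meson card_image_le card_mono finB finite_SigmaI finite_imageI finite_pos_le order_trans)
  also have "\<dots> = (\<Sum>b\<in>B. card (pos_le (y / real b)))" using finB by (simp add: card_SigmaI)
  finally have "real (card ?G) \<le> (\<Sum>b\<in>B. real (card (pos_le (y / real b))))" by (simp only: of_nat_le_iff of_nat_sum[symmetric])
  also have "\<dots> \<le> (\<Sum>b\<in>B. y / b)" by (rule sum_mono) (use assms in \<open>auto intro!: card_pos_le\<close>)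
  finally have "\<kappa> * real (card ?G) \<le> \<kappa> * (\<Sum>b\<in>B. y / b)" using assms by (intro mult_left_mono)
  also have "\<dots> = (\<Sum>b\<in>B. \<kappa> * (y / b))" by (simp add: sum_distrib_left)
  also have "\<dots> \<le> (\<Sum>b\<in>B. real (card (?A b)))"
  proof (rule sum_mono)
    fix b assume b: "b \<in> B"
    then have "\<theta> * f b = 1 \<or> \<theta> * f b = -1" using B(5)[OF b] \<theta> by auto
    from sm[OF B(1)[OF b] B(3,4)[OF b] this] show "\<kappa> * (y / b) \<le> real (card (?A b))" by (simp add: smooth_cnt_def)
  qed
  also have "\<dots> = real (card (Sigma B ?A))" using finB by (simp add: card_SigmaI)
  also have "\<dots> \<le> real (card {n \<in> pos_le y. f n = \<theta>})"
  proof (subst of_nat_le_iff, rule card_inj_on_le[where f="\<lambda>(b, a). a * b"])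
    show "inj_on (\<lambda>(b, a). a * b) (Sigma B ?A)"
    proof (rule inj_onI, clarify)
      fix b a b' a' assume h: "b \<in> B" "a \<in> pos_le (y / b)" "smooth_nat w a" "b' \<in> B" "smooth_nat w a'" "a * b = a' * b'"
      show "b = b' \<and> a = a'"
        using smooth_rough_unique[OF h(6,3,5) B(2)[OF h(1)] B(2)[OF h(4)]] h(2) by (auto simp: pos_le_def)
    qed
    show "(\<lambda>(b, a). a * b) ` (Sigma B ?A) \<subseteq> {n \<in> pos_le y. f n = \<theta>}"
    proof clarify
      fix b a assume b: "b \<in> B" and a: "a \<in> pos_le (y / b)" "f a = \<theta> * f b"
      have "f (a * b) = \<theta>" using B(5)[OF b] by (auto simp: f_mult a(2))
      moreover have "a * b \<in> pos_le y" using a(1) B(1)[OF b] by (auto simp: pos_le_def field_simps)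
      ultimately show "a * b \<in> pos_le y \<and> f (a * b) = \<theta>" by simp
    qed
  qed simp
  finally show ?thesis by (simp add: cnt_def)
qed

text \<open>Up to w^6, with w = z^(2^48), the smooth integers alone suffice; beyond, y/b falls back
  into that range for at least an eighth of all n.\<close>

lemma both_signs_large:
  assumes mass: "1 / 16 < neg_mass f z" "neg_mass f z \<le> 1 / 8" and z: "1 \<le> z" "ln z \<ge> 6000"
    and y: "z \<le> y" "y \<le> M" and \<theta>: "\<theta> = 1 \<or> \<theta> = -1"
  shows "cnt f \<theta> y \<ge> sign_density * y"
proof -
  define A :: real where "A = 2 ^ 48"
  define w where "w = exp (A * ln z)"
  define \<kappa>1 where "\<kappa>1 = 1 / (576 * 256 * 128 * A\<^sup>2)"
  define \<kappa>2 where "\<kappa>2 = \<kappa>1 / 96 ^ 20"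
  have \<kappa>: "\<kappa>1 \<ge> 0" "\<kappa>2 \<ge> 0" by (simp_all add: \<kappa>1_def \<kappa>2_def)
  have sd: "sign_density = \<kappa>2 / 8" by (simp add: sign_density_def \<kappa>2_def \<kappa>1_def A_def)
  have A: "A \<ge> 1" "A \<ge> 2" by (simp_all add: A_def)
  have lw: "ln w = A * ln z" by (simp add: w_def)
  have lw2: "ln w \<ge> 2 * ln z" unfolding lw using A z by (intro mult_right_mono) auto
  have zM: "z \<le> M" using y by linarith
  have w0: "w > 0" by (simp add: w_def)
  have y0: "y > 0" using y z by linarith
  have sm: "smooth_cnt f w \<theta> x \<ge> \<kappa>2 * x" if "z \<le> x" "ln x \<le> 6 * ln w" "x \<le> M" "\<theta> = 1 \<or> \<theta> = -1" for x \<theta>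
    unfolding \<kappa>2_def
  proof (rule both_signs_extend[OF z(1) w0 lw2 _ \<kappa>(1)])
    show "\<kappa>1 * x \<le> smooth_cnt f w \<theta> x" if "z \<le> x" "x \<le> w" "x \<le> M" "\<theta> = 1 \<or> \<theta> = -1" for x \<theta>
      unfolding \<kappa>1_def by (rule both_signs_medium[OF mass z(1) zM z(2) A(1) w_def that])
    show "160 \<le> ln w" using lw2 z by linarith
  qed (use that in auto)
  show ?thesis
  proof (cases "ln y \<le> 6 * ln w")
    case True
    have "\<kappa>2 * y \<le> smooth_cnt f w \<theta> y" by (rule sm) (use y True \<theta> in auto)
    also have "\<dots> \<le> cnt f \<theta> y" unfolding smooth_cnt_def cnt_def by (simp, rule card_mono) auto
    finally have "\<kappa>2 * y \<le> cnt f \<theta> y" .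
    moreover have "0 \<le> \<kappa>2 * y" using \<kappa>(2) y0 by (intro mult_nonneg_nonneg) auto
    moreover have "sign_density * y = \<kappa>2 * y / 8" by (simp add: sd)
    ultimately show ?thesis by linarith
  next
    case False
    have wy: "w \<le> y"
    proof -
      have "ln w \<le> ln y" using False lw2 z by linarith
      then show ?thesis using w0 y0 by simp
    qed
    have y8: "y \<ge> 8"
    proof -
      have "ln 8 \<le> ln y" using ln_le_minus_one[of 8] z y False lw2 by linarith
      then show ?thesis using y0 by simp
    qed
    have "\<kappa>2 * (y / 8) \<le> \<kappa>2 * real (card {n \<in> pos_le y. \<exists>a b. n = a * b \<and> smooth_nat w a \<and> rough_nat w b \<and> z \<le> y / b \<and> ln (y / b) \<le> 6 * ln w})"
      using card_good_split[OF z w_def[unfolded A_def] wy y8] \<kappa> by (intro mult_left_mono) auto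
    also have "\<dots> \<le> cnt f \<theta> y"
    proof (rule smooth_transfer[OF y(2) \<kappa>(2) y0 \<theta>])
      fix b :: nat and \<theta> :: int assume b: "b \<ge> 1" "z \<le> y / b" "ln (y / b) \<le> 6 * ln w" "\<theta> = 1 \<or> \<theta> = -1"
      have "y / b \<le> y / 1" using b y0 by (intro divide_left_mono) auto
      then have "y / b \<le> M" using y by simp
      then show "\<kappa>2 * (y / b) \<le> smooth_cnt f w \<theta> (y / b)" using sm b by blast
    qed
    finally show ?thesis unfolding sd by simp
  qed
qed

text \<open>The window around z requires ln z >= 6000, to make the Mertens error 20 negligible. A
  negative prime below exp 6000 could make z too small, but such a prime relates the two signs
  directly.\<close>

lemma both_signs:
  assumes y: "y \<le> M" "y \<ge> 2 * exp 6000" and mass: "neg_mass f y > 1 / 8" and \<theta>: "\<theta> = 1 \<or> \<theta> = -1"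
  shows "cnt f \<theta> y \<ge> min sign_density (1 / (4 * exp 6000)) * y"
proof (cases "\<exists>q\<in>neg_primes f y. real q \<le> exp 6000")
  case True
  then obtain q where q: "prime q" "f q = -1" "real q \<le> exp 6000" by (auto simp: neg_primes_def)
  have y0: "y > 0" using y exp_gt_zero[of "6000::real"] by linarith
  have q1: "real q \<ge> 1" using q prime_ge_1_nat by (simp add: Suc_leI prime_gt_0_nat)
  have q0: "real q > 0" using q1 by linarith
  have yq: "y / q \<le> y" using y0 q1 by (simp add: field_simps)
  \<comment> \<open>Multiplication by q flips the sign, so each of the two sign classes up to y/q
    injects into the class of \<theta> up to y, and one of them has at least half of the
    integers.\<close>
  have "cnt f \<theta> y \<ge> cnt f (-\<theta>) (y / q)"
    unfolding cnt_def
  proof (subst of_nat_le_iff, rule card_inj_on_le[where f="\<lambda>m. q * m"])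
    show "inj_on ((*) q) {n \<in> pos_le (y / q). f n = - \<theta>}" using q0 by (auto simp: inj_on_def)
    show "(*) q ` {n \<in> pos_le (y / q). f n = - \<theta>} \<subseteq> {n \<in> pos_le y. f n = \<theta>}"
      using q q0 by (auto simp: pos_le_def f_mult field_simps Suc_le_eq)
  qed simp
  moreover have "cnt f \<theta> y \<ge> cnt f \<theta> (y / q)"
    unfolding cnt_def
  proof (subst of_nat_le_iff, rule card_mono)
    show "{n \<in> pos_le (y / q). f n = \<theta>} \<subseteq> {n \<in> pos_le y. f n = \<theta>}"
      using yq by (auto simp: pos_le_def)
  qed simp
  moreover have "cnt f \<theta> (y / q) + cnt f (-\<theta>) (y / q) = card (pos_le (y / q))"
    using cnt_add[of "y / q"] yq y \<theta> by auto
  moreover have "y / q - 1 \<le> card (pos_le (y / q))" by (rule card_pos_le)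
  moreover have "y / q \<ge> y / exp 6000" using q q0 y0 by (intro divide_left_mono) auto
  moreover have "y / exp 6000 \<ge> 2" using y by (simp add: field_simps)
  ultimately have "cnt f \<theta> y \<ge> y / exp 6000 / 4" by linarith
  moreover have "min sign_density (1 / (4 * exp 6000)) * y \<le> 1 / (4 * exp 6000) * y"
    using y0 by (intro mult_right_mono) auto
  ultimately show ?thesis by simp
next
  case False
  have y0: "y > 0" using y exp_gt_zero[of "6000::real"] by linarith
  have fl: "neg_mass f (real (nat \<lfloor>y\<rfloor>)) > 1 / 16"
  proof -
    have "neg_primes f (real (nat \<lfloor>y\<rfloor>)) = neg_primes f y"
    proof -
      have "real q \<le> real (nat \<lfloor>y\<rfloor>) \<longleftrightarrow> real q \<le> y" for q
      proof -
        have "real q \<le> y \<longleftrightarrow> int q \<le> \<lfloor>y\<rfloor>" by (simp add: le_floor_iff)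
        then show ?thesis using y0 by auto
      qed
      then show ?thesis unfolding neg_primes_def by simp
    qed
    then show ?thesis using mass by (simp add: neg_mass_def)
  qed
  \<comment> \<open>The mass jumps only at negative primes, so z is one of them; as none lies below
    exp 6000, the jump 1/z is at most 1/16 and the mass at z at most 1/8.\<close>
  define z where "z = (LEAST n. neg_mass f (real n) > 1 / 16)"
  have z1: "neg_mass f (real z) > 1 / 16" unfolding z_def by (rule LeastI[of _ "nat \<lfloor>y\<rfloor>"]) (rule fl)
  have zmin: "neg_mass f (real n) \<le> 1 / 16" if "n < z" for n using not_less_Least[of n] that unfolding z_def by force
  have "z \<le> nat \<lfloor>y\<rfloor>" unfolding z_def by (rule Least_le) (rule fl)
  then have zy: "real z \<le> y" using y0 by (metis le_floor_iff le_nat_iff of_int_of_nat_eq order.strict_implies_order zero_le_floor)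
  have z0: "z \<noteq> 0"
  proof
    assume "z = 0"
    then have "neg_primes f (real z) = {}" by (auto simp: neg_primes_def)
    then show False using z1 by (simp add: neg_mass_def recip_sum_def)
  qed
  then obtain k where k: "z = Suc k" using not0_implies_Suc by blast
  have zk: "neg_mass f (real k) \<le> 1 / 16" using zmin k by simp
  have zin: "prime z \<and> f z = -1"
  proof (rule ccontr)
    assume no: "\<not> (prime z \<and> f z = -1)"
    have "neg_primes f (real z) = neg_primes f (real k)"
      unfolding neg_primes_def k
    proof (intro Collect_cong iffI)
      fix q assume q: "prime q \<and> real q \<le> real (Suc k) \<and> f q = - 1"
      then have "q \<noteq> Suc k" using no k by auto
      then show "prime q \<and> real q \<le> real k \<and> f q = - 1" using q by auto
    qed auto
    then show False using zk z1 by (simp add: neg_mass_def)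
  qed
  then have zbig: "real z > exp 6000" using False zy by (auto simp: neg_primes_def not_le)
  have "neg_primes f (real z) \<subseteq> insert z (neg_primes f (real k))"
    unfolding k neg_primes_def by (auto simp: le_Suc_eq)
  then have "neg_mass f (real z) \<le> recip_sum (insert z (neg_primes f (real k)))"
    unfolding neg_mass_def recip_sum_def by (intro sum_mono2) auto
  also have "\<dots> \<le> 1 / real z + neg_mass f (real k)"
    unfolding neg_mass_def recip_sum_def by (subst sum.insert_if) auto
  also have "\<dots> \<le> 1 / 16 + 1 / 16"
  proof -
    have "16 \<le> real z" using zbig exp_ge_add_one_self[of 6000] by linarith
    then have "1 / real z \<le> 1 / 16" by (intro divide_left_mono) auto
    then show ?thesis using zk by linarith
  qed
  finally have z2: "neg_mass f (real z) \<le> 1 / 8" by simp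
  have "ln (exp 6000) \<le> ln (real z)" using zbig by (intro ln_mono) auto
  then have "ln (real z) \<ge> 6000" by simp
  then have "cnt f \<theta> y \<ge> sign_density * y"
    using both_signs_large[OF z1 z2 _ _ zy y(1) \<theta>] z0 by simp
  moreover have "min sign_density (1 / (4 * exp 6000)) * y \<le> sign_density * y"
    using y0 by (intro mult_right_mono) auto
  ultimately show ?thesis by linarith
qed

end

section \<open>Density of residues and non-residues\<close>

definition legendre_fun :: "nat \<Rightarrow> nat \<Rightarrow> int" where
  "legendre_fun p n = Legendre (int n) (int p)"

lemma pm_mult_legendre:
  assumes "prime p" "2 < p" "M < real p"
  shows "pm_mult (legendre_fun p) M"
proof
  show "legendre_fun p (a * b) = legendre_fun p a * legendre_fun p b" for a b
    unfolding legendre_fun_def of_nat_mult by (rule Legendre_mult[OF assms(1,2)])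
  fix n assume n: "1 \<le> n" "real n \<le> M"
  have "\<not> [int n = 0] (mod int p)"
  proof
    assume "[int n = 0] (mod int p)"
    then have "p dvd n" by (simp add: cong_0_iff)
    then have "p \<le> n" using n by (intro dvd_imp_le) auto
    then show False using n assms by simp
  qed
  then show "legendre_fun p n = 1 \<or> legendre_fun p n = -1" by (simp add: legendre_fun_def Legendre_def)
qed

text \<open>Cancellation makes nearly half of the integers negative, and \<open>cnt_neg_le\<close>
  turns their number into mass. Cancellation alone costs v/2; the other v/2 absorbs the rounding,
  since v x >= 1.\<close>

lemma neg_mass_at_burgess:
  assumes p: "prime p" "2 < p" and x: "1 \<le> x" "x < real p"
    and S: "\<bar>\<Sum>n=1..nat \<lfloor>x\<rfloor>. real_of_int (Legendre (int n) (int p))\<bar> \<le> v * x" and xv: "1 / x \<le> v"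
  shows "neg_mass (legendre_fun p) x \<ge> 1 / 2 - v"
proof -
  let ?f = "legendre_fun p"
  interpret pm_mult ?f x by (rule pm_mult_legendre[OF p x(2)])
  have "(\<Sum>n=1..nat \<lfloor>x\<rfloor>. real_of_int (Legendre (int n) (int p))) = (\<Sum>n\<in>pos_le x. real_of_int (?f n))"
    by (simp add: pos_le_eq legendre_fun_def)
  also have "\<dots> = (\<Sum>n\<in>pos_le x. (if ?f n = 1 then 1 else 0) - (if ?f n = -1 then 1 else 0))"
  proof (rule sum.cong[OF refl])
    fix n assume "n \<in> pos_le x"
    then have "?f n = 1 \<or> ?f n = -1" using f_pm[of n] by (auto simp: pos_le_def)
    then show "real_of_int (?f n) = (if ?f n = 1 then 1 else 0) - (if ?f n = -1 then 1 else 0)" by auto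
  qed
  also have "\<dots> = cnt ?f 1 x - cnt ?f (-1) x"
    unfolding sum_subtractf cnt_def by (simp add: sum.If_cases Int_def)
  finally have "cnt ?f 1 x - cnt ?f (-1) x \<le> v * x" using S by linarith
  moreover have "cnt ?f 1 x + cnt ?f (-1) x \<ge> x - 1" using cnt_add[of x] card_pos_le(2)[of x] by simp
  moreover have "cnt ?f (-1) x \<le> x * neg_mass ?f x" by (rule cnt_neg_le) (use x in auto)
  ultimately have "x * (1 / 2 - v) \<le> x * neg_mass ?f x" if "1 \<le> v * x" using that by (simp add: algebra_simps)
  moreover have "1 \<le> v * x" using xv x by (simp add: divide_le_eq)
  ultimately show ?thesis using x by simp
qed

text \<open>48008 = 8 * 6001 turns ln y >= L/8 into y >= 2 exp 6000, as \<open>both_signs\<close>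
  demands; 1280 L^(-\<epsilon>) <= 1 serves the expansion of a logarithm in
  \<open>neg_mass_ge\<close>; the remaining conditions imply those of
  \<open>burgess_bound\<close>.\<close>

definition large_log :: "real \<Rightarrow> real \<Rightarrow> bool" where
  "large_log \<epsilon> L \<longleftrightarrow> 48008 \<le> L \<and> L powr (1 - \<epsilon>) * 160 \<le> L / 4 \<and> 16 * L ^ 3 \<le> exp (L / 4)
     \<and> 11776 * L ^ 6 \<le> exp (L powr (1 - \<epsilon>) / 2)
     \<and> exp (- (L powr (1 - 2 * \<epsilon>) / 4)) \<le> L powr (-\<epsilon>) / 2 \<and> 2 / L \<le> L powr (-\<epsilon>) / 2
     \<and> 1280 * L powr (-\<epsilon>) \<le> 1"

lemma eventually_large_log:
  assumes "0 < \<epsilon>" "\<epsilon> \<le> 1 / 8"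
  shows "eventually (large_log \<epsilon>) at_top"
proof -
  have 1: "\<forall>\<^sub>F L::real in at_top. 48008 \<le> L" by real_asymp
  have 2: "\<forall>\<^sub>F L::real in at_top. L powr (1 - \<epsilon>) * 160 \<le> L / 4" using assms by real_asymp
  have 3: "\<forall>\<^sub>F L::real in at_top. 16 * L ^ 3 \<le> exp (L / 4)" by real_asymp
  have 4: "\<forall>\<^sub>F L::real in at_top. 11776 * L ^ 6 \<le> exp (L powr (1 - \<epsilon>) / 2)" using assms by real_asymp
  have 5: "\<forall>\<^sub>F L::real in at_top. exp (- (L powr (1 - 2 * \<epsilon>) / 4)) \<le> L powr (-\<epsilon>) / 2" using assms by real_asymp
  have 6: "\<forall>\<^sub>F L::real in at_top. 2 / L \<le> L powr (-\<epsilon>) / 2" using assms by real_asymp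
  have 7: "\<forall>\<^sub>F L::real in at_top. 1280 * L powr (-\<epsilon>) \<le> 1" using assms by real_asymp
  show ?thesis using 1 2 3 4 5 6 7 by eventually_elim (auto simp: large_log_def)
qed

text \<open>Vinogradov's trick: the choice of the exponent 1 / (4 * sqrt e) makes the primes between y and the
  Burgess range carry reciprocal mass just below 1/2, so that some of the mass 1/2 of non-residue
  primes must lie below y.\<close>

lemma neg_mass_ge:
  fixes y L \<epsilon> :: real
  assumes p: "prime p" "2 < p" and \<epsilon>: "0 < \<epsilon>" "\<epsilon> \<le> 1 / 8" and L: "L = ln p" and large: "large_log \<epsilon> L"
    and y: "real p powr (1 / (4 * sqrt (exp 1))) * exp (160 * L powr (1 - \<epsilon>)) \<le> y"
  shows "neg_mass (legendre_fun p) y \<ge> L powr (-\<epsilon>)" and "ln y \<ge> L / 8" and "y > 0"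
proof -
  define u v s where "u = L powr (1 - \<epsilon>)" and "v = L powr (-\<epsilon>)" and "s = sqrt (exp (1::real))"
  note lg = large[unfolded large_log_def, folded u_def v_def]
  have L0: "L \<ge> 48008" using lg by simp
  have pL: "real p = exp L" using p L by simp
  have s1: "1 \<le> s" "s \<le> 2" "s > 0"
  proof -
    show "1 \<le> s" unfolding s_def by simp
    have "exp (1::real) \<le> 3" by (rule exp_le)
    then have "s \<le> sqrt 4" unfolding s_def by (intro real_sqrt_le_mono) simp
    then show "s \<le> 2" by simp
    show "s > 0" unfolding s_def by simp
  qed
  have lns: "ln s = 1 / 2" unfolding s_def by (simp add: ln_sqrt)
  \<comment> \<open>Through this identity the exponent 160 u is a relative change of ln y of order
    v, the order of the Burgess error.\<close>
  have uv: "u = L * v" unfolding u_def v_def using L0 powr_add[of L 1 "-\<epsilon>"] by simp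
  have v0: "v > 0" unfolding v_def using L0 by simp
  have u0: "u > 0" unfolding u_def using L0 by simp
  have v1: "v \<le> 1 / 1280" using lg by simp
  have Lv: "1 / L \<le> v"
    using lg v0 L0 by (simp add: field_simps)
  have yexp: "exp (L / (4 * s) + 160 * u) \<le> y"
    using y unfolding s_def[symmetric] u_def[symmetric] pL by (simp add: powr_def exp_add)
  then show y0: "y > 0" using exp_gt_zero less_le_trans by blast
  have lny: "L / (4 * s) + 160 * u \<le> ln y"
    using yexp y0 by (simp add: ln_ge_iff)
  have "L / 8 \<le> L / (4 * s)" using s1 L0 by (intro divide_left_mono) auto
  then show lny8: "L / 8 \<le> ln y" using lny u0 by linarith
  have lny0: "ln y > 0" using lny8 L0 by linarith
  define x where "x = exp (L / 4 + u)"
  have x0: "x > 0" by (simp add: x_def)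
  have lnx: "ln x = L / 4 + u" by (simp add: x_def)
  have u4: "u * 160 \<le> L / 4" using lg by simp
  have xp: "x < real p" unfolding x_def pL using u4 u0 L0 by simp
  have x1: "1 \<le> x" unfolding x_def using u0 L0 by simp
  have xL: "L \<le> x"
  proof -
    have "L + 1 \<le> 16 * L ^ 3"
    proof -
      have "L * 1 \<le> L * (L * L)" using L0 mult_mono[of 1 L 1 L] by (intro mult_left_mono) auto
      moreover have "L ^ 3 = L * (L * L)" by (simp add: power3_eq_cube)
      ultimately show ?thesis using L0 by linarith
    qed
    also have "\<dots> \<le> exp (L / 4)" using lg by simp
    also have "\<dots> \<le> x" unfolding x_def using u0 by simp
    finally show ?thesis by simp
  qed
  have S: "\<bar>\<Sum>n=1..nat \<lfloor>x\<rfloor>. real_of_int (Legendre (int n) (int p))\<bar> \<le> v * x"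
    unfolding v_def by (rule burgess_bound[OF p L _ \<epsilon> u_def x_def]) (use lg L0 u0 u4 u_def v_def in auto)
  have Tx: "neg_mass (legendre_fun p) x \<ge> 1 / 2 - v"
  proof (rule neg_mass_at_burgess[OF p x1 xp S])
    have "1 / x \<le> 1 / L" using xL L0 x0 by (intro divide_left_mono) auto
    then show "1 / x \<le> v" using Lv by linarith
  qed
  have "v \<le> neg_mass (legendre_fun p) y"
  proof (cases "x \<le> y")
    case True
    then show ?thesis using neg_mass_mono[OF True, of "legendre_fun p"] Tx v1 by linarith
  next
    case False
    then have yx: "y \<le> x" by simp
    have y2: "2 \<le> y"
    proof -
      have "ln 2 \<le> ln y" using lny8 L0 ln_le_minus_one[of 2] by linarith
      then show ?thesis using y0 by simp
    qed
    have "neg_mass (legendre_fun p) x - neg_mass (legendre_fun p) y \<le> (\<Sum>q\<in>primes_between y x. 1 / real q)"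
      by (rule neg_mass_diff_le[OF yx])
    also have "\<dots> \<le> ln (ln x / ln y) + 38 / ln y" by (rule mertens_recip_le[OF y2 yx])
    also have "38 / ln y \<le> 304 * v"
    proof -
      have "38 / ln y \<le> 38 / (L / 8)" using lny8 lny0 L0 by (intro divide_left_mono) auto
      also have "\<dots> = 304 * (1 / L)" by simp
      finally show ?thesis using Lv by linarith
    qed
    \<comment> \<open>The ratio is at most sqrt e (1 + 4 v) / (1 + 640 v), and ln (sqrt e) = 1/2 is
      the critical value. As 640 v <= 1/2, ln (1 + 640 v) >= 320 v, which outweighs 4 v, the Mertens
      error 304 v and the Burgess error v with 11 v to spare; 160 = 640 / 4 is chosen for
      this.\<close>
    also have "ln (ln x / ln y) \<le> 1 / 2 + 4 * v - 320 * v"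
    proof -
      have "ln x / ln y \<le> (L / 4 + u) / (L / (4 * s) + 160 * u)"
        unfolding lnx using lny u0 L0 s1 lny0 by (intro divide_left_mono mult_pos_pos add_pos_pos) auto
      also have "\<dots> = s * (1 + 4 * v) / (1 + 640 * s * v)"
      proof -
        have e1: "L / 4 + u = L / 4 * (1 + 4 * v)" unfolding uv by (simp add: algebra_simps)
        have e2: "L / (4 * s) + 160 * u = L / 4 * ((1 + 640 * s * v) / s)"
          unfolding uv using s1 by (simp add: field_simps)
        show ?thesis unfolding e1 e2 using L0 by simp
      qed
      also have "\<dots> \<le> s * (1 + 4 * v) / (1 + 640 * v)"
      proof (rule divide_left_mono)
        have "1 * v \<le> s * v" using s1 v0 by (intro mult_right_mono) auto
        then show "1 + 640 * v \<le> 1 + 640 * s * v" by simp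
        show "0 \<le> s * (1 + 4 * v)" using s1 v0 by simp
        show "0 < (1 + 640 * s * v) * (1 + 640 * v)" using s1 v0 by (intro mult_pos_pos add_pos_pos) auto
      qed
      finally have le: "ln x / ln y \<le> s * (1 + 4 * v) / (1 + 640 * v)" .
      have "0 < ln x / ln y" using lnx lny0 u0 L0 by (intro divide_pos_pos) auto
      then have "ln (ln x / ln y) \<le> ln (s * (1 + 4 * v) / (1 + 640 * v))" using le by (intro ln_mono) auto
      also have "\<dots> = 1 / 2 + ln (1 + 4 * v) - ln (1 + 640 * v)"
        using s1 v0 lns by (simp add: ln_div ln_mult)
      also have "ln (1 + 4 * v) \<le> 4 * v" using v0 by (intro ln_add_one_self_le_self) auto
      also have "1 / 2 + 4 * v - ln (1 + 640 * v) \<le> 1 / 2 + 4 * v - 320 * v"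
      proof -
        have "640 * v - (640 * v)\<^sup>2 \<le> ln (1 + 640 * v)"
          by (rule ln_one_plus_pos_lower_bound) (use v0 v1 in auto)
        moreover have "(640 * v)\<^sup>2 \<le> 1 / 2 * (640 * v)"
          unfolding power2_eq_square using v0 v1 by (intro mult_right_mono) auto
        ultimately show ?thesis by linarith
      qed
      finally show ?thesis by simp
    qed
    finally have "neg_mass (legendre_fun p) x - neg_mass (legendre_fun p) y \<le> 1 / 2 + 4 * v - 320 * v + 304 * v" by simp
    then show ?thesis using Tx v0 by linarith
  qed
  then show "neg_mass (legendre_fun p) y \<ge> L powr (-\<epsilon>)" unfolding v_def .
qed

section \<open>Lower bounds below p\<close>

definition base_density :: real where
  "base_density = min (1 / 18) (min sign_density (1 / (4 * exp 6000)))"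

lemma base_density_pos: "base_density > 0"
  by (simp add: base_density_def sign_density_pos)

lemma cnt_legendre_ge:
  fixes y L \<epsilon> :: real
  assumes p: "prime p" "2 < p" and \<epsilon>: "0 < \<epsilon>" "\<epsilon> \<le> 1 / 8" and L: "L = ln p" and large: "large_log \<epsilon> L"
    and y: "real p powr (1 / (4 * sqrt (exp 1))) * exp (160 * L powr (1 - \<epsilon>)) \<le> y" "y < real p"
    and \<theta>: "\<theta> = 1 \<or> \<theta> = -1"
  shows "cnt (legendre_fun p) \<theta> y \<ge> base_density * y * L powr (-\<epsilon>)"
proof -
  let ?f = "legendre_fun p" and ?v = "L powr (-\<epsilon>)"
  interpret pm_mult ?f y by (rule pm_mult_legendre[OF p y(2)])
  note T = neg_mass_ge[OF p \<epsilon> L large y(1)]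
  have L0: "L \<ge> 48008" and v1: "1280 * ?v \<le> 1" using large by (simp_all add: large_log_def)
  have v0: "?v \<ge> 0" by simp
  have ybig: "y \<ge> 2 * exp 6000"
  proof -
    have "(2::real) \<le> exp 1" using exp_ge_add_one_self[of 1] by simp
    then have "2 * exp 6000 \<le> exp 1 * exp (6000::real)" by (intro mult_right_mono) auto
    also have "\<dots> = exp 6001" by (simp add: exp_add[symmetric])
    also have "\<dots> \<le> exp (ln y)" using T(2) L0 by simp
    finally show ?thesis using T(3) by simp
  qed
  have y1: "1 \<le> y" using ybig exp_ge_add_one_self[of 6000] by linarith
  show ?thesis
  proof (cases "neg_mass ?f y \<le> 1 / 8")
    case True
    have "base_density * (y * ?v) \<le> 1 / 18 * (y * ?v)"
      using y1 v0 by (intro mult_right_mono) (auto simp: base_density_def)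
    then have bd: "base_density * y * ?v \<le> (y * ?v) / 18" by (simp only: mult.assoc)
    from \<theta> show ?thesis
    proof
      assume t: "\<theta> = 1"
      have "y * ?v \<le> y * 1" using v1 y1 by (intro mult_left_mono) auto
      moreover have "y / 4 \<le> cnt ?f 1 y" by (rule cnt_pos_ge) (use True y1 in auto)
      ultimately show ?thesis using bd y1 unfolding t by linarith
    next
      assume t: "\<theta> = -1"
      have "y * ?v \<le> y * neg_mass ?f y" using T(1) y1 by (intro mult_left_mono) auto
      moreover have "y * neg_mass ?f y / 18 \<le> cnt ?f (-1) y" by (rule cnt_neg_ge) (use True y1 in auto)
      ultimately show ?thesis using bd unfolding t by linarith
    qed
  next
    case False
    have "base_density * y * ?v \<le> base_density * y * 1"
      using v1 y1 base_density_pos by (intro mult_left_mono) auto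
    also have "\<dots> \<le> min sign_density (1 / (4 * exp 6000)) * y"
      using y1 by (simp only: mult_1_right, intro mult_right_mono) (auto simp: base_density_def)
    also have "\<dots> \<le> cnt ?f \<theta> y" by (rule both_signs) (use ybig False \<theta> in auto)
    finally show ?thesis .
  qed
qed

section \<open>Complete periods and small primes\<close>

lemma cnt_legendre_periodic:
  assumes p: "p > 0" and y: "real p \<le> y"
  shows "cnt (legendre_fun p) \<theta> y \<ge> y / (2 * real p) * cnt (legendre_fun p) \<theta> (real p - 1)"
proof -
  let ?f = "legendre_fun p"
  define K where "K = nat \<lfloor>y / p\<rfloor>"
  have p0: "real p > 0" using p by simp
  have yp: "1 \<le> y / p" using y p0 by simp
  have K: "real K \<le> y / p" "y / p \<le> 2 * real K" unfolding K_def by (rule nat_floor_bounds[OF yp])+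
  let ?R = "{n \<in> pos_le (real p - 1). ?f n = \<theta>}"
  have "card ({..<K} \<times> ?R) \<le> card {n \<in> pos_le y. ?f n = \<theta>}"
  proof (rule card_inj_on_le[where f="\<lambda>(k, n). k * p + n"])
    have lt: "n < p" if "n \<in> ?R" for n using that by (auto simp: pos_le_def)
    show "inj_on (\<lambda>(k, n). k * p + n) ({..<K} \<times> ?R)"
    proof (rule inj_onI)
      fix s t assume st: "s \<in> {..<K} \<times> ?R" "t \<in> {..<K} \<times> ?R" "(\<lambda>(k, n). k * p + n) s = (\<lambda>(k, n). k * p + n) t"
      obtain k n k' n' where e: "s = (k, n)" "t = (k', n')" by (metis surj_pair)
      have n: "n < p" "n' < p" using lt st e by auto
      have eq: "k * p + n = k' * p + n'" using st(3) e by simp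
      have "(k * p + n) mod p = n" "(k' * p + n') mod p = n'" using n by auto
      then have "n = n'" using eq by simp
      then show "s = t" using eq e p by simp
    qed
    show "(\<lambda>(k, n). k * p + n) ` ({..<K} \<times> ?R) \<subseteq> {n \<in> pos_le y. ?f n = \<theta>}"
    proof (rule image_subsetI)
      fix s assume s: "s \<in> {..<K} \<times> ?R"
      obtain k n where e: "s = (k, n)" by (metis surj_pair)
      have k: "k \<in> {..<K}" and n: "n \<in> pos_le (real p - 1)" and fn: "?f n = \<theta>" using s e by auto
      have "[int (k * p + n) = int n] (mod int p)" by (simp add: cong_iff_dvd_diff)
      then have "?f (k * p + n) = ?f n" unfolding legendre_fun_def by (rule Legendre_cong)
      moreover have "k * p + n \<in> pos_le y"
      proof -
        have "Suc k \<le> K" using k by simp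
        then have "Suc k * p \<le> K * p" by (rule mult_le_mono1)
        then have "real (k * p + p) \<le> real K * real p" by (metis add.commute mult_Suc of_nat_le_iff of_nat_mult)
        also have "\<dots> \<le> y" using K(1) p0 by (simp add: field_simps)
        finally show ?thesis using n by (auto simp: pos_le_def)
      qed
      ultimately show "(\<lambda>(k, n). k * p + n) s \<in> {n \<in> pos_le y. ?f n = \<theta>}" using e fn by simp
    qed
  qed simp
  then have "real K * cnt ?f \<theta> (real p - 1) \<le> cnt ?f \<theta> y"
    unfolding cnt_def by (simp add: card_cartesian_product) (metis of_nat_le_iff of_nat_mult)
  moreover have "y / (2 * real p) * cnt ?f \<theta> (real p - 1) \<le> real K * cnt ?f \<theta> (real p - 1)"
    using K(2) by (intro mult_right_mono) (auto simp: cnt_def)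
  ultimately show ?thesis by linarith
qed

text \<open>A non-residue exists because squaring identifies 1 and p - 1, hence is not onto the
  finite set {1..p-1}; any value it misses will do.\<close>

lemma ex_legendre_sign:
  assumes p: "prime p" "2 < p" and \<theta>: "\<theta> = 1 \<or> \<theta> = -1"
  shows "cnt (legendre_fun p) \<theta> (real p - 1) \<ge> 1"
proof -
  let ?f = "legendre_fun p" and ?X = "{1..p - 1}"
  have X: "?X = pos_le (real p - 1)" using p by (auto simp: pos_le_def of_nat_diff)
  have nz: "\<not> [int n = 0] (mod int p)" if "n \<in> ?X" for n
    using that p by (auto simp: cong_0_iff dest!: dvd_imp_le)
  have "\<exists>n\<in>?X. ?f n = \<theta>"
  proof (cases "\<theta> = 1")
    case True
    have "QuadRes (int p) 1" unfolding QuadRes_def by (rule exI[of _ 1]) simp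
    then have "?f 1 = 1" using nz[of 1] p by (simp add: legendre_fun_def Legendre_def)
    then show ?thesis using True p by (intro bexI[of _ 1]) auto
  next
    case False
    then have t: "\<theta> = -1" using \<theta> by simp
    let ?sq = "\<lambda>n. n * n mod p"
    have sub: "?sq ` ?X \<subseteq> ?X"
    proof
      fix m assume "m \<in> ?sq ` ?X"
      then obtain n where n: "n \<in> ?X" "m = n * n mod p" by auto
      have "\<not> p dvd n" using n p by (auto dest: dvd_imp_le)
      then have "\<not> p dvd n * n" using p by (simp add: prime_dvd_mult_iff)
      then have "m \<noteq> 0" using n by (simp add: dvd_eq_mod_eq_0)
      moreover have "m < p" using n p by simp
      ultimately show "m \<in> ?X" by auto
    qed
    have "\<not> inj_on ?sq ?X"
    proof
      assume inj: "inj_on ?sq ?X"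
      obtain k where k: "p = k + 2" using p by (metis add.commute le_add_diff_inverse less_imp_le)
      have "(p - 1) * (p - 1) = k * p + 1" unfolding k by (simp add: algebra_simps)
      then have "?sq (p - 1) = 1" using p by (simp only: mod_mult_self3) simp
      moreover have "?sq 1 = 1" using p by simp
      ultimately have "p - 1 = 1" using inj p by (auto simp: inj_on_def)
      then show False using p by simp
    qed
    then have "?sq ` ?X \<noteq> ?X" using finite_surj_inj[of ?X ?sq] by auto
    then obtain a where a: "a \<in> ?X" "a \<notin> ?sq ` ?X" using sub by blast
    have "\<not> QuadRes (int p) (int a)"
    proof
      assume "QuadRes (int p) (int a)"
      then obtain z where z: "[z\<^sup>2 = int a] (mod int p)" unfolding QuadRes_def by blast
      define n where "n = nat (z mod int p)"
      have n: "int n = z mod int p" unfolding n_def using p by simp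
      have "[int n * int n = int a] (mod int p)" unfolding n
        using z mod_mult_eq[of z "int p" z] unfolding Cong.cong_def power2_eq_square by simp
      then have c: "[n * n = a] (mod p)" by (simp add: cong_int_iff[symmetric])
      have "a < p" using a p by auto
      then have "n * n mod p = a" using c by (simp add: Cong.cong_def)
      moreover have "n < p" using n p by (metis of_nat_less_iff pos_mod_bound of_nat_0_less_iff prime_gt_0_nat)
      moreover have "n \<noteq> 0" using calculation(1) a by auto
      ultimately show False using a by auto
    qed
    then have "?f a = -1" using nz[OF a(1)] by (simp add: legendre_fun_def Legendre_def)
    then show ?thesis using a t by blast
  qed
  then have "{n \<in> pos_le (real p - 1). ?f n = \<theta>} \<noteq> {}" using X by auto
  then have "card {n \<in> pos_le (real p - 1). ?f n = \<theta>} \<ge> 1" by (simp add: Suc_le_eq card_gt_0_iff)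
  then show ?thesis unfolding cnt_def by simp
qed

lemma xi_le: "xi \<le> 1 / 8"
  unfolding xi_def using pi_ge_two by (simp add: field_simps)

theorem theorem1p2:
  fixes \<epsilon> :: real
  assumes "0 < \<epsilon>" and "\<epsilon> \<le> xi"
  shows "\<exists>c>0. \<exists>\<kappa>>0. \<forall>(p::nat) (\<theta>::int) (y::real).
           prime p \<longrightarrow> odd p \<longrightarrow> \<theta> \<in> {1, -1} \<longrightarrow>
           y \<ge> real p powr (1 / (4 * sqrt (exp 1))) * exp (c * ln (real p) powr (1 - \<epsilon>)) \<longrightarrow>
           real (card {n::nat. n \<ge> 1 \<and> real n \<le> y \<and> Legendre (int n) (int p) = \<theta>})
             \<ge> \<kappa> * (y / ln y powr \<epsilon>)"
proof -
  have \<epsilon>: "0 < \<epsilon>" "\<epsilon> \<le> 1 / 8" using assms xi_le by auto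
  obtain L0 where L0: "\<And>L. L \<ge> L0 \<Longrightarrow> large_log \<epsilon> L"
    using eventually_large_log[OF \<epsilon>] unfolding eventually_at_top_linorder by blast
  define L1 where "L1 = max 1 L0"
  \<comment> \<open>For primes with L < L1 the second entry gives c L^(1-\<epsilon>) >= L, hence y
    >= p, and complete periods settle the case.\<close>
  define c where "c = max 160 (L1 powr \<epsilon>)"
  \<comment> \<open>The first entry is for L >= L1: its 1/8 covers the passage from L to ln y below
    p and the loss at incomplete periods above. The second is for L < L1, where each period of
    length p < exp L1 contains at least one integer of either sign.\<close>
  define \<kappa> where "\<kappa> = min (base_density / 8) (1 / (2 * exp L1))"
  have \<kappa>0: "\<kappa> > 0" unfolding \<kappa>_def using base_density_pos by simp
  show ?thesis
  proof (rule exI[of _ c], rule conjI[rotated], rule exI[of _ \<kappa>], intro conjI allI impI)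
    show "c > 0" by (simp add: c_def)
    show "\<kappa> > 0" by (rule \<kappa>0)
    fix p :: nat and \<theta> :: int and y :: real
    assume pr: "prime p" and od: "odd p" and th: "\<theta> \<in> {1, -1}"
      and y: "y \<ge> real p powr (1 / (4 * sqrt (exp 1))) * exp (c * ln (real p) powr (1 - \<epsilon>))"
    have p2: "2 < p" using pr od prime_ge_2_nat[of p] by (cases "p = 2") auto
    have \<theta>: "\<theta> = 1 \<or> \<theta> = -1" using th by auto
    let ?f = "legendre_fun p"
    define L where "L = ln (real p)"
    have p0: "real p > 0" using p2 by simp
    have pL: "real p = exp L" using p0 by (simp add: L_def)
    have L1': "L \<ge> 1"
    proof -
      have "exp (1::real) \<le> 3" by (rule exp_le)
      then have "exp 1 \<le> real p" using p2 by linarith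
      then show ?thesis unfolding pL by simp
    qed
    have goal: "real (card {n::nat. n \<ge> 1 \<and> real n \<le> y \<and> Legendre (int n) (int p) = \<theta>}) = cnt ?f \<theta> y"
      unfolding cnt_def pos_le_def legendre_fun_def by (simp add: conj_assoc)
    have pge: "1 \<le> real p powr (1 / (4 * sqrt (exp 1)))" using p2 by (intro ge_one_powr_ge_zero) auto
    have "cnt ?f \<theta> y \<ge> \<kappa> * (y / ln y powr \<epsilon>)"
    proof (cases "L \<ge> L1")
      case True
      then have large: "large_log \<epsilon> L" using L0 by (simp add: L1_def)
      have "160 * L powr (1 - \<epsilon>) \<le> c * L powr (1 - \<epsilon>)" unfolding c_def by (intro mult_right_mono) auto
      then have y160: "real p powr (1 / (4 * sqrt (exp 1))) * exp (160 * L powr (1 - \<epsilon>)) \<le> y"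
        using y mult_left_mono[of "exp (160 * L powr (1 - \<epsilon>))" "exp (c * L powr (1 - \<epsilon>))"
            "real p powr (1 / (4 * sqrt (exp 1)))"]
        unfolding L_def[symmetric] by simp
      note T = neg_mass_ge[OF pr p2 \<epsilon> L_def large y160]
      have lny: "ln y > 0" using T(2) L1' by linarith
      show ?thesis
      proof (cases "y < real p")
        case True
        have "L powr \<epsilon> \<le> (8 * ln y) powr \<epsilon>" using T(2) \<epsilon> L1' by (intro powr_mono2) auto
        also have "\<dots> = 8 powr \<epsilon> * ln y powr \<epsilon>" using lny by (simp add: powr_mult)
        also have "\<dots> \<le> 8 * ln y powr \<epsilon>"
          using \<epsilon> powr_mono[of \<epsilon> 1 8] by (intro mult_right_mono) auto
        finally have le: "L powr \<epsilon> \<le> 8 * ln y powr \<epsilon>" .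
        have "\<kappa> * (y / ln y powr \<epsilon>) \<le> base_density / 8 * (y / ln y powr \<epsilon>)"
          using T(3) by (intro mult_right_mono) (auto simp: \<kappa>_def)
        also have "\<dots> = base_density * y * (1 / (8 * ln y powr \<epsilon>))" by simp
        also have "\<dots> \<le> base_density * y * (1 / L powr \<epsilon>)"
          using le L1' T(3) base_density_pos by (intro mult_left_mono divide_left_mono) (auto intro!: mult_pos_pos)
        also have "\<dots> = base_density * y * L powr (-\<epsilon>)" by (simp add: powr_minus_divide)
        also have "\<dots> \<le> cnt ?f \<theta> y" by (rule cnt_legendre_ge[OF pr p2 \<epsilon> L_def large y160 True \<theta>])
        finally show ?thesis .
      next
        case False
        then have yp: "real p \<le> y" by simp
        let ?s = "sqrt (exp 1) :: real"
        \<comment> \<open>The bound below p is applied at p - 1, which exhausts the nonzero classes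
          of a period. It is admissible because the two exponents are at most L/4 each.\<close>
        have "real p powr (1 / (4 * ?s)) * exp (160 * L powr (1 - \<epsilon>)) \<le> real p - 1"
        proof -
          have "1 \<le> ?s" by simp
          then have "L / (4 * ?s) \<le> L / 4" using L1' by (intro divide_left_mono) auto
          moreover have "160 * L powr (1 - \<epsilon>) \<le> L / 4" using large by (simp add: large_log_def)
          ultimately have e: "L / (4 * ?s) + 160 * L powr (1 - \<epsilon>) \<le> L / 2" by linarith
          have "real p powr (1 / (4 * ?s)) * exp (160 * L powr (1 - \<epsilon>)) = exp (L / (4 * ?s) + 160 * L powr (1 - \<epsilon>))"
            unfolding pL by (simp add: powr_def exp_add)
          also have "\<dots> \<le> exp (L / 2)" using e by simp
          also have "\<dots> \<le> exp L - 1"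
          proof -
            have "2 \<le> exp (L / 2)"
            proof -
              have "L / 2 + 1 \<le> exp (L / 2)" using exp_ge_add_one_self[of "L / 2"] by linarith
              moreover have "L \<ge> 48008" using large by (simp add: large_log_def)
              ultimately show ?thesis by linarith
            qed
            then have "2 * exp (L / 2) \<le> exp (L / 2) * exp (L / 2)" by (intro mult_right_mono) auto
            also have "\<dots> = exp L" by (simp add: exp_add[symmetric])
            finally show ?thesis using \<open>2 \<le> exp (L / 2)\<close> by linarith
          qed
          finally show ?thesis unfolding pL .
        qed
        then have cp: "base_density * (real p - 1) * L powr (-\<epsilon>) \<le> cnt ?f \<theta> (real p - 1)"
          by (intro cnt_legendre_ge[OF pr p2 \<epsilon> L_def large _ _ \<theta>]) auto
        have "L powr \<epsilon> \<le> ln y powr \<epsilon>"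
          using yp p0 \<epsilon> L1' unfolding L_def by (intro powr_mono2) auto
        then have "1 / ln y powr \<epsilon> \<le> 1 / L powr \<epsilon>" using L1' lny by (intro divide_left_mono) (auto intro!: mult_pos_pos)
        then have inv: "1 / ln y powr \<epsilon> \<le> L powr (-\<epsilon>)" by (simp add: powr_minus_divide)
        have "\<kappa> * (y / ln y powr \<epsilon>) \<le> base_density / 8 * (y / ln y powr \<epsilon>)"
          using T(3) by (intro mult_right_mono) (auto simp: \<kappa>_def)
        also have "\<dots> = base_density / 8 * y * (1 / ln y powr \<epsilon>)" by simp
        also have "\<dots> \<le> base_density / 8 * y * L powr (-\<epsilon>)"
          using inv T(3) base_density_pos by (intro mult_left_mono) auto
        also have "\<dots> \<le> y / (2 * real p) * (base_density * (real p - 1) * L powr (-\<epsilon>))"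
        proof -
          have "1 / 8 \<le> (real p - 1) / (2 * real p)" using p2 by (simp add: field_simps)
          then have "(base_density * y * L powr (-\<epsilon>)) * (1 / 8) \<le> (base_density * y * L powr (-\<epsilon>)) * ((real p - 1) / (2 * real p))"
            using T(3) base_density_pos by (intro mult_left_mono) auto
          then show ?thesis by (simp add: mult_ac)
        qed
        also have "\<dots> \<le> y / (2 * real p) * cnt ?f \<theta> (real p - 1)"
          using cp T(3) by (intro mult_left_mono) auto
        also have "\<dots> \<le> cnt ?f \<theta> y" by (rule cnt_legendre_periodic) (use p2 yp in auto)
        finally show ?thesis .
      qed
    next
      case False
      have yp: "real p \<le> y"
      proof -
        have "L powr \<epsilon> \<le> L1 powr \<epsilon>" using False L1' \<epsilon> by (intro powr_mono2) auto
        then have "L powr \<epsilon> \<le> c" by (simp add: c_def)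
        then have "L powr \<epsilon> * L powr (1 - \<epsilon>) \<le> c * L powr (1 - \<epsilon>)" by (intro mult_right_mono) auto
        moreover have "L powr \<epsilon> * L powr (1 - \<epsilon>) = L" using L1' by (simp add: powr_add[symmetric])
        ultimately have "exp L \<le> exp (c * L powr (1 - \<epsilon>))" by simp
        also have "\<dots> \<le> real p powr (1 / (4 * sqrt (exp 1))) * exp (c * L powr (1 - \<epsilon>))"
          using pge mult_right_mono[of 1 "real p powr (1 / (4 * sqrt (exp 1)))" "exp (c * L powr (1 - \<epsilon>))"] by simp
        finally show ?thesis using y pL unfolding L_def by linarith
      qed
      have y0: "y > 0" using yp p0 by linarith
      have "1 \<le> ln y"
      proof -
        have "L \<le> ln y" unfolding L_def using yp p0 by simp
        then show ?thesis using L1' by linarith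
      qed
      then have "1 \<le> ln y powr \<epsilon>" using \<epsilon> by (intro ge_one_powr_ge_zero) auto
      then have "y / ln y powr \<epsilon> \<le> y / 1" using y0 by (intro divide_left_mono) auto
      then have "\<kappa> * (y / ln y powr \<epsilon>) \<le> \<kappa> * y" using \<kappa>0 by (intro mult_left_mono) auto
      also have "\<dots> \<le> 1 / (2 * exp L1) * y" using y0 by (intro mult_right_mono) (auto simp: \<kappa>_def)
      also have "\<dots> \<le> 1 / (2 * real p) * y"
        unfolding pL using False y0 by (intro mult_right_mono divide_left_mono) auto
      also have "\<dots> \<le> y / (2 * real p) * cnt ?f \<theta> (real p - 1)"
        using mult_left_mono[OF ex_legendre_sign[OF pr p2 \<theta>], of "y / (2 * real p)"] y0 by simp
      also have "\<dots> \<le> cnt ?f \<theta> y" by (rule cnt_legendre_periodic) (use p2 yp in auto)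
      finally show ?thesis .
    qed
    then show "real (card {n::nat. n \<ge> 1 \<and> real n \<le> y \<and> Legendre (int n) (int p) = \<theta>}) \<ge> \<kappa> * (y / ln y powr \<epsilon>)"
      unfolding goal .
  qed
qed

end
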